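(* The truncated Fourier–Plancherel operator $\mathscr{F}_{\mathbb{R}^{+}}$ is unitarily equivalent to the multiplication operator $\mathcal{M}_F$ on $\mathfrak{M}$: the operator $U:L^2(\mathbb{R}^{+})\to\mathfrak{M}$ is unitary and $$\mathscr{F}_{\mathbb{R}^{+}}=U^{-1}\mathcal{M}_F\,U.$$
   Context: $\mathbb{R}^{+}=(0,\infty)$; $\Gamma$ is Euler's Gamma function; $\xi^{\zeta}=e^{\zeta\ln\xi}$ with real $\ln\xi$. The truncated Fourier–Plancherel operator $\mathscr{F}_{\mathbb{R}^{+}}:L^2(\mathbb{R}^{+})\to L^2(\mathbb{R}^{+})$ is $P_{\mathbb{R}^{+}}\mathscr{F}|_{L^2(\mathbb{R}^{+})}$, where $\mathscr{F}$ is the unitary Fourier–Plancherel operator on $L^2(\mathbb{R})$, $(\mathscr{F}x)(t)=\frac{1}{\sqrt{2\pi}}\int_{\mathbb{R}}x(\xi)e^{it\xi}d\xi$, and $P_{\mathbb{R}^{+}}$ is multiplication by the indicator of $\mathbb{R}^{+}$; for integrable $x$, $(\mathscr{F}_{\mathbb{R}^{+}}x)(t)=\frac{1}{\sqrt{2\pi}}\int_{\mathbb{R}^{+}}x(\xi)e^{it\xi}d\xi$. The model space $\mathfrak{M}$ consists of columns $\begin{bmatrix}\varphi_+\\ \varphi_-\end{bmatrix}$, $\varphi_\pm\in L^2(\mathbb{R}^{+})$, with inner product $\langle\varphi_+,\psi_+\rangle_{L^2(\mathbb{R}^{+})}+\langle\varphi_-,\psi_-\rangle_{L^2(\mathbb{R}^{+})}$.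 The operator $U$ is defined on $\mathcal{D}=\{x\in L^2(\mathbb{R}^{+}):\int_{\mathbb{R}^{+}}|x(\xi)|\xi^{-1/2}d\xi<\infty\}$ by $(Ux)_{\pm}(\mu)=\frac{1}{\sqrt{2\pi}}\int_{\mathbb{R}^{+}}x(\xi)\xi^{-1/2}\xi^{\pm i\mu}d\xi$, $\mu>0$, is isometric there, and is extended by continuity to $L^2(\mathbb{R}^{+})$. For $\mu>0$ let $F(\mu)=\begin{bmatrix}0&F_{+-}(\mu)\\ F_{-+}(\mu)&0\end{bmatrix}$ with $F_{+-}(\mu)=\frac{1}{\sqrt{2\pi}}e^{i\pi/4}e^{-\pi\mu/2}\Gamma(\tfrac12+i\mu)$ and $F_{-+}(\mu)=\frac{1}{\sqrt{2\pi}}e^{i\pi/4}e^{\pi\mu/2}\Gamma(\tfrac12-i\mu)$. The multiplication operator $\mathcal{M}_F$ on $\mathfrak{M}$ is $(\mathcal{M}_Fy)(\mu)=F(\mu)y(\mu)$. *)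

theory Defs
  imports "HOL-Analysis.Analysis"
begin

section \<open>L^2(R^+): functions modulo a.e. equality, represented by Borel representatives\<close>

definition L2pos :: "(real \<Rightarrow> complex) set" where
  "L2pos = {f. f \<in> borel_measurable lborel \<and>
                set_integrable lborel {0<..} (\<lambda>t. (cmod (f t))\<^sup>2)}"

definition L2pos_inner :: "(real \<Rightarrow> complex) \<Rightarrow> (real \<Rightarrow> complex) \<Rightarrow> complex" where
  "L2pos_inner f g = (LINT t:{0<..}|lborel. f t * cnj (g t))"

definition L2pos_dist :: "(real \<Rightarrow> complex) \<Rightarrow> (real \<Rightarrow> complex) \<Rightarrow> real" where
  "L2pos_dist f g = sqrt (LINT t:{0<..}|lborel. (cmod (f t - g t))\<^sup>2)"

definition L2pos_conv :: "(nat \<Rightarrow> real \<Rightarrow> complex) \<Rightarrow> (real \<Rightarrow> complex) \<Rightarrow> bool" where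
  "L2pos_conv s y \<longleftrightarrow> (\<forall>n. s n \<in> L2pos) \<and> y \<in> L2pos \<and>
      (\<lambda>n. L2pos_dist (s n) y) \<longlonglongrightarrow> 0"

definition L2pos_eq :: "(real \<Rightarrow> complex) \<Rightarrow> (real \<Rightarrow> complex) \<Rightarrow> bool" where
  "L2pos_eq f g \<longleftrightarrow> (AE t in lborel. t > 0 \<longrightarrow> f t = g t)"

definition L2R :: "(real \<Rightarrow> complex) set" where
  "L2R = {f. f \<in> borel_measurable lborel \<and> integrable lborel (\<lambda>t. (cmod (f t))\<^sup>2)}"

definition L2R_dist :: "(real \<Rightarrow> complex) \<Rightarrow> (real \<Rightarrow> complex) \<Rightarrow> real" where
  "L2R_dist f g = sqrt (LINT t|lborel. (cmod (f t - g t))\<^sup>2)"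

definition L2R_conv :: "(nat \<Rightarrow> real \<Rightarrow> complex) \<Rightarrow> (real \<Rightarrow> complex) \<Rightarrow> bool" where
  "L2R_conv s y \<longleftrightarrow> (\<forall>n. s n \<in> L2R) \<and> y \<in> L2R \<and>
      (\<lambda>n. L2R_dist (s n) y) \<longlonglongrightarrow> 0"

definition fourier_int :: "(real \<Rightarrow> complex) \<Rightarrow> real \<Rightarrow> complex" where
  "fourier_int x t = complex_of_real (1 / sqrt (2 * pi)) *
      (LINT \<xi>|lborel. x \<xi> * exp (\<i> * complex_of_real (t * \<xi>)))"

text \<open>Fourier--Plancherel operator: continuous extension of the Fourier integral
  from L^1 \<inter> L^2 to L^2(R).\<close>
definition FP :: "(real \<Rightarrow> complex) \<Rightarrow> real \<Rightarrow> complex" where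
  "FP x = (SOME y. y \<in> L2R \<and>
      (\<exists>s. (\<forall>n. integrable lborel (s n)) \<and> L2R_conv s x \<and>
           L2R_conv (\<lambda>n. fourier_int (s n)) y))"

definition FRp :: "(real \<Rightarrow> complex) \<Rightarrow> real \<Rightarrow> complex" where
  "FRp x = (\<lambda>t. indicator {0<..} t * FP (\<lambda>\<xi>. indicator {0<..} \<xi> * x \<xi>) t)"

type_synonym mvec = "(real \<Rightarrow> complex) \<times> (real \<Rightarrow> complex)"

definition Mspace :: "mvec set" where
  "Mspace = {(p, m). p \<in> L2pos \<and> m \<in> L2pos}"

definition M_inner :: "mvec \<Rightarrow> mvec \<Rightarrow> complex" where
  "M_inner y z = L2pos_inner (fst y) (fst z) + L2pos_inner (snd y) (snd z)"

definition M_dist :: "mvec \<Rightarrow> mvec \<Rightarrow> real" where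
  "M_dist y z = sqrt ((L2pos_dist (fst y) (fst z))\<^sup>2 + (L2pos_dist (snd y) (snd z))\<^sup>2)"

definition M_conv :: "(nat \<Rightarrow> mvec) \<Rightarrow> mvec \<Rightarrow> bool" where
  "M_conv s y \<longleftrightarrow> (\<forall>n. s n \<in> Mspace) \<and> y \<in> Mspace \<and>
      (\<lambda>n. M_dist (s n) y) \<longlonglongrightarrow> 0"

definition M_eq :: "mvec \<Rightarrow> mvec \<Rightarrow> bool" where
  "M_eq y z \<longleftrightarrow> L2pos_eq (fst y) (fst z) \<and> L2pos_eq (snd y) (snd z)"

definition Udom :: "(real \<Rightarrow> complex) set" where
  "Udom = {x \<in> L2pos. set_integrable lborel {0<..} (\<lambda>\<xi>. cmod (x \<xi>) * \<xi> powr (-1/2))}"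

text \<open>\<open>\<xi>^(\<sigma> i \<mu>) = exp (\<sigma> i \<mu> ln \<xi>)\<close>, \<open>\<sigma> = \<plusminus>1\<close>.\<close>
definition U_comp :: "real \<Rightarrow> (real \<Rightarrow> complex) \<Rightarrow> real \<Rightarrow> complex" where
  "U_comp \<sigma> x \<mu> = complex_of_real (1 / sqrt (2 * pi)) *
      (LINT \<xi>:{0<..}|lborel. x \<xi> * complex_of_real (\<xi> powr (-1/2)) *
           exp (\<i> * complex_of_real (\<sigma> * \<mu> * ln \<xi>)))"

definition U0 :: "(real \<Rightarrow> complex) \<Rightarrow> mvec" where
  "U0 x = (U_comp 1 x, U_comp (-1) x)"

text \<open>Extension of U by continuity from Udom to L^2(R^+).\<close>
definition U :: "(real \<Rightarrow> complex) \<Rightarrow> mvec" where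
  "U x = (SOME y. y \<in> Mspace \<and>
      (\<exists>s. (\<forall>n. s n \<in> Udom) \<and> L2pos_conv s x \<and> M_conv (\<lambda>n. U0 (s n)) y))"

definition U_inv :: "mvec \<Rightarrow> real \<Rightarrow> complex" where
  "U_inv y = (SOME x. x \<in> L2pos \<and> M_eq (U x) y)"

definition F_pm :: "real \<Rightarrow> complex" where
  "F_pm \<mu> = complex_of_real (1 / sqrt (2 * pi)) * exp (\<i> * complex_of_real (pi / 4)) *
      complex_of_real (exp (- pi * \<mu> / 2)) * Gamma (1/2 + \<i> * complex_of_real \<mu>)"

definition F_mp :: "real \<Rightarrow> complex" where
  "F_mp \<mu> = complex_of_real (1 / sqrt (2 * pi)) * exp (\<i> * complex_of_real (pi / 4)) *
      complex_of_real (exp (pi * \<mu> / 2)) * Gamma (1/2 - \<i> * complex_of_real \<mu>)"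

text \<open>\<open>F(\<mu>) = [[0, F_{+-}], [F_{-+}, 0]]\<close> applied to the column \<open>(y_+, y_-)\<close>.\<close>
definition MF :: "mvec \<Rightarrow> mvec" where
  "MF y = ((\<lambda>\<mu>. F_pm \<mu> * snd y \<mu>), (\<lambda>\<mu>. F_mp \<mu> * fst y \<mu>))"

end

theory Submission
  imports Defs "HOL-Probability.Levy" "HOL-Real_Asymp.Real_Asymp"
begin

text \<open>Under \<open>\<xi> = e\<^sup>s\<close> the space \<open>L\<^sup>2(\<real>\<^sup>+)\<close> becomes \<open>L\<^sup>2(\<real>)\<close> and \<open>U\<close> becomes the Fourier--Plancherel operator, the model
  space being \<open>L\<^sup>2(\<real>)\<close> cut at the origin; unitarity of \<open>U\<close> is thus Plancherel's theorem. The latter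
  follows from two facts: the Fourier integral is a contraction on \<open>L\<^sup>1 \<inter> L\<^sup>2\<close>, and applying
  the extended operator twice gives the reflection, which forces it to be isometric and onto.

  For the multiplier, \<open>e\<^bsup>it\<xi>\<^esup>\<close> is replaced by \<open>e\<^bsup>-(\<delta> - i)t\<xi>\<^esup>\<close> with \<open>\<delta> > 0\<close>. This kernel depends on
  the product \<open>t\<xi>\<close> only, hence is diagonalized by the Mellin transform \<open>U\<close>; Fubini applies for \<open>x\<close> supported away
  from \<open>0\<close>, and the symbol is \<open>\<Gamma>(s) (\<delta> - i)\<^bsup>-s\<^esup> / \<surd>(2\<pi>)\<close> at \<open>s = 1/2 + i\<mu>\<close>. These symbols are bounded by 1 and
  converge to \<open>F\<^sub>+\<^sub>-\<close> as \<open>\<delta> \<rightarrow> 0\<close>, with \<open>F\<^sub>-\<^sub>+(\<mu>) = F\<^sub>+\<^sub>-(-\<mu>)\<close>.\<close>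

section \<open>Square-integrable functions on the line\<close>

text \<open>\<open>FP\<close>, \<open>U\<close> and \<open>U_inv\<close> are Hilbert choices among
  representatives, so they are known only up to null sets. Each is pinned down by something with a
  uniqueness property (\<open>FP_lim\<close> for \<open>FP\<close> and \<open>U\<close>, injectivity
  of \<open>U\<close> for \<open>U_inv\<close>), and identities are carried through limits in
  \<open>L2R_dist\<close>. The damping is forced by the Mellin weight: against t^(-1/2) the kernel
  e^(it xi) is not absolutely integrable at infinity, so Fubini's theorem does not apply to it. To
  remove the damping, L2 convergence of the damped functions is required. It is not estimated
  directly but obtained on the transform side, where the symbols converge pointwise, and pulled back
  by the isometry. The bound 1 for the symbols is a balance: on the line Re s = 1/2 the decay e^(-pi
  |mu| / 2) of Gamma compensates the growth of the complex power.\<close>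

definition L2R_norm :: "(real \<Rightarrow> complex) \<Rightarrow> real" where
  "L2R_norm f = sqrt (LINT t|lborel. (cmod (f t))\<^sup>2)"

lemma L2R_dist_eq_norm: "L2R_dist f g = L2R_norm (\<lambda>t. f t - g t)"
  by (simp add: L2R_dist_def L2R_norm_def)

lemma L2R_norm_nonneg [simp]: "0 \<le> L2R_norm f"
  by (simp add: L2R_norm_def)

lemma L2R_dist_nonneg [simp]: "0 \<le> L2R_dist f g"
  by (simp add: L2R_dist_eq_norm)

lemma L2R_norm_power2: "(L2R_norm f)\<^sup>2 = (LINT t|lborel. (cmod (f t))\<^sup>2)"
  by (simp add: L2R_norm_def)

lemma L2R_measurable [measurable_dest]: "f \<in> L2R \<Longrightarrow> f \<in> borel_measurable borel"
  by (simp add: L2R_def)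

lemma L2R_integrable: "f \<in> L2R \<Longrightarrow> integrable lborel (\<lambda>t. (cmod (f t))\<^sup>2)"
  by (simp add: L2R_def)

lemma L2R_bound:
  assumes "integrable lborel w" "f \<in> borel_measurable borel" "\<And>t. (cmod (f t))\<^sup>2 \<le> w t"
  shows "f \<in> L2R"
proof -
  have "integrable lborel (\<lambda>t. (cmod (f t))\<^sup>2)"
    by (rule Bochner_Integration.integrable_bound[OF assms(1)])
       (use assms in \<open>auto intro!: AE_I2 order_trans[OF assms(3)]\<close>)
  with assms show ?thesis by (simp add: L2R_def)
qed

lemma L2R_cmod_le:
  assumes "g \<in> L2R" "f \<in> borel_measurable borel" "\<And>t. cmod (f t) \<le> cmod (g t)"
  shows "f \<in> L2R"
  by (rule L2R_bound[OF L2R_integrable[OF assms(1)]]) (use assms in \<open>auto intro!: power_mono\<close>)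

lemma cmod_add_power2_le: "(cmod (a + b))\<^sup>2 \<le> 2 * (cmod a)\<^sup>2 + 2 * (cmod b)\<^sup>2"
proof -
  have "(cmod (a + b))\<^sup>2 \<le> (cmod a + cmod b)\<^sup>2"
    by (intro power_mono norm_triangle_ineq) auto
  also have "\<dots> \<le> 2 * (cmod a)\<^sup>2 + 2 * (cmod b)\<^sup>2"
    using zero_le_power2[of "cmod a - cmod b"] by (simp add: power2_eq_square algebra_simps)
  finally show ?thesis .
qed

lemma borel_measurable_cnj [measurable (raw)]:
  "f \<in> borel_measurable M \<Longrightarrow> (\<lambda>t. cnj (f t)) \<in> borel_measurable M"
  by (rule borel_measurable_continuous_on[where f=cnj]) (auto intro: continuous_intros)

lemma L2R_add [intro]:
  assumes f: "f \<in> L2R" and g: "g \<in> L2R" shows "(\<lambda>t. f t + g t) \<in> L2R"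
proof (rule L2R_bound)
  show "integrable lborel (\<lambda>t. 2 * (cmod (f t))\<^sup>2 + 2 * (cmod (g t))\<^sup>2)"
    using L2R_integrable[OF f] L2R_integrable[OF g] by auto
  show "(\<lambda>t. f t + g t) \<in> borel_measurable borel" using f g by measurable
qed (rule cmod_add_power2_le)

lemma L2R_uminus [intro]: "f \<in> L2R \<Longrightarrow> (\<lambda>t. - f t) \<in> L2R"
  by (rule L2R_cmod_le[of f]) auto

lemma L2R_diff [intro]:
  assumes f: "f \<in> L2R" and g: "g \<in> L2R" shows "(\<lambda>t. f t - g t) \<in> L2R"
  using L2R_add[OF f L2R_uminus[OF g]] by simp

lemma L2R_cnj [intro]: "f \<in> L2R \<Longrightarrow> (\<lambda>t. cnj (f t)) \<in> L2R"
  by (rule L2R_cmod_le[of f]) auto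

lemma L2R_reflect [intro]: "f \<in> L2R \<Longrightarrow> (\<lambda>t. f (- t)) \<in> L2R"
  using lborel_integrable_real_affine[of "\<lambda>t. (cmod (f t))\<^sup>2" "-1" 0]
  by (auto simp: L2R_def)

lemma integral_reflect:
  fixes f :: "real \<Rightarrow> 'a::{banach, second_countable_topology}"
  shows "(LINT t|lborel. f (- t)) = (LINT t|lborel. f t)"
  using lborel_integral_real_affine[of "-1" f 0] by simp

lemma AE_reflect:
  fixes P :: "real \<Rightarrow> bool"
  assumes "AE t in lborel. P t" shows "AE t in lborel. P (- t)"
proof -
  have "AE t in distr lborel borel uminus. P t"
    using assms unfolding lborel_distr_uminus .
  then show ?thesis
    using AE_distrD[of uminus lborel borel P] by simp
qed

lemma L2R_norm_reflect: "L2R_norm (\<lambda>t. f (- t)) = L2R_norm f"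
  using integral_reflect[of "\<lambda>t. (cmod (f t))\<^sup>2"] by (simp add: L2R_norm_def)

lemma L2R_dist_reflect: "L2R_dist (\<lambda>t. f (- t)) (\<lambda>t. g (- t)) = L2R_dist f g"
  using L2R_norm_reflect[of "\<lambda>t. f t - g t"] by (simp add: L2R_dist_eq_norm)

lemma L2R_norm_cnj: "L2R_norm (\<lambda>t. cnj (f t)) = L2R_norm f"
  by (simp add: L2R_norm_def)

lemma L2R_dist_cnj: "L2R_dist (\<lambda>t. cnj (f t)) (\<lambda>t. cnj (g t)) = L2R_dist f g"
  using L2R_norm_cnj[of "\<lambda>t. f t - g t"] by (simp add: L2R_dist_eq_norm)

section \<open>Norm estimates and the Cauchy-Schwarz inequality\<close>

lemma L2R_nn_integral:
  "f \<in> L2R \<Longrightarrow> (\<integral>\<^sup>+t. ennreal ((cmod (f t))\<^sup>2) \<partial>lborel) = ennreal ((L2R_norm f)\<^sup>2)"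
  by (simp add: L2R_norm_power2 nn_integral_eq_integral L2R_integrable)

text \<open>In terms of the nonnegative integral, one estimate yields both square-integrability and
  the norm bound; Fatou's lemma and the Gaussian estimate deliver their results in this
  form.\<close>

lemma L2R_norm_leI:
  assumes f: "f \<in> borel_measurable borel" and c: "0 \<le> c"
    and le: "(\<integral>\<^sup>+t. ennreal ((cmod (f t))\<^sup>2) \<partial>lborel) \<le> ennreal (c\<^sup>2)"
  shows "f \<in> L2R" "L2R_norm f \<le> c"
proof -
  have "integrable lborel (\<lambda>t. (cmod (f t))\<^sup>2)"
    using f le by (intro integrableI_nonneg) (auto simp: le_less_trans)
  with f show *: "f \<in> L2R" by (simp add: L2R_def)
  have "ennreal ((L2R_norm f)\<^sup>2) \<le> ennreal (c\<^sup>2)" using le L2R_nn_integral[OF *] by simp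
  then have "(L2R_norm f)\<^sup>2 \<le> c\<^sup>2" by simp
  then show "L2R_norm f \<le> c" using c by (rule power2_le_imp_le)
qed

lemma L2R_cmod_mult:
  assumes f: "f \<in> L2R" and g: "g \<in> L2R"
  shows "integrable lborel (\<lambda>t. cmod (f t) * cmod (g t))"
    and "(LINT t|lborel. cmod (f t) * cmod (g t)) \<le> L2R_norm f * L2R_norm g"
proof -
  note [measurable] = L2R_measurable[OF f] L2R_measurable[OF g]
  show int: "integrable lborel (\<lambda>t. cmod (f t) * cmod (g t))"
  proof (rule Bochner_Integration.integrable_bound)
    show "integrable lborel (\<lambda>t. (cmod (f t))\<^sup>2 + (cmod (g t))\<^sup>2)"
      using L2R_integrable[OF f] L2R_integrable[OF g] by auto
    show "AE t in lborel. norm (cmod (f t) * cmod (g t)) \<le> norm ((cmod (f t))\<^sup>2 + (cmod (g t))\<^sup>2)"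
    proof (rule AE_I2)
      fix t
      have "0 \<le> (cmod (f t) - cmod (g t))\<^sup>2 + (cmod (f t))\<^sup>2 + (cmod (g t))\<^sup>2" by simp
      then show "norm (cmod (f t) * cmod (g t)) \<le> norm ((cmod (f t))\<^sup>2 + (cmod (g t))\<^sup>2)"
        by (simp add: abs_mult power2_eq_square algebra_simps)
    qed
  qed simp
  let ?I = "LINT t|lborel. cmod (f t) * cmod (g t)"
  have "(\<integral>\<^sup>+t. ennreal (cmod (f t)) * ennreal (cmod (g t)) \<partial>lborel)\<^sup>2
      \<le> (\<integral>\<^sup>+t. (ennreal (cmod (f t)))\<^sup>2 \<partial>lborel) * (\<integral>\<^sup>+t. (ennreal (cmod (g t)))\<^sup>2 \<partial>lborel)"
    by (rule Cauchy_Schwarz_nn_integral) auto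
  moreover have "(\<integral>\<^sup>+t. ennreal (cmod (f t)) * ennreal (cmod (g t)) \<partial>lborel) = ennreal ?I"
    using int by (simp add: nn_integral_eq_integral flip: ennreal_mult')
  ultimately have "(ennreal ?I)\<^sup>2 \<le> ennreal ((L2R_norm f)\<^sup>2) * ennreal ((L2R_norm g)\<^sup>2)"
    by (simp add: ennreal_power L2R_nn_integral[OF f] L2R_nn_integral[OF g])
  then have "(ennreal ?I)\<^sup>2 \<le> ennreal ((L2R_norm f * L2R_norm g)\<^sup>2)"
    by (simp add: power_mult_distrib flip: ennreal_mult')
  then have "?I\<^sup>2 \<le> (L2R_norm f * L2R_norm g)\<^sup>2"
    by (simp add: ennreal_power)
  then show "?I \<le> L2R_norm f * L2R_norm g"
    by (rule power2_le_imp_le) simp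
qed

lemma L2R_mult_integrable:
  assumes "f \<in> L2R" "g \<in> L2R" shows "integrable lborel (\<lambda>t. f t * g t)"
  by (rule Bochner_Integration.integrable_bound[OF L2R_cmod_mult(1)[OF assms]])
     (use assms in \<open>auto simp: norm_mult L2R_measurable\<close>)

lemma L2R_Cauchy_Schwarz:
  assumes "f \<in> L2R" "g \<in> L2R"
  shows "cmod (LINT t|lborel. f t * g t) \<le> L2R_norm f * L2R_norm g"
proof -
  have "cmod (LINT t|lborel. f t * g t) \<le> (LINT t|lborel. cmod (f t) * cmod (g t))"
    using integral_norm_bound[of lborel "\<lambda>t. f t * g t"] by (simp add: norm_mult)
  with L2R_cmod_mult(2)[OF assms] show ?thesis by simp
qed

lemma L2R_norm_add_le:
  assumes f: "f \<in> L2R" and g: "g \<in> L2R"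
  shows "L2R_norm (\<lambda>t. f t + g t) \<le> L2R_norm f + L2R_norm g"
proof -
  note int = L2R_integrable[OF f] L2R_integrable[OF g] L2R_cmod_mult(1)[OF f g]
  have "(L2R_norm (\<lambda>t. f t + g t))\<^sup>2
      \<le> (LINT t|lborel. (cmod (f t))\<^sup>2 + (cmod (g t))\<^sup>2 + 2 * (cmod (f t) * cmod (g t)))"
    unfolding L2R_norm_power2
  proof (rule integral_mono)
    show "integrable lborel (\<lambda>t. (cmod (f t + g t))\<^sup>2)"
      using L2R_integrable[OF L2R_add[OF f g]] .
    fix t
    have "(cmod (f t + g t))\<^sup>2 \<le> (cmod (f t) + cmod (g t))\<^sup>2"
      by (intro power_mono norm_triangle_ineq) auto
    then show "(cmod (f t + g t))\<^sup>2 \<le> (cmod (f t))\<^sup>2 + (cmod (g t))\<^sup>2 + 2 * (cmod (f t) * cmod (g t))"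
      by (simp add: power2_eq_square algebra_simps)
  qed (use int in auto)
  also have "\<dots> = (L2R_norm f)\<^sup>2 + (L2R_norm g)\<^sup>2 + 2 * (LINT t|lborel. cmod (f t) * cmod (g t))"
    using int by (simp add: L2R_norm_power2)
  also have "\<dots> \<le> (L2R_norm f + L2R_norm g)\<^sup>2"
    using L2R_cmod_mult(2)[OF f g] by (simp add: power2_eq_square algebra_simps)
  finally show ?thesis by (rule power2_le_imp_le) simp
qed

lemma L2R_dist_commute: "L2R_dist f g = L2R_dist g f"
  by (simp add: L2R_dist_def norm_minus_commute)

lemma L2R_dist_triangle:
  assumes "f \<in> L2R" "g \<in> L2R" "h \<in> L2R"
  shows "L2R_dist f h \<le> L2R_dist f g + L2R_dist g h"
  using L2R_norm_add_le[OF L2R_diff[OF assms(1,2)] L2R_diff[OF assms(2,3)]]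
  by (simp add: L2R_dist_eq_norm)

lemma L2R_dist_0_iff:
  assumes f: "f \<in> L2R" and g: "g \<in> L2R"
  shows "L2R_dist f g = 0 \<longleftrightarrow> (AE t in lborel. f t = g t)"
  using integral_nonneg_eq_0_iff_AE[OF L2R_integrable[OF L2R_diff[OF f g]]]
  by (simp add: L2R_dist_def)

lemma L2R_dist_cong_AE:
  assumes "f \<in> L2R" "f' \<in> L2R" "g \<in> L2R" "g' \<in> L2R"
    and "AE t in lborel. f t = f' t" "AE t in lborel. g t = g' t"
  shows "L2R_dist f g = L2R_dist f' g'"
proof -
  have "(LINT t|lborel. (cmod (f t - g t))\<^sup>2) = (LINT t|lborel. (cmod (f' t - g' t))\<^sup>2)"
    by (rule integral_cong_AE)
       (use assms in \<open>auto dest!: L2R_measurable elim: eventually_elim2\<close>)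
  then show ?thesis by (simp add: L2R_dist_def)
qed

text \<open>The norm bound is asked only eventually: in \<open>L2R_limit_AE_eq\<close> and
  \<open>L2R_complete\<close> it starts at an index that depends on the chosen accuracy.\<close>

lemma L2R_Fatou:
  assumes s: "\<And>n. s n \<in> L2R" and y: "y \<in> borel_measurable borel" and c: "0 \<le> c"
    and lim: "AE t in lborel. (\<lambda>n. s n t) \<longlonglongrightarrow> y t"
    and le: "eventually (\<lambda>n. L2R_norm (s n) \<le> c) sequentially"
  shows "y \<in> L2R" "L2R_norm y \<le> c"
proof -
  have [measurable]: "s n \<in> borel_measurable borel" for n using s by (rule L2R_measurable)
  have "(\<integral>\<^sup>+t. ennreal ((cmod (y t))\<^sup>2) \<partial>lborel)
      = (\<integral>\<^sup>+t. liminf (\<lambda>n. ennreal ((cmod (s n t))\<^sup>2)) \<partial>lborel)"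
  proof (rule nn_integral_cong_AE, use lim in eventually_elim)
    fix t assume "(\<lambda>n. s n t) \<longlonglongrightarrow> y t"
    then have "(\<lambda>n. ennreal ((cmod (s n t))\<^sup>2)) \<longlonglongrightarrow> ennreal ((cmod (y t))\<^sup>2)"
      by (intro tendsto_ennrealI tendsto_intros)
    then show "ennreal ((cmod (y t))\<^sup>2) = liminf (\<lambda>n. ennreal ((cmod (s n t))\<^sup>2))"
      by (metis lim_imp_Liminf trivial_limit_sequentially)
  qed
  also have "\<dots> \<le> liminf (\<lambda>n. \<integral>\<^sup>+t. ennreal ((cmod (s n t))\<^sup>2) \<partial>lborel)"
    by (rule nn_integral_liminf) measurable
  also have "\<dots> = liminf (\<lambda>n. ennreal ((L2R_norm (s n))\<^sup>2))"
    by (simp add: L2R_nn_integral[OF s])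
  also have "\<dots> \<le> liminf (\<lambda>n. ennreal (c\<^sup>2))"
    by (rule Liminf_mono, use le in eventually_elim) (auto intro!: ennreal_leI power_mono)
  finally have "(\<integral>\<^sup>+t. ennreal ((cmod (y t))\<^sup>2) \<partial>lborel) \<le> ennreal (c\<^sup>2)"
    by (simp add: Liminf_const)
  from L2R_norm_leI[OF y c this] show "y \<in> L2R" "L2R_norm y \<le> c" by auto
qed

text \<open>Fatou's lemma, applied to \<open>s n - f\<close>, bounds the norm of
  \<open>y - f\<close> by every e > 0. This compares the two kinds of limit without passing to a
  subsequence and also puts \<open>y\<close> into L2.\<close>

lemma L2R_limit_AE_eq:
  assumes s: "L2R_conv s f" and y: "y \<in> borel_measurable borel"
    and lim: "AE t in lborel. (\<lambda>n. s n t) \<longlonglongrightarrow> y t"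
  shows "AE t in lborel. f t = y t"
proof -
  have sL: "s n \<in> L2R" for n using s by (auto simp: L2R_conv_def)
  have f: "f \<in> L2R" and 0: "(\<lambda>n. L2R_dist (s n) f) \<longlonglongrightarrow> 0"
    using s by (auto simp: L2R_conv_def)
  have "(\<lambda>t. y t - f t) \<in> L2R \<and> L2R_norm (\<lambda>t. y t - f t) \<le> e" if "e > 0" for e
  proof -
    have "AE t in lborel. (\<lambda>n. s n t - f t) \<longlonglongrightarrow> y t - f t"
      using lim by eventually_elim (intro tendsto_intros)
    moreover have "eventually (\<lambda>n. L2R_norm (\<lambda>t. s n t - f t) \<le> e) sequentially"
      using order_tendstoD(2)[OF 0 that]
      by eventually_elim (simp add: L2R_dist_eq_norm)
    ultimately show ?thesis
      using L2R_Fatou[of "\<lambda>n t. s n t - f t" "\<lambda>t. y t - f t" e] sL f y that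
      by (auto dest: L2R_measurable)
  qed
  note * = this
  have dL: "(\<lambda>t. y t - f t) \<in> L2R" using *[of 1] by simp
  have "L2R_norm (\<lambda>t. y t - f t) \<le> 0"
    by (rule field_le_epsilon) (use * in simp)
  then have 0: "L2R_dist y f = 0"
    using L2R_norm_nonneg[of "\<lambda>t. y t - f t"] by (simp add: L2R_dist_eq_norm)
  have yL: "y \<in> L2R" using L2R_add[OF dL f] by simp
  show ?thesis using L2R_dist_0_iff[OF yL f] 0 by (auto elim: eventually_mono)
qed

text \<open>Riesz--Fischer: a subsequence with \<open>\<parallel>s\<^sub>k\<^sub>+\<^sub>1 - s\<^sub>k\<parallel> \<le> 2\<^sup>-\<^sup>k\<close> converges pointwise because
  \<open>\<Sum>2\<^sup>k |s\<^sub>k\<^sub>+\<^sub>1 - s\<^sub>k|\<^sup>2\<close> has finite integral; Fatou's lemma upgrades this to \<open>L\<^sup>2\<close>.\<close>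
lemma L2R_fast_Cauchy_AE_convergent:
  assumes s: "\<And>n. s n \<in> L2R" and le: "\<And>k. L2R_dist (s (Suc k)) (s k) \<le> (1/2) ^ k"
  shows "AE t in lborel. convergent (\<lambda>k. s k t)"
proof -
  have [measurable]: "s n \<in> borel_measurable borel" for n using s by (rule L2R_measurable)
  \<comment> \<open>The squared distances decay like 4^(-k). The weight spends half of this decay on
    the pointwise increments; the rest, 2^(-k), is still summable.\<close>
  define d where "d k t = (2::real) ^ k * (cmod (s (Suc k) t - s k t))\<^sup>2" for k t
  have [measurable]: "d k \<in> borel_measurable borel" for k unfolding d_def by measurable
  have int: "(\<integral>\<^sup>+t. ennreal (d k t) \<partial>lborel) \<le> ennreal ((1/2) ^ k)" for k
  proof -
    have "(\<integral>\<^sup>+t. ennreal (d k t) \<partial>lborel)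
        = ennreal (2 ^ k) * (\<integral>\<^sup>+t. ennreal ((cmod (s (Suc k) t - s k t))\<^sup>2) \<partial>lborel)"
      unfolding d_def by (subst nn_integral_cmult[symmetric]) (auto simp: ennreal_mult)
    also have "\<dots> = ennreal (2 ^ k * (L2R_dist (s (Suc k)) (s k))\<^sup>2)"
      using L2R_nn_integral[OF L2R_diff[OF s[of "Suc k"] s[of k]]]
      by (simp add: L2R_dist_eq_norm ennreal_mult)
    also have "\<dots> \<le> ennreal (2 ^ k * ((1/2) ^ k)\<^sup>2)"
      using le[of k] by (intro ennreal_leI mult_left_mono power_mono) auto
    also have "(2::real) ^ k * ((1/2) ^ k)\<^sup>2 = (1/2) ^ k"
      by (simp add: power2_eq_square power_one_over)
    finally show ?thesis .
  qed
  have "(\<integral>\<^sup>+t. (\<Sum>k. ennreal (d k t)) \<partial>lborel) = (\<Sum>k. \<integral>\<^sup>+t. ennreal (d k t) \<partial>lborel)"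
    by (rule nn_integral_suminf) measurable
  also have "\<dots> \<le> (\<Sum>k. ennreal ((1/2) ^ k))"
    using int by (intro suminf_le) auto
  also have "\<dots> < \<infinity>"
    by (subst suminf_ennreal2) (auto intro!: summable_geometric)
  finally have "AE t in lborel. (\<Sum>k. ennreal (d k t)) \<noteq> \<infinity>"
    by (intro nn_integral_PInf_AE) (auto simp: less_top)
  then show ?thesis
  proof eventually_elim
    fix t assume "(\<Sum>k. ennreal (d k t)) \<noteq> \<infinity>"
    then have sm: "summable (\<lambda>k. d k t)"
      by (intro summable_suminf_not_top) (auto simp: d_def)
    then obtain C where C: "\<And>k. norm (d k t) \<le> C"
      using summable_imp_bounded[OF sm] by (auto simp: bounded_iff)
    \<comment> \<open>Each term of the convergent series is at most \<open>C\<close>, so the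
      increments decay like (1/sqrt 2)^k.\<close>
    have bd: "cmod (s (Suc k) t - s k t) \<le> sqrt C * sqrt (1/2) ^ k" for k
    proof -
      have "(cmod (s (Suc k) t - s k t))\<^sup>2 \<le> C * (1/2) ^ k"
        using C[of k] by (simp add: d_def field_simps power_one_over)
      then have "cmod (s (Suc k) t - s k t) \<le> sqrt (C * (1/2) ^ k)"
        by (rule real_le_rsqrt)
      then show ?thesis by (simp add: real_sqrt_mult real_sqrt_power)
    qed
    have "sqrt (1/2) < sqrt (1::real)" by (rule real_sqrt_less_mono) simp
    then have "summable (\<lambda>k. sqrt C * sqrt (1/2) ^ k)"
      by (intro summable_mult summable_geometric) simp
    then have "summable (\<lambda>k. s (Suc k) t - s k t)"
      by (rule summable_comparison_test'[where N=0]) (use bd in auto)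
    then have "convergent (\<lambda>n. s 0 t + (\<Sum>k<n. s (Suc k) t - s k t))"
      by (intro convergent_add convergent_const) (simp add: summable_iff_convergent)
    then show "convergent (\<lambda>k. s k t)"
      by (subst (asm) sum_lessThan_telescope) simp
  qed
qed

lemma L2R_complete:
  assumes s: "\<And>n. s n \<in> L2R"
    and Cauchy: "\<And>e. e > 0 \<Longrightarrow> \<exists>N. \<forall>m\<ge>N. \<forall>n\<ge>N. L2R_dist (s m) (s n) \<le> e"
  shows "\<exists>y. L2R_conv s y"
proof -
  have [measurable]: "s n \<in> borel_measurable borel" for n using s by (rule L2R_measurable)
  have "\<exists>N. \<forall>m\<ge>N. \<forall>n\<ge>N. L2R_dist (s m) (s n) \<le> (1/2) ^ k" for k
    by (rule Cauchy) simp
  then obtain N where N: "\<And>k m n. m \<ge> N k \<Longrightarrow> n \<ge> N k \<Longrightarrow> L2R_dist (s m) (s n) \<le> (1/2) ^ k"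
    by metis
  \<comment> \<open>The sum makes \<open>r\<close> increasing with both \<open>r k\<close> and
    \<open>r (Suc k)\<close> beyond \<open>N k\<close>; the summand \<open>k\<close> drives
    \<open>r\<close> to infinity.\<close>
  define r where "r k = (\<Sum>i\<le>k. N i) + k" for k
  have rN: "N k \<le> r k" for k
    using member_le_sum[of k "{..k}" N] by (simp add: r_def)
  have "r k \<le> r (Suc k)" for k by (simp add: r_def)
  then have rN': "N k \<le> r (Suc k)" for k using rN[of k] by (meson order_trans)
  have rk: "k \<le> r k" for k by (simp add: r_def)
  define y where "y t = lim (\<lambda>k. s (r k) t)" for t
  have [measurable]: "y \<in> borel_measurable borel"
    unfolding y_def by measurable
  have "AE t in lborel. convergent (\<lambda>k. s (r k) t)"
    by (rule L2R_fast_Cauchy_AE_convergent) (use s N rN rN' in auto)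
  then have lim: "AE t in lborel. (\<lambda>k. s (r k) t) \<longlonglongrightarrow> y t"
    by eventually_elim (simp add: y_def convergent_LIMSEQ_iff)
  \<comment> \<open>Here \<open>n\<close> stays fixed while the subsequence runs to its limit in
    Fatou's lemma, which gives convergence of the whole sequence.\<close>
  have close: "\<exists>M. \<forall>n\<ge>M. (\<lambda>t. y t - s n t) \<in> L2R \<and> L2R_norm (\<lambda>t. y t - s n t) \<le> e" if e: "e > 0" for e
  proof -
    obtain M where M: "\<And>m n. m \<ge> M \<Longrightarrow> n \<ge> M \<Longrightarrow> L2R_dist (s m) (s n) \<le> e"
      using Cauchy[OF e] by blast
    have "(\<lambda>t. y t - s n t) \<in> L2R \<and> L2R_norm (\<lambda>t. y t - s n t) \<le> e" if "n \<ge> M" for n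
    proof -
      have "AE t in lborel. (\<lambda>k. s (r k) t - s n t) \<longlonglongrightarrow> y t - s n t"
        using lim by eventually_elim (intro tendsto_intros)
      moreover have "eventually (\<lambda>k. L2R_norm (\<lambda>t. s (r k) t - s n t) \<le> e) sequentially"
        using eventually_ge_at_top[of M]
      proof eventually_elim
        case (elim k)
        then have "r k \<ge> M" using rk[of k] by simp
        with M \<open>n \<ge> M\<close> show ?case by (simp add: L2R_dist_eq_norm)
      qed
      ultimately show ?thesis
        using L2R_Fatou[of "\<lambda>k t. s (r k) t - s n t" "\<lambda>t. y t - s n t" e] s \<open>e > 0\<close> by auto
    qed
    then show ?thesis by blast
  qed
  obtain M where "(\<lambda>t. y t - s M t) \<in> L2R" using close[of 1] by auto
  from L2R_add[OF this s[of M]] have yL: "y \<in> L2R" by simp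
  have "(\<lambda>n. L2R_dist (s n) y) \<longlonglongrightarrow> 0"
  proof (rule LIMSEQ_I)
    fix e :: real assume "e > 0"
    then obtain M where "\<forall>n\<ge>M. L2R_norm (\<lambda>t. y t - s n t) \<le> e / 2" using close[of "e/2"] by auto
    then have "\<forall>n\<ge>M. L2R_dist (s n) y \<le> e / 2"
      by (metis L2R_dist_commute L2R_dist_eq_norm)
    with \<open>e > 0\<close> show "\<exists>M. \<forall>n\<ge>M. norm (L2R_dist (s n) y - 0) < e"
      by (intro exI[of _ M]) (auto simp: intro: le_less_trans)
  qed
  with s yL show ?thesis by (auto simp: L2R_conv_def)
qed

section \<open>Limits of distances and pairings\<close>

lemma tendsto_of_norm_diff_le:
  fixes X :: "nat \<Rightarrow> 'a::real_normed_vector"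
  assumes "\<And>n. norm (X n - l) \<le> b n" "b \<longlonglongrightarrow> 0"
  shows "X \<longlonglongrightarrow> l"
  by (rule LIM_zero_cancel, rule Lim_null_comparison[OF _ assms(2)]) (simp add: assms(1))

lemma L2R_conv_dist_tendsto:
  assumes s: "L2R_conv s f" and s': "L2R_conv s' g"
  shows "(\<lambda>n. L2R_dist (s n) (s' n)) \<longlonglongrightarrow> L2R_dist f g"
proof -
  note L = assms[unfolded L2R_conv_def]
  have le: "norm (L2R_dist (s n) (s' n) - L2R_dist f g) \<le> L2R_dist (s n) f + L2R_dist (s' n) g" for n
  proof -
    have "L2R_dist (s n) (s' n) \<le> L2R_dist (s n) f + (L2R_dist f g + L2R_dist g (s' n))"
      using L2R_dist_triangle[of "s n" f "s' n"] L2R_dist_triangle[of f g "s' n"] L by auto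
    moreover have "L2R_dist f g \<le> L2R_dist f (s n) + (L2R_dist (s n) (s' n) + L2R_dist (s' n) g)"
      using L2R_dist_triangle[of f "s n" g] L2R_dist_triangle[of "s n" "s' n" g] L by auto
    ultimately show ?thesis
      using L2R_dist_commute[of g "s' n"] L2R_dist_commute[of f "s n"] by auto
  qed
  show ?thesis
    using L by (intro tendsto_of_norm_diff_le[OF le] tendsto_add_zero) auto
qed

lemma L2R_conv_Cauchy:
  assumes s: "L2R_conv s f" and "e > 0"
  shows "\<exists>N. \<forall>m\<ge>N. \<forall>n\<ge>N. L2R_dist (s m) (s n) \<le> e"
proof -
  note L = s[unfolded L2R_conv_def]
  have "eventually (\<lambda>n. L2R_dist (s n) f < e / 2) sequentially"
    using order_tendstoD(2)[of _ 0 _ "e/2"] L \<open>e > 0\<close> by auto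
  then obtain N where N: "\<And>n. n \<ge> N \<Longrightarrow> L2R_dist (s n) f < e / 2"
    by (auto simp: eventually_sequentially)
  have "L2R_dist (s m) (s n) \<le> e" if "m \<ge> N" "n \<ge> N" for m n
    using L2R_dist_triangle[of "s m" f "s n"] L N[OF that(1)] N[OF that(2)]
      L2R_dist_commute[of f "s n"] by auto
  then show ?thesis by blast
qed

lemma L2R_conv_mult_integral:
  assumes s: "L2R_conv s f" and g: "g \<in> L2R"
  shows "(\<lambda>n. LINT t|lborel. s n t * g t) \<longlonglongrightarrow> (LINT t|lborel. f t * g t)"
proof -
  note L = s[unfolded L2R_conv_def]
  have le: "cmod ((LINT t|lborel. s n t * g t) - (LINT t|lborel. f t * g t)) \<le> L2R_dist (s n) f * L2R_norm g" for n
  proof -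
    have "(LINT t|lborel. s n t * g t) - (LINT t|lborel. f t * g t) = (LINT t|lborel. (s n t - f t) * g t)"
      using L g by (subst Bochner_Integration.integral_diff[symmetric])
        (auto intro!: L2R_mult_integrable simp: algebra_simps)
    with L2R_Cauchy_Schwarz[OF L2R_diff g, of "s n" f] L show ?thesis
      by (simp add: L2R_dist_eq_norm)
  qed
  show ?thesis
    using L by (intro tendsto_of_norm_diff_le[OF le] tendsto_mult_left_zero) auto
qed

lemma L2R_dominated_convergence:
  assumes w: "w \<in> L2R" and s: "\<And>n. s n \<in> borel_measurable borel"
    and f: "f \<in> borel_measurable borel"
    and le: "\<And>n t. cmod (s n t) \<le> cmod (w t)"
    and lim: "\<And>t. (\<lambda>n. s n t) \<longlonglongrightarrow> f t"
  shows "L2R_conv s f"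
proof -
  have sL: "s n \<in> L2R" for n using w s le by (rule L2R_cmod_le)
  have fle: "cmod (f t) \<le> cmod (w t)" for t
    using lim[of t] le by (intro LIMSEQ_le_const2[OF tendsto_norm]) auto
  have fL: "f \<in> L2R" using w f fle by (rule L2R_cmod_le)
  have "(\<lambda>n. LINT t|lborel. (cmod (s n t - f t))\<^sup>2) \<longlonglongrightarrow> integral\<^sup>L lborel (\<lambda>t::real. 0::real)"
  \<comment> \<open>The limit inherits the bound |f| <= |w|, hence |s n - f| <= 2 |w|, and squaring
    gives the 4.\<close>
  proof (rule integral_dominated_convergence[where w="\<lambda>t. 4 * (cmod (w t))\<^sup>2"])
    show "integrable lborel (\<lambda>t. 4 * (cmod (w t))\<^sup>2)" using L2R_integrable[OF w] by simp
    show "AE t in lborel. norm ((cmod (s n t - f t))\<^sup>2) \<le> 4 * (cmod (w t))\<^sup>2" for n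
    proof (rule AE_I2)
      fix t
      have "cmod (s n t - f t) \<le> 2 * cmod (w t)"
        using norm_triangle_ineq4[of "s n t" "f t"] le[of n t] fle[of t] by simp
      then have "(cmod (s n t - f t))\<^sup>2 \<le> (2 * cmod (w t))\<^sup>2" by (rule power_mono) simp
      then show "norm ((cmod (s n t - f t))\<^sup>2) \<le> 4 * (cmod (w t))\<^sup>2" by (simp add: power_mult_distrib)
    qed
    show "AE t in lborel. (\<lambda>n. (cmod (s n t - f t))\<^sup>2) \<longlonglongrightarrow> 0"
    proof (rule AE_I2)
      fix t
      have "(\<lambda>n. (cmod (s n t - f t))\<^sup>2) \<longlonglongrightarrow> (cmod (f t - f t))\<^sup>2"
        by (intro tendsto_intros lim)
      then show "(\<lambda>n. (cmod (s n t - f t))\<^sup>2) \<longlonglongrightarrow> 0" by simp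
    qed
  qed (use s f in auto)
  then have "(\<lambda>n. L2R_dist (s n) f) \<longlonglongrightarrow> sqrt 0"
    unfolding L2R_dist_def by (intro tendsto_real_sqrt) simp
  with sL fL show ?thesis by (simp add: L2R_conv_def)
qed

section \<open>The Fourier integral\<close>

text \<open>The kernel has to be bounded only where \<open>f\<close> and \<open>g\<close> are both
  nonzero. The kernel in \<open>fourier_int_regularized_FRp\<close> grows exponentially
  elsewhere.\<close>

lemma integral_swap_bounded_kernel:
  fixes f g :: "real \<Rightarrow> complex" and k :: "real \<Rightarrow> real \<Rightarrow> complex"
  assumes f: "integrable lborel f" and g: "integrable lborel g"
    and k: "(\<lambda>(x, y). k x y) \<in> borel_measurable (borel \<Otimes>\<^sub>M borel)"
    and bd: "\<And>x y. f x \<noteq> 0 \<Longrightarrow> g y \<noteq> 0 \<Longrightarrow> cmod (k x y) \<le> B"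
  shows "(LINT x|lborel. f x * (LINT y|lborel. g y * k x y))
       = (LINT y|lborel. g y * (LINT x|lborel. f x * k x y))"
proof -
  have [measurable]: "f \<in> borel_measurable borel" "g \<in> borel_measurable borel"
    using f g by (auto dest: borel_measurable_integrable)
  note [measurable] = k
  have le: "cmod (f x * (g y * k x y)) \<le> B * cmod (f x) * cmod (g y)" for x y
    using bd[of x y] mult_mono[OF order_refl bd[of x y], of "cmod (f x) * cmod (g y)"]
    by (cases "f x = 0 \<or> g y = 0") (auto simp: norm_mult mult_ac)
  have inty: "integrable lborel (\<lambda>y. f x * (g y * k x y))" for x
    by (rule Bochner_Integration.integrable_bound[where f="\<lambda>y. B * cmod (f x) * cmod (g y)"])
       (use g le in \<open>auto intro!: AE_I2 order_trans[OF le]\<close>)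
  have "integrable (lborel \<Otimes>\<^sub>M lborel) (\<lambda>(x, y). f x * (g y * k x y))"
  proof (rule lborel_pair.Fubini_integrable)
    show "integrable lborel (\<lambda>x. LINT y|lborel. norm (case (x, y) of (x, y) \<Rightarrow> f x * (g y * k x y)))"
    proof (rule Bochner_Integration.integrable_bound)
      show "integrable lborel (\<lambda>x. B * cmod (f x) * (LINT y|lborel. cmod (g y)))"
        using f by auto
      show "AE x in lborel. norm (LINT y|lborel. norm (case (x, y) of (x, y) \<Rightarrow> f x * (g y * k x y)))
          \<le> norm (B * cmod (f x) * (LINT y|lborel. cmod (g y)))"
      proof (rule AE_I2)
        fix x
        have "(LINT y|lborel. cmod (f x * (g y * k x y))) \<le> (LINT y|lborel. B * cmod (f x) * cmod (g y))"
          by (rule integral_mono) (use inty g le in auto)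
        then show "norm (LINT y|lborel. norm (case (x, y) of (x, y) \<Rightarrow> f x * (g y * k x y)))
          \<le> norm (B * cmod (f x) * (LINT y|lborel. cmod (g y)))"
          by (simp add: abs_of_nonneg Bochner_Integration.integral_nonneg del: norm_mult)
      qed
    qed measurable
    show "AE x in lborel. integrable lborel (\<lambda>y. case (x, y) of (x, y) \<Rightarrow> f x * (g y * k x y))"
      using inty by auto
  qed measurable
  from lborel_pair.Fubini_integral[OF this]
  have "(LINT x|lborel. LINT y|lborel. f x * (g y * k x y))
      = (LINT y|lborel. LINT x|lborel. f x * (g y * k x y))" by simp
  also have "(\<lambda>y. LINT x|lborel. f x * (g y * k x y)) = (\<lambda>y. LINT x|lborel. g y * (f x * k x y))"
    by (simp add: mult_ac)
  finally show ?thesis by simp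
qed

definition expi :: "real \<Rightarrow> complex" where
  "expi x = exp (\<i> * complex_of_real x)"

lemma expi_measurable [measurable]: "expi \<in> borel_measurable borel"
  unfolding expi_def by (intro borel_measurable_continuous_onI continuous_intros)

lemma cmod_expi [simp]: "cmod (expi x) = 1"
  by (simp add: expi_def)

lemma expi_add: "expi (x + y) = expi x * expi y"
  by (simp add: expi_def algebra_simps exp_add)

lemma cnj_expi: "cnj (expi x) = expi (- x)"
  by (simp add: expi_def exp_cnj)

lemma fourier_int_eq:
  "fourier_int f t = complex_of_real (1 / sqrt (2 * pi)) * (LINT x|lborel. f x * expi (t * x))"
  by (simp add: fourier_int_def expi_def)

lemma fourier_int_measurable [measurable]:
  assumes [measurable]: "f \<in> borel_measurable borel"
  shows "fourier_int f \<in> borel_measurable borel"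
  unfolding fourier_int_eq[abs_def] by measurable

lemma integrable_mult_expi:
  assumes "integrable lborel f" shows "integrable lborel (\<lambda>x. f x * expi (t * x))"
  by (rule Bochner_Integration.integrable_bound[OF integrable_norm[OF assms]])
     (use assms in \<open>auto simp: norm_mult\<close>)

lemma fourier_int_diff:
  assumes "integrable lborel f" "integrable lborel g"
  shows "fourier_int (\<lambda>x. f x - g x) t = fourier_int f t - fourier_int g t"
proof -
  have "(LINT x|lborel. (f x - g x) * expi (t * x))
      = (LINT x|lborel. f x * expi (t * x)) - (LINT x|lborel. g x * expi (t * x))"
    unfolding left_diff_distrib
    by (intro Bochner_Integration.integral_diff integrable_mult_expi assms)
  then show ?thesis by (simp add: fourier_int_eq diff_divide_distrib)
qed

text \<open>The kernel is symmetric in t and x, so Fubini's theorem moves the transform across the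
  pairing. The pairing is bilinear, without conjugation; this form extends to L2 in
  \<open>FP_lim_mult_integral\<close>.\<close>

lemma integral_fourier_int_mult:
  assumes f: "integrable lborel f" and g: "integrable lborel g"
  shows "(LINT t|lborel. fourier_int f t * g t) = (LINT t|lborel. f t * fourier_int g t)"
proof -
  have "(LINT t|lborel. g t * (LINT x|lborel. f x * expi (t * x)))
      = (LINT x|lborel. f x * (LINT t|lborel. g t * expi (t * x)))"
    by (rule integral_swap_bounded_kernel[OF g f, where B=1]) auto
  then show ?thesis by (simp add: fourier_int_eq mult_ac)
qed

section \<open>Gaussians and the contraction property on the intersection of L1 and L2\<close>

lemma gaussian_integrable:
  assumes "\<sigma> > 0"
  shows "integrable lborel (\<lambda>t. complex_of_real (exp (- t\<^sup>2 / (2 * \<sigma>\<^sup>2))))"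
    and "(\<integral>\<^sup>+t. ennreal (exp (- (t - a)\<^sup>2 / (2 * \<sigma>\<^sup>2))) \<partial>lborel) = ennreal (sqrt (2 * pi) * \<sigma>)"
proof -
  have eq: "exp (- (t - a)\<^sup>2 / (2 * \<sigma>\<^sup>2)) = (sqrt (2 * pi) * \<sigma>) * normal_density a \<sigma> t" for t a
    using assms by (simp add: normal_density_def real_sqrt_mult)
  have *: "integrable lborel (\<lambda>t. exp (- (t - a)\<^sup>2 / (2 * \<sigma>\<^sup>2)))" for a
    unfolding eq using integrable_normal_density[OF assms] by simp
  from *[of 0] show "integrable lborel (\<lambda>t. complex_of_real (exp (- t\<^sup>2 / (2 * \<sigma>\<^sup>2))))"
    by (intro integrable_of_real) simp
  have "(LINT t|lborel. exp (- (t - a)\<^sup>2 / (2 * \<sigma>\<^sup>2))) = sqrt (2 * pi) * \<sigma>"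
    unfolding eq using integral_normal_density[OF assms] by simp
  with * show "(\<integral>\<^sup>+t. ennreal (exp (- (t - a)\<^sup>2 / (2 * \<sigma>\<^sup>2))) \<partial>lborel) = ennreal (sqrt (2 * pi) * \<sigma>)"
    by (subst nn_integral_eq_integral) auto
qed

text \<open>For sigma = 1 this is the characteristic function of the standard normal distribution;
  the dilation t = sigma x does the rest.\<close>

lemma gaussian_fourier:
  assumes "\<sigma> > 0"
  shows "(LINT t|lborel. complex_of_real (exp (- t\<^sup>2 / (2 * \<sigma>\<^sup>2))) * expi (a * t))
       = complex_of_real (sqrt (2 * pi) * \<sigma> * exp (- (\<sigma> * a)\<^sup>2 / 2))"
proof -
  have std: "(LINT x|lborel. complex_of_real (exp (- x\<^sup>2 / 2)) * expi (b * x))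
      = complex_of_real (sqrt (2 * pi) * exp (- b\<^sup>2 / 2))" for b
  proof -
    have "char std_normal_distribution b
        = (LINT x|lborel. std_normal_density x *\<^sub>R exp (\<i> * complex_of_real (b * x)))"
      unfolding char_def by (subst integral_density) (auto simp: normal_density_nonneg)
    also have "\<dots> = (LINT x|lborel. complex_of_real (1 / sqrt (2 * pi)) * (complex_of_real (exp (- x\<^sup>2 / 2)) * expi (b * x)))"
      by (simp add: std_normal_density_def scaleR_conv_of_real expi_def mult_ac)
    also have "\<dots> = complex_of_real (1 / sqrt (2 * pi)) * (LINT x|lborel. complex_of_real (exp (- x\<^sup>2 / 2)) * expi (b * x))"
      by simp
    finally have "complex_of_real (exp (- (b\<^sup>2) / 2))
       = complex_of_real (1 / sqrt (2 * pi)) * (LINT x|lborel. complex_of_real (exp (- x\<^sup>2 / 2)) * expi (b * x))"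
      by (simp add: char_std_normal_distribution)
    then show ?thesis by (simp add: field_simps)
  qed
  have "(LINT t|lborel. complex_of_real (exp (- t\<^sup>2 / (2 * \<sigma>\<^sup>2))) * expi (a * t))
      = \<sigma> *\<^sub>R (LINT x|lborel. complex_of_real (exp (- (0 + \<sigma> * x)\<^sup>2 / (2 * \<sigma>\<^sup>2))) * expi (a * (0 + \<sigma> * x)))"
    using lborel_integral_real_affine[of \<sigma> "\<lambda>t. complex_of_real (exp (- t\<^sup>2 / (2 * \<sigma>\<^sup>2))) * expi (a * t)" 0] assms by simp
  also have "(\<lambda>x. complex_of_real (exp (- (0 + \<sigma> * x)\<^sup>2 / (2 * \<sigma>\<^sup>2))) * expi (a * (0 + \<sigma> * x)))
     = (\<lambda>x. complex_of_real (exp (- x\<^sup>2 / 2)) * expi ((\<sigma> * a) * x))"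
    using assms by (simp add: power_mult_distrib mult_ac)
  finally show ?thesis
    by (simp only: std) (simp add: scaleR_conv_of_real)
qed

lemma ennreal_norm_integral_le:
  fixes f :: "real \<Rightarrow> complex"
  shows "ennreal (norm (integral\<^sup>L M f)) \<le> (\<integral>\<^sup>+x. ennreal (norm (f x)) \<partial>M)"
  by (cases "integrable M f") (simp_all add: integral_norm_bound_ennreal not_integrable_integral_eq)

text \<open>Schur's test: the kernel is symmetric and all its row integrals equal sqrt(2 pi) /
  sigma, so the two halves of the arithmetic-geometric mean inequality contribute equally.\<close>

lemma gaussian_kernel_bound:
  assumes f: "f \<in> L2R" and s: "\<sigma> > 0"
  shows "(\<integral>\<^sup>+x. \<integral>\<^sup>+y. ennreal (cmod (f x) * cmod (f y) * exp (- (\<sigma> * (x - y))\<^sup>2 / 2)) \<partial>lborel \<partial>lborel)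
     \<le> ennreal ((L2R_norm f)\<^sup>2 * (sqrt (2 * pi) / \<sigma>))"
proof -
  note [measurable] = L2R_measurable[OF f]
  define K where "K x y = exp (- (\<sigma> * (x - y))\<^sup>2 / 2)" for x y
  have [measurable]: "(\<lambda>(x, y). K x y) \<in> borel_measurable (borel \<Otimes>\<^sub>M borel)"
    unfolding K_def by measurable
  have Keq: "K x y = exp (- (y - x)\<^sup>2 / (2 * (1 / \<sigma>)\<^sup>2))" for x y
    by (simp add: K_def power_mult_distrib power_divide power2_commute mult.commute)
  have Ksym: "K x y = K y x" for x y by (simp add: K_def power_mult_distrib power2_commute)
  have KI: "(\<integral>\<^sup>+y. ennreal (K x y) \<partial>lborel) = ennreal (sqrt (2 * pi) / \<sigma>)" for x
    unfolding Keq using gaussian_integrable(2)[of "1 / \<sigma>" x] s by simp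
  let ?N = "\<integral>\<^sup>+x. \<integral>\<^sup>+y. ennreal ((cmod (f x))\<^sup>2 / 2 * K x y) \<partial>lborel \<partial>lborel"
  have "?N = (\<integral>\<^sup>+x. ennreal ((cmod (f x))\<^sup>2) * ennreal (sqrt (2 * pi) / \<sigma> / 2) \<partial>lborel)"
  proof (rule nn_integral_cong)
    fix x
    have "(\<integral>\<^sup>+y. ennreal ((cmod (f x))\<^sup>2 / 2 * K x y) \<partial>lborel)
        = (\<integral>\<^sup>+y. ennreal ((cmod (f x))\<^sup>2 / 2) * ennreal (K x y) \<partial>lborel)"
      by (subst ennreal_mult') (auto simp: K_def)
    also have "\<dots> = ennreal ((cmod (f x))\<^sup>2 / 2) * ennreal (sqrt (2 * pi) / \<sigma>)"
      by (subst nn_integral_cmult) (auto simp: KI)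
    also have "\<dots> = ennreal ((cmod (f x))\<^sup>2) * ennreal (sqrt (2 * pi) / \<sigma> / 2)"
      using s by (simp flip: ennreal_mult')
    finally show "(\<integral>\<^sup>+y. ennreal ((cmod (f x))\<^sup>2 / 2 * K x y) \<partial>lborel)
        = ennreal ((cmod (f x))\<^sup>2) * ennreal (sqrt (2 * pi) / \<sigma> / 2)" .
  qed
  also have "\<dots> = ennreal ((L2R_norm f)\<^sup>2) * ennreal (sqrt (2 * pi) / \<sigma> / 2)"
    by (subst nn_integral_multc) (auto simp: L2R_nn_integral[OF f])
  finally have N: "?N = ennreal ((L2R_norm f)\<^sup>2 * (sqrt (2 * pi) / \<sigma>) / 2)"
    using s by (simp flip: ennreal_mult')
  have N': "(\<integral>\<^sup>+x. \<integral>\<^sup>+y. ennreal ((cmod (f y))\<^sup>2 / 2 * K x y) \<partial>lborel \<partial>lborel) = ?N"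
    by (subst lborel_pair.Fubini') (auto simp: Ksym)
  have "(\<integral>\<^sup>+x. \<integral>\<^sup>+y. ennreal (cmod (f x) * cmod (f y) * K x y) \<partial>lborel \<partial>lborel)
      \<le> (\<integral>\<^sup>+x. \<integral>\<^sup>+y. ennreal ((cmod (f x))\<^sup>2 / 2 * K x y) + ennreal ((cmod (f y))\<^sup>2 / 2 * K x y) \<partial>lborel \<partial>lborel)"
  proof (intro nn_integral_mono)
    fix x y
    have "cmod (f x) * cmod (f y) \<le> (cmod (f x))\<^sup>2 / 2 + (cmod (f y))\<^sup>2 / 2"
      using zero_le_power2[of "cmod (f x) - cmod (f y)"] by (simp add: power2_eq_square algebra_simps)
    then have "cmod (f x) * cmod (f y) * K x y \<le> ((cmod (f x))\<^sup>2 / 2 + (cmod (f y))\<^sup>2 / 2) * K x y"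
      by (rule mult_right_mono) (simp add: K_def)
    then have "ennreal (cmod (f x) * cmod (f y) * K x y)
        \<le> ennreal ((cmod (f x))\<^sup>2 / 2 * K x y + (cmod (f y))\<^sup>2 / 2 * K x y)"
      by (intro ennreal_leI) (simp only: distrib_right)
    also have "\<dots> = ennreal ((cmod (f x))\<^sup>2 / 2 * K x y) + ennreal ((cmod (f y))\<^sup>2 / 2 * K x y)"
      by (rule ennreal_plus) (auto simp: K_def)
    finally show "ennreal (cmod (f x) * cmod (f y) * K x y)
        \<le> ennreal ((cmod (f x))\<^sup>2 / 2 * K x y) + ennreal ((cmod (f y))\<^sup>2 / 2 * K x y)" .
  qed
  also have "\<dots> = ?N + (\<integral>\<^sup>+x. \<integral>\<^sup>+y. ennreal ((cmod (f y))\<^sup>2 / 2 * K x y) \<partial>lborel \<partial>lborel)"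
    by (simp add: nn_integral_add)
  also have "\<dots> = ?N + ?N"
    by (simp only: N')
  also have "\<dots> = ennreal ((L2R_norm f)\<^sup>2 * (sqrt (2 * pi) / \<sigma>))"
    unfolding N using s by (subst ennreal_plus[symmetric]) auto
  finally show ?thesis by (simp add: K_def)
qed

text \<open>\<open>\<integral>|f\<^sup>^|\<^sup>2 e\<^bsup>-t\<^sup>2/2\<sigma>\<^sup>2\<^esup>\<close> becomes, by Fubini, a Gaussian double integral of \<open>f(x) cnj f(y)\<close>, to which
  \<open>|f(x) f(y)| \<le> (|f(x)|\<^sup>2 + |f(y)|\<^sup>2)/2\<close> applies; then \<open>\<sigma> \<rightarrow> \<infinity>\<close>.\<close>
lemma fourier_int_gaussian_le:
  assumes f: "integrable lborel f" and fL: "f \<in> L2R" and s: "\<sigma> > 0"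
  shows "(\<integral>\<^sup>+t. ennreal (exp (- t\<^sup>2 / (2 * \<sigma>\<^sup>2)) * (cmod (fourier_int f t))\<^sup>2) \<partial>lborel) \<le> ennreal ((L2R_norm f)\<^sup>2)"
proof -
  note [measurable] = L2R_measurable[OF fL]
  define F where "F t = (LINT x|lborel. f x * expi (t * x))" for t
  define G where "G t = complex_of_real (exp (- t\<^sup>2 / (2 * \<sigma>\<^sup>2)))" for t
  have [measurable]: "F \<in> borel_measurable borel" "G \<in> borel_measurable borel"
    unfolding F_def G_def by measurable
  have G: "integrable lborel G"
    unfolding G_def by (rule gaussian_integrable(1)[OF s])
  have F_le: "cmod (F t) \<le> (LINT x|lborel. cmod (f x))" for t
    using integral_norm_bound[of lborel "\<lambda>x. f x * expi (t * x)"] by (simp add: norm_mult F_def)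
  have GF: "integrable lborel (\<lambda>t. G t * cnj (F t))"
  proof (rule Bochner_Integration.integrable_bound)
    show "integrable lborel (\<lambda>t. cmod (G t) * (LINT x|lborel. cmod (f x)))"
      using G by auto
  qed (auto simp: norm_mult intro!: AE_I2 mult_left_mono order_trans[OF F_le] )
  have cnjF: "cnj (F t) = (LINT y|lborel. cnj (f y) * expi (- (t * y)))" for t
    using Bochner_Integration.integral_cnj[of lborel "\<lambda>x. f x * expi (t * x)"]
    by (simp add: F_def cnj_expi)
  \<comment> \<open>Exchanging the integrals leaves the transform of the Gaussian at the frequency x
    - y; this is where the convolution kernel arises.\<close>
  have inner: "(LINT t|lborel. G t * cnj (F t) * expi (t * x))
      = (LINT y|lborel. cnj (f y) * complex_of_real (sqrt (2 * pi) * \<sigma> * exp (- (\<sigma> * (x - y))\<^sup>2 / 2)))" for x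
  proof -
    have "G t * cnj (F t) * expi (t * x) = G t * (LINT y|lborel. cnj (f y) * expi ((x - y) * t))" for t
    proof -
      have "cnj (F t) * expi (t * x) = (LINT y|lborel. cnj (f y) * expi (- (t * y)) * expi (t * x))"
        unfolding cnjF by simp
      also have "\<dots> = (LINT y|lborel. cnj (f y) * expi ((x - y) * t))"
        by (simp add: mult.assoc flip: expi_add) (simp add: algebra_simps)
      finally show ?thesis by simp
    qed
    then have "(LINT t|lborel. G t * cnj (F t) * expi (t * x))
        = (LINT t|lborel. G t * (LINT y|lborel. cnj (f y) * expi ((x - y) * t)))"
      by (simp only:)
    also have "\<dots> = (LINT y|lborel. cnj (f y) * (LINT t|lborel. G t * expi ((x - y) * t)))"
      by (rule integral_swap_bounded_kernel[OF G, where B=1]) (use f in auto)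
    finally show ?thesis by (simp only: G_def gaussian_fourier[OF s])
  qed
  have "(LINT t|lborel. G t * cnj (F t) * (LINT x|lborel. f x * expi (t * x)))
      = (LINT x|lborel. f x * (LINT t|lborel. G t * cnj (F t) * expi (t * x)))"
    by (rule integral_swap_bounded_kernel[OF GF f, where B=1]) auto
  then have "(LINT t|lborel. G t * cnj (F t) * F t)
      = (LINT x|lborel. f x * (LINT t|lborel. G t * cnj (F t) * expi (t * x)))"
    by (simp only: F_def[symmetric])
  also have "\<dots> = (LINT x|lborel. f x *
      (LINT y|lborel. cnj (f y) * complex_of_real (sqrt (2 * pi) * \<sigma> * exp (- (\<sigma> * (x - y))\<^sup>2 / 2))))"
    by (simp only: inner)
  finally have A: "(LINT t|lborel. G t * cnj (F t) * F t) = \<dots>" .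
  have int: "integrable lborel (\<lambda>t. exp (- t\<^sup>2 / (2 * \<sigma>\<^sup>2)) * (cmod (F t))\<^sup>2)"
  proof (rule Bochner_Integration.integrable_bound)
    show "integrable lborel (\<lambda>t. cmod (G t) * (LINT x|lborel. cmod (f x))\<^sup>2)"
      using G by auto
  qed (auto simp: G_def intro!: AE_I2 mult_left_mono power_mono F_le)
  have "(LINT t|lborel. G t * cnj (F t) * F t)
     = (LINT t|lborel. complex_of_real (exp (- t\<^sup>2 / (2 * \<sigma>\<^sup>2)) * (cmod (F t))\<^sup>2))"
    by (rule Bochner_Integration.integral_cong)
       (simp_all only: of_real_mult complex_norm_square G_def mult_ac)
  also have "\<dots> = complex_of_real (LINT t|lborel. exp (- t\<^sup>2 / (2 * \<sigma>\<^sup>2)) * (cmod (F t))\<^sup>2)"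
    by (rule integral_complex_of_real)
  finally have B: "cmod (LINT t|lborel. G t * cnj (F t) * F t) = (LINT t|lborel. exp (- t\<^sup>2 / (2 * \<sigma>\<^sup>2)) * (cmod (F t))\<^sup>2)"
    by (simp add: Bochner_Integration.integral_nonneg)
  have "(\<integral>\<^sup>+t. ennreal (exp (- t\<^sup>2 / (2 * \<sigma>\<^sup>2)) * (cmod (F t))\<^sup>2) \<partial>lborel)
      = ennreal (cmod (LINT t|lborel. G t * cnj (F t) * F t))"
    unfolding B by (rule nn_integral_eq_integral[OF int]) auto
  also have "\<dots> \<le> (\<integral>\<^sup>+x. ennreal (cmod (f x *
      (LINT y|lborel. cnj (f y) * complex_of_real (sqrt (2 * pi) * \<sigma> * exp (- (\<sigma> * (x - y))\<^sup>2 / 2))))) \<partial>lborel)"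
    unfolding A by (rule ennreal_norm_integral_le)
  also have "\<dots> \<le> (\<integral>\<^sup>+x. \<integral>\<^sup>+y. ennreal (sqrt (2 * pi) * \<sigma>) *
      ennreal (cmod (f x) * cmod (f y) * exp (- (\<sigma> * (x - y))\<^sup>2 / 2)) \<partial>lborel \<partial>lborel)"
  proof (rule nn_integral_mono)
    fix x
    have "ennreal (cmod (f x * (LINT y|lborel. cnj (f y) * complex_of_real (sqrt (2 * pi) * \<sigma> * exp (- (\<sigma> * (x - y))\<^sup>2 / 2)))))
      = ennreal (cmod (LINT y|lborel. f x * (cnj (f y) * complex_of_real (sqrt (2 * pi) * \<sigma> * exp (- (\<sigma> * (x - y))\<^sup>2 / 2)))))"
      by simp
    also have "\<dots> \<le> (\<integral>\<^sup>+y. ennreal (cmod (f x * (cnj (f y) * complex_of_real (sqrt (2 * pi) * \<sigma> * exp (- (\<sigma> * (x - y))\<^sup>2 / 2))))) \<partial>lborel)"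
      by (rule ennreal_norm_integral_le)
    also have "\<dots> = (\<integral>\<^sup>+y. ennreal (sqrt (2 * pi) * \<sigma>) *
      ennreal (cmod (f x) * cmod (f y) * exp (- (\<sigma> * (x - y))\<^sup>2 / 2)) \<partial>lborel)"
      using s by (intro nn_integral_cong) (simp add: norm_mult mult_ac flip: ennreal_mult')
    finally show "ennreal (cmod (f x * (LINT y|lborel. cnj (f y) * complex_of_real (sqrt (2 * pi) * \<sigma> * exp (- (\<sigma> * (x - y))\<^sup>2 / 2)))))
       \<le> (\<integral>\<^sup>+y. ennreal (sqrt (2 * pi) * \<sigma>) *
      ennreal (cmod (f x) * cmod (f y) * exp (- (\<sigma> * (x - y))\<^sup>2 / 2)) \<partial>lborel)" .
  qed
  also have "\<dots> = ennreal (sqrt (2 * pi) * \<sigma>) * (\<integral>\<^sup>+x. \<integral>\<^sup>+y.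
      ennreal (cmod (f x) * cmod (f y) * exp (- (\<sigma> * (x - y))\<^sup>2 / 2)) \<partial>lborel \<partial>lborel)"
    by (simp add: nn_integral_cmult)
  \<comment> \<open>The row integral sqrt(2 pi) / sigma meets the factor sqrt(2 pi) * sigma, so
    sigma drops out of the bound; the remaining 2 pi is absorbed by the normalisation of
    \<open>fourier_int\<close>.\<close>
  also have "\<dots> \<le> ennreal (sqrt (2 * pi) * \<sigma>) * ennreal ((L2R_norm f)\<^sup>2 * (sqrt (2 * pi) / \<sigma>))"
    by (intro mult_left_mono gaussian_kernel_bound[OF fL s]) auto
  also have "\<dots> = ennreal (2 * pi * (L2R_norm f)\<^sup>2)"
    using s by (simp flip: ennreal_mult')
  finally have main: "(\<integral>\<^sup>+t. ennreal (exp (- t\<^sup>2 / (2 * \<sigma>\<^sup>2)) * (cmod (F t))\<^sup>2) \<partial>lborel)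
      \<le> ennreal (2 * pi * (L2R_norm f)\<^sup>2)" .
  have "ennreal (exp (- t\<^sup>2 / (2 * \<sigma>\<^sup>2)) * (cmod (fourier_int f t))\<^sup>2)
      = ennreal (1 / (2 * pi)) * ennreal (exp (- t\<^sup>2 / (2 * \<sigma>\<^sup>2)) * (cmod (F t))\<^sup>2)" for t
    by (simp add: fourier_int_eq F_def norm_mult norm_divide power_divide flip: ennreal_mult')
  then have "(\<integral>\<^sup>+t. ennreal (exp (- t\<^sup>2 / (2 * \<sigma>\<^sup>2)) * (cmod (fourier_int f t))\<^sup>2) \<partial>lborel)
      = ennreal (1 / (2 * pi)) * (\<integral>\<^sup>+t. ennreal (exp (- t\<^sup>2 / (2 * \<sigma>\<^sup>2)) * (cmod (F t))\<^sup>2) \<partial>lborel)"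
    by (simp add: nn_integral_cmult)
  also have "\<dots> \<le> ennreal (1 / (2 * pi)) * ennreal (2 * pi * (L2R_norm f)\<^sup>2)"
    by (intro mult_left_mono main) auto
  also have "\<dots> = ennreal ((L2R_norm f)\<^sup>2)" by (simp flip: ennreal_mult')
  finally show ?thesis .
qed

lemma fourier_int_L2R:
  assumes f: "integrable lborel f" and fL: "f \<in> L2R"
  shows "fourier_int f \<in> L2R" "L2R_norm (fourier_int f) \<le> L2R_norm f"
proof -
  note [measurable] = L2R_measurable[OF fL]
  \<comment> \<open>The 4 becomes a 2 after squaring, which matches
    \<open>fourier_int_gaussian_le\<close> with sigma = n + 1.\<close>
  define s where "s n t = complex_of_real (exp (- t\<^sup>2 / (4 * (real (Suc n))\<^sup>2))) * fourier_int f t" for n t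
  have sq: "(cmod (s n t))\<^sup>2 = exp (- t\<^sup>2 / (2 * (real (Suc n))\<^sup>2)) * (cmod (fourier_int f t))\<^sup>2" for n t
    by (simp add: s_def norm_mult power_mult_distrib flip: exp_double)
  have *: "s n \<in> L2R \<and> L2R_norm (s n) \<le> L2R_norm f" for n
  proof -
    have "(\<integral>\<^sup>+t. ennreal ((cmod (s n t))\<^sup>2) \<partial>lborel) \<le> ennreal ((L2R_norm f)\<^sup>2)"
      unfolding sq by (rule fourier_int_gaussian_le[OF f fL]) simp
    moreover have "s n \<in> borel_measurable borel" unfolding s_def by measurable
    ultimately show ?thesis by (blast intro: L2R_norm_leI L2R_norm_nonneg)
  qed
  have lim: "(\<lambda>n. s n t) \<longlonglongrightarrow> fourier_int f t" for t
  proof -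
    have "(\<lambda>n. exp (- t\<^sup>2 / (4 * (real (Suc n))\<^sup>2))) \<longlonglongrightarrow> 1"
      by real_asymp
    then have "(\<lambda>n. s n t) \<longlonglongrightarrow> complex_of_real 1 * fourier_int f t"
      unfolding s_def by (intro tendsto_mult tendsto_of_real tendsto_const)
    then show ?thesis by simp
  qed
  show "fourier_int f \<in> L2R" "L2R_norm (fourier_int f) \<le> L2R_norm f"
    using L2R_Fatou[of s "fourier_int f" "L2R_norm f"] * lim by auto
qed

section \<open>The Fourier--Plancherel operator\<close>

text \<open>The relation from which \<open>FP\<close> chooses. Existence and uniqueness are proved
  for it, and it also captures the choice made in \<open>U\<close>.\<close>

definition FP_lim :: "(real \<Rightarrow> complex) \<Rightarrow> (real \<Rightarrow> complex) \<Rightarrow> bool" where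
  "FP_lim x y \<longleftrightarrow> (\<exists>s. (\<forall>n. integrable lborel (s n)) \<and> L2R_conv s x \<and>
           L2R_conv (\<lambda>n. fourier_int (s n)) y)"

lemma FP_lim_L2R: "FP_lim x y \<Longrightarrow> x \<in> L2R" "FP_lim x y \<Longrightarrow> y \<in> L2R"
  by (auto simp: FP_lim_def L2R_conv_def)

lemma L2R_dist_fourier_int_le:
  assumes "integrable lborel f" "f \<in> L2R" "integrable lborel g" "g \<in> L2R"
  shows "L2R_dist (fourier_int f) (fourier_int g) \<le> L2R_dist f g"
proof -
  have "(\<lambda>t. fourier_int f t - fourier_int g t) = fourier_int (\<lambda>x. f x - g x)"
    using assms by (simp add: fourier_int_diff fun_eq_iff)
  then show ?thesis
    using fourier_int_L2R(2)[of "\<lambda>x. f x - g x"] assms by (auto simp: L2R_dist_eq_norm)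
qed

lemma FP_lim_dist_le:
  assumes "FP_lim f y" "FP_lim g z"
  shows "L2R_dist y z \<le> L2R_dist f g"
proof -
  obtain s where s: "\<And>n. integrable lborel (s n)" "L2R_conv s f" "L2R_conv (\<lambda>n. fourier_int (s n)) y"
    using assms(1) by (auto simp: FP_lim_def)
  obtain r where r: "\<And>n. integrable lborel (r n)" "L2R_conv r g" "L2R_conv (\<lambda>n. fourier_int (r n)) z"
    using assms(2) by (auto simp: FP_lim_def)
  show ?thesis
  proof (rule LIMSEQ_le[OF L2R_conv_dist_tendsto[OF s(3) r(3)] L2R_conv_dist_tendsto[OF s(2) r(2)]])
    show "\<exists>N. \<forall>n\<ge>N. L2R_dist (fourier_int (s n)) (fourier_int (r n)) \<le> L2R_dist (s n) (r n)"
      using s r by (intro exI allI impI L2R_dist_fourier_int_le) (auto simp: L2R_conv_def)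
  qed
qed

lemma FP_lim_unique:
  assumes "FP_lim f y" "FP_lim g z" "AE t in lborel. f t = g t"
  shows "AE t in lborel. y t = z t"
proof -
  note L = FP_lim_L2R[OF assms(1)] FP_lim_L2R[OF assms(2)]
  have "L2R_dist f g = 0" using assms(3) L by (simp add: L2R_dist_0_iff)
  with FP_lim_dist_le[OF assms(1,2)] have "L2R_dist y z = 0"
    using L2R_dist_nonneg[of y z] by linarith
  then show ?thesis using L by (simp add: L2R_dist_0_iff)
qed

lemma FP_lim_fourier_int:
  assumes "integrable lborel f" "f \<in> L2R" shows "FP_lim f (fourier_int f)"
  unfolding FP_lim_def using assms fourier_int_L2R[OF assms]
  by (intro exI[of _ "\<lambda>_. f"]) (simp add: L2R_conv_def L2R_dist_def)

text \<open>The indicator of a set of finite measure is itself in L2, so its product with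
  \<open>f\<close> is integrable.\<close>

lemma L2R_truncate:
  assumes f: "f \<in> L2R" and A: "A \<in> sets lborel" "emeasure lborel A < \<infinity>"
  shows "integrable lborel (\<lambda>t. indicator A t * f t)" "(\<lambda>t. indicator A t * f t) \<in> L2R"
proof -
  have sq: "(cmod (indicator A t))\<^sup>2 = indicat_real A t" for t by (simp add: indicator_def)
  have "(\<lambda>t. indicator A t) \<in> L2R"
    using A by (simp add: L2R_def sq integrable_real_indicator)
  then show "integrable lborel (\<lambda>t. indicator A t * f t)" using f by (rule L2R_mult_integrable)
  show "(\<lambda>t. indicator A t * f t) \<in> L2R"
    using A f by (intro L2R_cmod_le[OF f]) (auto simp: indicator_def)
qed

lemma L2R_truncate_conv:
  assumes f: "f \<in> L2R"
  shows "L2R_conv (\<lambda>n t. indicator {- real n..real n} t * f t) f"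
proof -
  define s where "s n t = indicator {- real n..real n} t * f t" for n t
  have s: "s n \<in> L2R" for n
    unfolding s_def using L2R_truncate[OF f, of "{- real n..real n}"] by auto
  have "L2R_conv s f"
  proof (rule L2R_dominated_convergence[OF f])
    fix t :: real
    obtain N :: nat where N: "\<bar>t\<bar> \<le> real N" using real_arch_simple by blast
    have "eventually (\<lambda>n. s n t = f t) sequentially"
      using eventually_ge_at_top[of N]
      by eventually_elim (use N in \<open>auto simp: s_def indicator_def\<close>)
    then show "(\<lambda>n. s n t) \<longlonglongrightarrow> f t" by (rule tendsto_eventually)
  qed (use f s in \<open>auto simp: s_def indicator_def dest: L2R_measurable\<close>)
  then show ?thesis by (simp add: s_def[abs_def])
qed

text \<open>The contraction bound turns the truncations into a Cauchy sequence of transforms;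
  completeness supplies the limit.\<close>

lemma FP_lim_exists:
  assumes f: "f \<in> L2R" shows "\<exists>y. FP_lim f y"
proof -
  define s where "s n t = indicator {- real n..real n} t * f t" for n t
  have s: "integrable lborel (s n)" "s n \<in> L2R" for n
    unfolding s_def using L2R_truncate[OF f, of "{- real n..real n}"] by auto
  have conv: "L2R_conv s f"
    unfolding s_def[abs_def] by (rule L2R_truncate_conv[OF f])
  have "\<exists>y. L2R_conv (\<lambda>n. fourier_int (s n)) y"
  proof (rule L2R_complete)
    fix e :: real assume "e > 0"
    from L2R_conv_Cauchy[OF conv this] show "\<exists>N. \<forall>m\<ge>N. \<forall>n\<ge>N. L2R_dist (fourier_int (s m)) (fourier_int (s n)) \<le> e"
      using L2R_dist_fourier_int_le[OF s s] by (meson order_trans)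
  qed (use fourier_int_L2R s in auto)
  with s conv show ?thesis by (auto simp: FP_lim_def)
qed

lemma FP_lim_FP: "f \<in> L2R \<Longrightarrow> FP_lim f (FP f)"
proof -
  assume "f \<in> L2R"
  then have "\<exists>y. y \<in> L2R \<and> FP_lim f y" using FP_lim_exists FP_lim_L2R(2) by blast
  then have "FP f \<in> L2R \<and> FP_lim f (FP f)"
    unfolding FP_def FP_lim_def by (rule someI_ex)
  then show ?thesis ..
qed

lemma FP_L2R: "f \<in> L2R \<Longrightarrow> FP f \<in> L2R"
  using FP_lim_FP FP_lim_L2R(2) by blast

lemma FP_AE_fourier_int:
  assumes "integrable lborel f" "f \<in> L2R"
  shows "AE t in lborel. FP f t = fourier_int f t"
  using FP_lim_unique[OF FP_lim_FP FP_lim_fourier_int] assms by auto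

lemma FP_cong_AE:
  assumes "f \<in> L2R" "g \<in> L2R" "AE t in lborel. f t = g t"
  shows "AE t in lborel. FP f t = FP g t"
  using FP_lim_unique[OF FP_lim_FP FP_lim_FP] assms by auto

lemma FP_dist_le:
  assumes "f \<in> L2R" "g \<in> L2R" shows "L2R_dist (FP f) (FP g) \<le> L2R_dist f g"
  using FP_lim_dist_le[OF FP_lim_FP FP_lim_FP] assms by auto

text \<open>The limits are taken one at a time: with \<open>r m\<close> and its transform held
  fixed, \<open>n\<close> goes to infinity, and only then \<open>m\<close>. Duality thus extends
  from integrable functions to L2.\<close>

lemma FP_lim_mult_integral:
  assumes "FP_lim f y" "FP_lim g z"
  shows "(LINT t|lborel. y t * g t) = (LINT t|lborel. f t * z t)"
proof -
  obtain s where s: "\<And>n. integrable lborel (s n)" "L2R_conv s f" "L2R_conv (\<lambda>n. fourier_int (s n)) y"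
    using assms(1) by (auto simp: FP_lim_def)
  obtain r where r: "\<And>n. integrable lborel (r n)" "L2R_conv r g" "L2R_conv (\<lambda>n. fourier_int (r n)) z"
    using assms(2) by (auto simp: FP_lim_def)
  have rL: "r m \<in> L2R" for m using r(2) by (simp add: L2R_conv_def)
  have "(LINT t|lborel. r m t * y t) = (LINT t|lborel. fourier_int (r m) t * f t)" for m
  proof -
    have "(\<lambda>n. LINT t|lborel. fourier_int (s n) t * r m t) \<longlonglongrightarrow> (LINT t|lborel. y t * r m t)"
      by (rule L2R_conv_mult_integral[OF s(3) rL])
    moreover have "(\<lambda>n. LINT t|lborel. fourier_int (s n) t * r m t) \<longlonglongrightarrow> (LINT t|lborel. f t * fourier_int (r m) t)"
      unfolding integral_fourier_int_mult[OF s(1) r(1)]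
      by (rule L2R_conv_mult_integral[OF s(2) fourier_int_L2R(1)[OF r(1) rL]])
    ultimately show ?thesis by (simp add: mult.commute LIMSEQ_unique)
  qed
  moreover have "(\<lambda>m. LINT t|lborel. r m t * y t) \<longlonglongrightarrow> (LINT t|lborel. g t * y t)"
    by (rule L2R_conv_mult_integral[OF r(2) FP_lim_L2R(2)[OF assms(1)]])
  moreover have "(\<lambda>m. LINT t|lborel. fourier_int (r m) t * f t) \<longlonglongrightarrow> (LINT t|lborel. z t * f t)"
    by (rule L2R_conv_mult_integral[OF r(3) FP_lim_L2R(1)[OF assms(1)]])
  ultimately show ?thesis by (simp add: mult.commute LIMSEQ_unique)
qed

text \<open>Levy's uniqueness theorem speaks of probability measures. The positive and negative
  parts of \<open>k\<close> have equal transforms and, from frequency 0, equal mass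
  \<open>c\<close>; divided by \<open>c\<close> they are densities with the same characteristic
  function.\<close>

lemma real_L1_fourier_unique:
  fixes k :: "real \<Rightarrow> real"
  assumes k: "integrable lborel k"
    and 0: "\<And>b. (LINT x|lborel. complex_of_real (k x) * expi (b * x)) = 0"
  shows "AE x in lborel. k x = 0"
proof -
  have [measurable]: "k \<in> borel_measurable borel" using k by auto
  define p where "p x = max 0 (k x)" for x
  define m where "m x = max 0 (- k x)" for x
  have [measurable]: "p \<in> borel_measurable borel" "m \<in> borel_measurable borel"
    unfolding p_def m_def by measurable
  have int: "integrable lborel p" "integrable lborel m"
    unfolding p_def m_def using k by auto
  have nn: "0 \<le> p x" "0 \<le> m x" for x by (auto simp: p_def m_def)
  have km: "k x = p x - m x" for x by (auto simp: p_def m_def)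
  have eq: "(LINT x|lborel. complex_of_real (p x) * expi (b * x)) = (LINT x|lborel. complex_of_real (m x) * expi (b * x))" for b
  proof -
    have "(LINT x|lborel. complex_of_real (k x) * expi (b * x))
        = (LINT x|lborel. complex_of_real (p x) * expi (b * x) - complex_of_real (m x) * expi (b * x))"
      by (simp add: km algebra_simps)
    also have "\<dots> = (LINT x|lborel. complex_of_real (p x) * expi (b * x)) - (LINT x|lborel. complex_of_real (m x) * expi (b * x))"
      using int by (intro Bochner_Integration.integral_diff integrable_mult_expi) auto
    finally show ?thesis using 0 by simp
  qed
  define c where "c = (LINT x|lborel. p x)"
  have cm: "c = (LINT x|lborel. m x)"
    using eq[of 0] by (simp add: c_def expi_def del: of_real_eq_iff flip: of_real_eq_iff[where 'a=complex])
  show ?thesis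
  \<comment> \<open>With mass 0 there is nothing to normalise: both parts vanish almost
    everywhere.\<close>
  proof (cases "c = 0")
    case True
    then have "AE x in lborel. p x = 0" "AE x in lborel. m x = 0"
      using integral_nonneg_eq_0_iff_AE[OF int(1)] integral_nonneg_eq_0_iff_AE[OF int(2)] nn cm
      by (auto simp: c_def)
    then show ?thesis by eventually_elim (simp add: km)
  next
    case False
    have "0 \<le> c" unfolding c_def using nn by simp
    with False have c: "c > 0" by simp
    have rd: "real_distribution (density lborel (\<lambda>x. ennreal (q x / c)))"
      if "integrable lborel q" "\<And>x. 0 \<le> q x" "(LINT x|lborel. q x) = c" for q
    proof -
      have [measurable]: "q \<in> borel_measurable borel" using that(1) by auto
      have "(\<integral>\<^sup>+x. ennreal (q x / c) \<partial>lborel) = ennreal (LINT x|lborel. q x / c)"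
        using that c by (intro nn_integral_eq_integral) auto
      also have "\<dots> = 1" using that c by simp
      finally have "prob_space (density lborel (\<lambda>x. ennreal (q x / c)))"
        by (intro prob_spaceI) (simp add: emeasure_density)
      then show ?thesis
        by (simp add: real_distribution_def real_distribution_axioms_def)
    qed
    have ch: "char (density lborel (\<lambda>x. ennreal (q x / c))) b = (LINT x|lborel. complex_of_real (q x) * expi (b * x)) / c"
      if "integrable lborel q" "\<And>x. 0 \<le> q x" for q b
    proof -
      have [measurable]: "q \<in> borel_measurable borel" using that(1) by auto
      have "char (density lborel (\<lambda>x. ennreal (q x / c))) b = (LINT x|lborel. (q x / c) *\<^sub>R exp (\<i> * complex_of_real (b * x)))"
        unfolding char_def using that c by (subst integral_density) auto
      also have "\<dots> = (LINT x|lborel. complex_of_real (q x) * expi (b * x) / c)"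
        by (simp add: scaleR_conv_of_real expi_def)
      finally show ?thesis by simp
    qed
    have "density lborel (\<lambda>x. ennreal (p x / c)) = density lborel (\<lambda>x. ennreal (m x / c))"
    proof (rule Levy_uniqueness)
      show "char (density lborel (\<lambda>x. ennreal (p x / c))) = char (density lborel (\<lambda>x. ennreal (m x / c)))"
        using ch[OF int(1) nn(1)] ch[OF int(2) nn(2)] eq by (simp add: fun_eq_iff)
    qed (use rd int nn c_def cm in auto)
    then have "AE x in lborel. ennreal (p x / c) = ennreal (m x / c)"
      by (subst (asm) sigma_finite_measure.density_unique_iff[OF sigma_finite_lborel]) auto
    then show ?thesis
      by eventually_elim (use c nn in \<open>simp add: km\<close>)
  qed
qed

text \<open>The transform of \<open>cnj k\<close> at b is the conjugate of that of \<open>k\<close>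
  at -b. It vanishes too, and with it the transforms of the real and imaginary parts.\<close>

lemma L1_fourier_unique:
  fixes k :: "real \<Rightarrow> complex"
  assumes k: "integrable lborel k" and 0: "\<And>b. (LINT x|lborel. k x * expi (b * x)) = 0"
  shows "AE x in lborel. k x = 0"
proof -
  have c0: "(LINT x|lborel. cnj (k x) * expi (b * x)) = 0" for b
  proof -
    have "(LINT x|lborel. cnj (k x) * expi (b * x)) = (LINT x|lborel. cnj (k x * expi ((- b) * x)))"
      by (simp add: cnj_expi)
    also have "\<dots> = cnj (LINT x|lborel. k x * expi ((- b) * x))"
      by (rule Bochner_Integration.integral_cnj)
    finally show ?thesis by (simp only: 0 complex_cnj_zero)
  qed
  have i: "integrable lborel (\<lambda>x. k x * expi (b * x))" "integrable lborel (\<lambda>x. cnj (k x) * expi (b * x))" for b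
    using k by (auto intro!: integrable_mult_expi)
  have "AE x in lborel. Re (k x) = 0"
  proof (rule real_L1_fourier_unique)
    fix b
    have "(LINT x|lborel. complex_of_real (Re (k x)) * expi (b * x))
        = (LINT x|lborel. (k x * expi (b * x) + cnj (k x) * expi (b * x)) / 2)"
      by (simp add: complex_add_cnj flip: distrib_right)
    also have "\<dots> = 0" using i 0 c0 by simp
    finally show "(LINT x|lborel. complex_of_real (Re (k x)) * expi (b * x)) = 0" .
  qed (use k in auto)
  moreover have "AE x in lborel. Im (k x) = 0"
  proof (rule real_L1_fourier_unique)
    fix b
    have "(LINT x|lborel. complex_of_real (Im (k x)) * expi (b * x))
        = (LINT x|lborel. (k x * expi (b * x) - cnj (k x) * expi (b * x)) / (2 * \<i>))"
    proof -
      have "complex_of_real (Im z) * e = (z * e - cnj z * e) / (2 * \<i>)" for z e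
        by (simp add: complex_eq_iff)
      then show ?thesis by (simp only:)
    qed
    also have "\<dots> = 0" using i 0 c0 by simp
    finally show "(LINT x|lborel. complex_of_real (Im (k x)) * expi (b * x)) = 0" .
  qed (use k in auto)
  ultimately show ?thesis by eventually_elim (simp add: complex_eq_iff)
qed

section \<open>Gaussian test functions and the square of the Fourier-Plancherel operator\<close>

lemma gaussian_L2R: "(\<lambda>t. complex_of_real (exp (- (t + b)\<^sup>2 / 2)) * expi (a * t)) \<in> L2R"
proof -
  \<comment> \<open>With sigma = 1 / sqrt 2 the denominator 2 sigma^2 is 1, as fits e^(-t^2), the
    square of the Gaussian.\<close>
  have "integrable lborel (\<lambda>t. exp (- t\<^sup>2 / (2 * (1 / sqrt 2)\<^sup>2)) :: complex)"
    using gaussian_integrable(1)[of "1 / sqrt 2"] by simp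
  then have "integrable lborel (\<lambda>t. cmod (complex_of_real (exp (- t\<^sup>2))))"
    by (intro integrable_norm) (simp add: power_divide)
  then have "integrable lborel (\<lambda>t. exp (- (b + 1 * t)\<^sup>2))"
    by (subst lborel_integrable_real_affine_iff) auto
  then have "integrable lborel (\<lambda>t. (exp (- (t + b)\<^sup>2 / 2))\<^sup>2)"
    by (simp add: add.commute flip: exp_double)
  then show ?thesis
    by (rule L2R_bound) (auto simp: norm_mult)
qed

lemma gaussian_L1: "integrable lborel (\<lambda>t. complex_of_real (exp (- (t + b)\<^sup>2 / 2)) * expi (a * t))"
proof (rule integrable_mult_expi)
  have "integrable lborel (\<lambda>t. complex_of_real (exp (- (b + 1 * t)\<^sup>2 / 2)))"
    using gaussian_integrable(1)[of 1]
    by (subst lborel_integrable_real_affine_iff) auto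
  then show "integrable lborel (\<lambda>t. complex_of_real (exp (- (t + b)\<^sup>2 / 2)))"
    by (simp add: add.commute)
qed

text \<open>Translations and modulations are exchanged, so up to constant factors the family is
  closed under the transform, and transforming a test function twice stays explicit.\<close>

lemma fourier_int_gaussian:
  "fourier_int (\<lambda>t. complex_of_real (exp (- (t + b)\<^sup>2 / 2)) * expi (a * t)) s
     = complex_of_real (exp (- (s + a)\<^sup>2 / 2)) * expi (- b * (s + a))"
proof -
  have "(LINT t|lborel. complex_of_real (exp (- (t + b)\<^sup>2 / 2)) * expi (a * t) * expi (s * t))
      = (LINT t|lborel. complex_of_real (exp (- (t + b)\<^sup>2 / 2)) * expi ((s + a) * t))"
    by (simp add: mult.assoc flip: expi_add) (simp add: algebra_simps)
  also have "\<dots> = (LINT t|lborel. complex_of_real (exp (- ((- b + 1 * t) + b)\<^sup>2 / 2)) * expi ((s + a) * (- b + 1 * t)))"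
    using lborel_integral_real_affine[of 1 "\<lambda>t. complex_of_real (exp (- (t + b)\<^sup>2 / 2)) * expi ((s + a) * t)" "- b"] by simp
  also have "\<dots> = (LINT t|lborel. expi (- b * (s + a)) * (complex_of_real (exp (- t\<^sup>2 / (2 * 1\<^sup>2))) * expi ((s + a) * t)))"
  proof -
    have "expi ((s + a) * (- b + 1 * t)) = expi (- b * (s + a)) * expi ((s + a) * t)" for t
      by (simp add: algebra_simps flip: expi_add)
    then show ?thesis by (simp add: mult_ac)
  qed
  also have "\<dots> = expi (- b * (s + a)) * (LINT t|lborel. complex_of_real (exp (- t\<^sup>2 / (2 * 1\<^sup>2))) * expi ((s + a) * t))"
    by (rule integral_mult_right_zero)
  also have "\<dots> = expi (- b * (s + a)) * complex_of_real (sqrt (2 * pi) * 1 * exp (- (1 * (s + a))\<^sup>2 / 2))"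
    by (subst gaussian_fourier) simp_all
  finally show ?thesis by (simp add: fourier_int_eq)
qed

text \<open>Tested against the modulated Gaussians \<open>e\<^bsup>-x\<^sup>2/2 + ibx\<^esup>\<close>, whose transforms are explicit,
  the identity becomes the vanishing of the Fourier integral of \<open>(FP (FP f)(x) - f(-x)) e\<^bsup>-x\<^sup>2/2\<^esup>\<close>.\<close>
lemma FP_FP:
  assumes f: "f \<in> L2R"
  shows "AE t in lborel. FP (FP f) t = f (- t)"
proof -
  define h where "h t = FP (FP f) t - f (- t)" for t
  \<comment> \<open>The summand 0 and the factor \<open>expi (0 * t)\<close>, which is 1, keep
    \<open>w\<close> an instance of \<open>gaussian_L2R\<close>.\<close>
  define w where "w t = complex_of_real (exp (- (t + 0)\<^sup>2 / 2)) * expi (0 * t)" for t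
  have w: "w \<in> L2R" unfolding w_def by (rule gaussian_L2R)
  have R: "(\<lambda>t. f (- t)) \<in> L2R" using f by (rule L2R_reflect)
  have FF: "FP (FP f) \<in> L2R" using f by (intro FP_L2R)
  have h: "h \<in> L2R" unfolding h_def using FF R by (rule L2R_diff)
  have "AE x in lborel. h x * w x = 0"
  proof (rule L1_fourier_unique)
    show "integrable lborel (\<lambda>x. h x * w x)" by (rule L2R_mult_integrable[OF h w])
    fix b
    define g where "g t = complex_of_real (exp (- (t + 0)\<^sup>2 / 2)) * expi (b * t)" for t
    \<comment> \<open>The transform of \<open>g\<close> is \<open>g1\<close>, and that of
      \<open>g1\<close> is the reflected \<open>g\<close>. Moving both operators across the pairing
      therefore puts the reflection on \<open>g\<close>, and then on \<open>f\<close>.\<close>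
    define g1 where "g1 t = complex_of_real (exp (- (t + b)\<^sup>2 / 2)) * expi (0 * t)" for t
    have gL: "g \<in> L2R" and g1L: "g1 \<in> L2R" unfolding g_def g1_def by (rule gaussian_L2R)+
    have gI: "integrable lborel g" and g1I: "integrable lborel g1"
      unfolding g_def g1_def by (rule gaussian_L1)+
    have gg1: "fourier_int g = g1"
      unfolding g_def g1_def fourier_int_gaussian by (simp add: fun_eq_iff expi_def)
    have g1g: "fourier_int g1 = (\<lambda>t. g (- t))"
      unfolding g_def g1_def fourier_int_gaussian by (simp add: fun_eq_iff)
    have "(LINT t|lborel. FP (FP f) t * g t) = (LINT t|lborel. FP f t * g1 t)"
      using FP_lim_mult_integral[OF FP_lim_FP[OF FP_L2R[OF f]] FP_lim_fourier_int[OF gI gL]] gg1 by simp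
    also have "\<dots> = (LINT t|lborel. f t * g (- t))"
      using FP_lim_mult_integral[OF FP_lim_FP[OF f] FP_lim_fourier_int[OF g1I g1L]] g1g by simp
    also have "\<dots> = (LINT t|lborel. f (- t) * g t)"
      using integral_reflect[of "\<lambda>t. f t * g (- t)"] by simp
    finally have "(LINT t|lborel. FP (FP f) t * g t) - (LINT t|lborel. f (- t) * g t) = 0" by simp
    then have "(LINT t|lborel. h t * g t) = 0"
      unfolding h_def left_diff_distrib
      by (subst Bochner_Integration.integral_diff) (auto intro!: L2R_mult_integrable FF R gL)
    moreover have "(\<lambda>t. h t * w t * expi (b * t)) = (\<lambda>t. h t * g t)"
      by (simp add: w_def g_def expi_def fun_eq_iff)
    ultimately show "(LINT x|lborel. h x * w x * expi (b * x)) = 0" by (simp only:)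
  qed
  \<comment> \<open>The Gaussian weight has no zeros, so it can be cancelled.\<close>
  then show ?thesis
    by eventually_elim (simp add: h_def w_def expi_def)
qed

text \<open>Two contractions in succession give a reflection, which preserves distances; neither of
  them can then shrink a distance.\<close>

lemma FP_dist:
  assumes f: "f \<in> L2R" and g: "g \<in> L2R" shows "L2R_dist (FP f) (FP g) = L2R_dist f g"
proof (rule antisym)
  have "L2R_dist f g = L2R_dist (\<lambda>t. f (- t)) (\<lambda>t. g (- t))" by (simp add: L2R_dist_reflect)
  also have "\<dots> = L2R_dist (FP (FP f)) (FP (FP g))"
    by (rule L2R_dist_cong_AE) (use FP_FP[OF f] FP_FP[OF g] f g in \<open>auto intro: FP_L2R elim: eventually_mono\<close>)
  also have "\<dots> \<le> L2R_dist (FP f) (FP g)" using f g by (intro FP_dist_le FP_L2R)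
  finally show "L2R_dist f g \<le> L2R_dist (FP f) (FP g)" .
qed (rule FP_dist_le[OF f g])

lemma FP_AE_inject:
  assumes "f \<in> L2R" "g \<in> L2R" "AE t in lborel. FP f t = FP g t"
  shows "AE t in lborel. f t = g t"
  using assms FP_dist[of f g] L2R_dist_0_iff[of f g] L2R_dist_0_iff[of "FP f" "FP g"] FP_L2R by auto

text \<open>Since \<open>FP\<close> applied twice reflects, the transform of the reflected
  \<open>g\<close> is a preimage of \<open>g\<close>.\<close>

lemma FP_surj:
  assumes g: "g \<in> L2R" shows "\<exists>f\<in>L2R. AE t in lborel. FP f t = g t"
proof
  show "FP (\<lambda>t. g (- t)) \<in> L2R" using g by (intro FP_L2R L2R_reflect)
  show "AE t in lborel. FP (FP (\<lambda>t. g (- t))) t = g t"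
    using FP_FP[OF L2R_reflect[OF g]] by simp
qed

text \<open>Supplies the conjugate that the bilinear duality lacks. Conjugation flips the sign in
  the exponential, and the reflection restores it.\<close>

lemma FP_cnj:
  assumes g: "g \<in> L2R"
  shows "AE t in lborel. FP (\<lambda>t. cnj (g (- t))) t = cnj (FP g t)"
proof -
  obtain s where s: "\<And>n. integrable lborel (s n)" "L2R_conv s g" "L2R_conv (\<lambda>n. fourier_int (s n)) (FP g)"
    using FP_lim_FP[OF g] by (auto simp: FP_lim_def)
  have int: "integrable lborel (\<lambda>t. cnj (s n (- t)))" for n
    using lborel_integrable_real_affine[OF s(1)[of n], of "-1" 0] by simp
  have fi: "fourier_int (\<lambda>t. cnj (s n (- t))) u = cnj (fourier_int (s n) u)" for n u
  proof -
    have "(LINT t|lborel. cnj (s n (- t)) * expi (u * t)) = (LINT t|lborel. cnj (s n t) * expi (u * (- t)))"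
      using integral_reflect[of "\<lambda>t. cnj (s n t) * expi (u * (- t))"] by simp
    also have "\<dots> = (LINT t|lborel. cnj (s n t * expi (u * t)))"
      by (simp add: cnj_expi)
    also have "\<dots> = cnj (LINT t|lborel. s n t * expi (u * t))"
      by (rule Bochner_Integration.integral_cnj)
    finally show ?thesis by (simp add: fourier_int_eq)
  qed
  have "FP_lim (\<lambda>t. cnj (g (- t))) (\<lambda>t. cnj (FP g t))"
    unfolding FP_lim_def
  proof (intro exI conjI allI)
    show "integrable lborel (\<lambda>t. cnj (s n (- t)))" for n by (rule int)
    show "L2R_conv (\<lambda>n t. cnj (s n (- t))) (\<lambda>t. cnj (g (- t)))"
      using s(2) L2R_dist_reflect[of "\<lambda>t. cnj (s _ t)" "\<lambda>t. cnj (g t)"]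
      by (auto simp: L2R_conv_def L2R_dist_cnj intro!: L2R_cnj L2R_reflect)
    show "L2R_conv (\<lambda>n. fourier_int (\<lambda>t. cnj (s n (- t)))) (\<lambda>t. cnj (FP g t))"
      using s(3) unfolding fi[abs_def] by (auto simp: L2R_conv_def L2R_dist_cnj)
  qed
  from FP_lim_unique[OF FP_lim_FP[OF L2R_cnj[OF L2R_reflect[OF g]]] this] show ?thesis by simp
qed

text \<open>With \<open>r t = cnj (g (- t))\<close> the conjugated factor is itself the transform
  \<open>FP r\<close>. Duality moves the other transform onto it, and \<open>FP (FP r)\<close> is
  the reflected \<open>r\<close>, that is, \<open>cnj g\<close>.\<close>

lemma FP_inner:
  assumes f: "f \<in> L2R" and g: "g \<in> L2R"
  shows "(LINT t|lborel. FP f t * cnj (FP g t)) = (LINT t|lborel. f t * cnj (g t))"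
proof -
  define r where "r t = cnj (g (- t))" for t
  have r: "r \<in> L2R" unfolding r_def using g by auto
  have m: "FP f \<in> borel_measurable borel" "FP g \<in> borel_measurable borel" "FP r \<in> borel_measurable borel"
    "FP (FP r) \<in> borel_measurable borel" "f \<in> borel_measurable borel" "g \<in> borel_measurable borel"
    using f g r by (auto intro: L2R_measurable FP_L2R)
  note [measurable] = m
  have FPr: "AE t in lborel. FP r t = cnj (FP g t)"
    using FP_cnj[OF g] by (simp add: r_def[abs_def])
  have "(LINT t|lborel. FP f t * cnj (FP g t)) = (LINT t|lborel. FP f t * FP r t)"
    using FPr by (intro integral_cong_AE) (auto elim: eventually_mono)
  also have "\<dots> = (LINT t|lborel. f t * FP (FP r) t)"
    using FP_lim_mult_integral[OF FP_lim_FP[OF f] FP_lim_FP[OF FP_L2R[OF r]]] .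
  also have "\<dots> = (LINT t|lborel. f t * cnj (g t))"
    using FP_FP[OF r] by (intro integral_cong_AE) (auto simp: r_def elim: eventually_mono)
  finally show ?thesis .
qed

section \<open>The exponential change of variables\<close>

text \<open>The logarithm carries dx/x, the Haar measure of the multiplicative group of positive
  reals, to Lebesgue measure. The density vanishes at nonpositive arguments, where \<open>ln\<close>
  has only conventional values.\<close>

lemma lborel_eq_distr_ln:
  "(lborel :: real measure) = distr (density lborel (\<lambda>x. ennreal (indicator {0<..} x / x))) borel ln"
proof (rule lborel_eqI)
  fix l u :: real
  assume "\<And>b. b \<in> Basis \<Longrightarrow> l \<bullet> b \<le> u \<bullet> b"
  then have le: "l \<le> u" by simp
  have "emeasure (distr (density lborel (\<lambda>x. ennreal (indicator {0<..} x / x))) borel ln) (box l u)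
      = emeasure (density lborel (\<lambda>x. ennreal (indicator {0<..} x / x))) (ln -` {l<..<u})"
    by (subst emeasure_distr) (auto simp: box_real)
  also have "\<dots> = (\<integral>\<^sup>+x. ennreal (indicator {0<..} x / x) * indicator (ln -` {l<..<u}) x \<partial>lborel)"
  proof (rule emeasure_density)
    show "ln -` {l<..<u} \<in> sets lborel"
      using measurable_sets[of ln borel borel "{l<..<u}"] by simp
  qed measurable
  \<comment> \<open>On the interval \<open>max (exp l) x\<close> is just x, and it is positive on
    the whole line. The two endpoints form a null set, so the closed interval of the fundamental
    theorem may replace the open one.\<close>
  also have "\<dots> = (\<integral>\<^sup>+x. ennreal (1 / max (exp l) x) * indicator {exp l..exp u} x \<partial>lborel)"
  proof (rule nn_integral_cong_AE, use AE_lborel_singleton[of "exp l"] AE_lborel_singleton[of "exp u"] in eventually_elim)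
    case (elim x)
    show ?case
    proof (cases "x > 0")
      case True
      then have "x \<in> ln -` {l<..<u} \<longleftrightarrow> x \<in> {exp l..exp u}"
        using elim ln_ge_iff[of x l] ln_le_cancel_iff[of x "exp u"] ln_unique[of l x] ln_unique[of u x]
        by (auto simp: less_le)
      with True show ?thesis by (auto simp: indicator_def max_def)
    next
      case False
      then have "x \<notin> {exp l..exp u}" using exp_gt_zero[of l] by (auto simp del: exp_gt_zero)
      with False show ?thesis by (auto simp: indicator_def)
    qed
  qed
  also have "\<dots> = ennreal (ln (exp u) - ln (exp l))"
  proof (rule nn_integral_FTC_Icc)
    fix x assume "x \<in> {exp l..exp u}"
    then have "exp l \<le> x" "x \<le> exp u" by auto
    moreover from this have "x > 0" using exp_gt_zero[of l] by linarith
    ultimately show "(ln has_real_derivative 1 / max (exp l) x) (at x)"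
      by (auto intro!: derivative_eq_intros simp: max_def)
  qed (use le in \<open>auto simp: le_max_iff_disj dest: order_trans[OF exp_ge_zero]\<close>)
  finally show "emeasure (distr (density lborel (\<lambda>x. ennreal (indicator {0<..} x / x))) borel ln) (box l u)
      = (\<Prod>b\<in>Basis. (u - l) \<bullet> b)" by simp
qed simp

text \<open>The rules for image measures and densities cover all measurable functions, so the
  integrals agree also where they take the default value 0. The equivalence lets membership in
  \<open>L2pos\<close> and \<open>Udom\<close> be read off on the line in both directions.\<close>

lemma integral_exp_substitution:
  fixes k :: "real \<Rightarrow> 'a::{banach, second_countable_topology}"
  assumes [measurable]: "k \<in> borel_measurable borel"
  shows "integrable lborel (\<lambda>s. exp s *\<^sub>R k (exp s)) \<longleftrightarrow> set_integrable lborel {0<..} k"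
    and "(LINT s|lborel. exp s *\<^sub>R k (exp s)) = (LINT x:{0<..}|lborel. k x)"
proof -
  let ?h = "\<lambda>s. exp s *\<^sub>R k (exp s)"
  let ?D = "density lborel (\<lambda>x. ennreal (indicator {0<..} x / x))"
  have eq: "(indicator {0<..} x / x) *\<^sub>R ?h (ln x) = indicator {0<..} x *\<^sub>R k x" for x :: real
    by (auto simp: indicator_def)
  have lnm: "ln \<in> measurable ?D borel" by simp
  have nn: "AE x in lborel. 0 \<le> indicator {0<..} x / (x::real)" by (auto simp: indicator_def)
  have "integrable lborel ?h \<longleftrightarrow> integrable (distr ?D borel ln) ?h"
    by (simp flip: lborel_eq_distr_ln)
  also have "\<dots> \<longleftrightarrow> integrable ?D (\<lambda>x. ?h (ln x))"
    by (rule integrable_distr_eq[OF lnm]) measurable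
  also have "\<dots> \<longleftrightarrow> integrable lborel (\<lambda>x. (indicator {0<..} x / x) *\<^sub>R ?h (ln x))"
    by (rule integrable_density[OF _ _ nn]) measurable
  finally show "integrable lborel ?h \<longleftrightarrow> set_integrable lborel {0<..} k"
    by (simp only: eq set_integrable_def)
  have "integral\<^sup>L lborel ?h = integral\<^sup>L (distr ?D borel ln) ?h"
    by (simp flip: lborel_eq_distr_ln)
  also have "\<dots> = (LINT x|?D. ?h (ln x))"
    by (rule integral_distr[OF lnm]) measurable
  also have "\<dots> = (LINT x|lborel. (indicator {0<..} x / x) *\<^sub>R ?h (ln x))"
    by (rule integral_density[OF _ _ nn]) measurable
  finally show "integral\<^sup>L lborel ?h = (LINT x:{0<..}|lborel. k x)"
    by (simp only: eq set_lebesgue_integral_def)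
qed

text \<open>The factor e^(s/2) is the square root of the Jacobian e^s; it makes the change of
  variables preserve inner products.\<close>

definition log_pullback :: "(real \<Rightarrow> complex) \<Rightarrow> real \<Rightarrow> complex" where
  "log_pullback x s = complex_of_real (exp (s / 2)) * x (exp s)"

text \<open>Inverse to \<open>log_pullback\<close> on the positive axis, where alone elements of
  \<open>L2pos\<close> are determined; elsewhere the value is set to 0.\<close>

definition log_pushforward :: "(real \<Rightarrow> complex) \<Rightarrow> real \<Rightarrow> complex" where
  "log_pushforward g \<xi> = indicator {0<..} \<xi> * complex_of_real (\<xi> powr (-1/2)) * g (ln \<xi>)"

lemma log_pullback_measurable [measurable]:
  assumes [measurable]: "x \<in> borel_measurable borel"
  shows "log_pullback x \<in> borel_measurable borel"
  unfolding log_pullback_def[abs_def] by measurable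

lemma exp_half_power2: "(exp (s / 2))\<^sup>2 = exp (s::real)"
  by (simp flip: exp_double)

lemma L2pos_measurable [measurable_dest]: "x \<in> L2pos \<Longrightarrow> x \<in> borel_measurable borel"
  by (simp add: L2pos_def)

lemma L2R_log_pullback_iff:
  assumes [measurable]: "x \<in> borel_measurable borel"
  shows "log_pullback x \<in> L2R \<longleftrightarrow> x \<in> L2pos"
proof -
  have "(cmod (log_pullback x s))\<^sup>2 = exp s *\<^sub>R (cmod (x (exp s)))\<^sup>2" for s
    by (simp add: log_pullback_def norm_mult power_mult_distrib exp_half_power2)
  then show ?thesis
    using integral_exp_substitution(1)[of "\<lambda>\<xi>. (cmod (x \<xi>))\<^sup>2"] by (simp add: L2R_def L2pos_def)
qed

lemma L2R_log_pullback: "x \<in> L2pos \<Longrightarrow> log_pullback x \<in> L2R"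
  using L2R_log_pullback_iff[of x] by (simp add: L2pos_measurable)

lemma L2R_dist_log_pullback:
  assumes [measurable]: "x \<in> borel_measurable borel" "y \<in> borel_measurable borel"
  shows "L2R_dist (log_pullback x) (log_pullback y) = L2pos_dist x y"
proof -
  have "(cmod (log_pullback x s - log_pullback y s))\<^sup>2 = exp s *\<^sub>R (cmod (x (exp s) - y (exp s)))\<^sup>2" for s
    by (simp add: log_pullback_def norm_mult power_mult_distrib exp_half_power2 flip: right_diff_distrib)
  then show ?thesis
    using integral_exp_substitution(2)[of "\<lambda>\<xi>. (cmod (x \<xi> - y \<xi>))\<^sup>2"] by (simp add: L2R_dist_def L2pos_dist_def)
qed

lemma L2pos_inner_log_pullback:
  assumes [measurable]: "x \<in> borel_measurable borel" "y \<in> borel_measurable borel"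
  shows "(LINT s|lborel. log_pullback x s * cnj (log_pullback y s)) = L2pos_inner x y"
proof -
  have "log_pullback x s * cnj (log_pullback y s) = exp s *\<^sub>R (x (exp s) * cnj (y (exp s)))" for s
  proof -
    have "complex_of_real (exp (s / 2)) * complex_of_real (exp (s / 2)) = complex_of_real (exp s)"
      by (simp only: of_real_mult[symmetric] power2_eq_square[symmetric] of_real_power[symmetric] exp_half_power2)
    moreover have "log_pullback x s * cnj (log_pullback y s)
        = (complex_of_real (exp (s / 2)) * complex_of_real (exp (s / 2))) * (x (exp s) * cnj (y (exp s)))"
      by (simp add: log_pullback_def mult_ac)
    ultimately show ?thesis by (simp only: scaleR_conv_of_real)
  qed
  then show ?thesis
    using integral_exp_substitution(2)[of "\<lambda>\<xi>. x \<xi> * cnj (y \<xi>)"] by (simp add: L2pos_inner_def)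
qed

lemma log_pullback_pushforward [simp]: "log_pullback (log_pushforward g) = g"
proof
  fix s :: real
  have "exp (s / 2) * exp s powr (-1/2) = 1"
    by (simp add: powr_def flip: exp_add)
  then have "complex_of_real (exp (s / 2)) * complex_of_real (exp s powr (-1/2)) = 1"
    by (simp only: of_real_mult[symmetric] of_real_1)
  then show "log_pullback (log_pushforward g) s = g s"
    by (simp add: log_pullback_def log_pushforward_def mult.assoc[symmetric])
qed

lemma log_pushforward_measurable [measurable]:
  assumes [measurable]: "g \<in> borel_measurable borel"
  shows "log_pushforward g \<in> borel_measurable borel"
  unfolding log_pushforward_def[abs_def] by measurable

lemma L2pos_log_pushforward: "g \<in> L2R \<Longrightarrow> log_pushforward g \<in> L2pos"
  using L2R_log_pullback_iff[of "log_pushforward g"] by (simp add: L2R_measurable)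

text \<open>For xi = e^s the Jacobian and the weight xi^(-1/2) combine to e^(s/2), so the domain of
  U corresponds to the intersection of L1 and L2 on the line.\<close>

lemma Udom_iff:
  "x \<in> Udom \<longleftrightarrow> x \<in> L2pos \<and> integrable lborel (log_pullback x)"
proof (cases "x \<in> L2pos")
  case True
  note [measurable] = L2pos_measurable[OF True]
  have "cmod (log_pullback x s) = exp s *\<^sub>R (cmod (x (exp s)) * exp s powr (-1/2))" for s
  proof -
    have "exp s * exp s powr (-1/2) = exp (s / 2)"
      by (simp add: powr_def flip: exp_add)
    then show ?thesis by (simp add: log_pullback_def norm_mult mult_ac)
  qed
  then have "integrable lborel (\<lambda>s. cmod (log_pullback x s)) \<longleftrightarrow> x \<in> Udom"
    using integral_exp_substitution(1)[of "\<lambda>\<xi>. cmod (x \<xi>) * \<xi> powr (-1/2)"] True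
    by (simp add: Udom_def)
  then show ?thesis using True integrable_norm_iff[of "log_pullback x" lborel] by auto
qed (auto simp: Udom_def)

text \<open>The power xi^(i sigma mu) becomes the character e^(i sigma mu s). Both components of U
  are thus values of one Fourier integral, at mu and at -mu.\<close>

lemma U_comp_eq_fourier_int:
  assumes [measurable]: "x \<in> borel_measurable borel"
  shows "U_comp \<sigma> x \<mu> = fourier_int (log_pullback x) (\<sigma> * \<mu>)"
proof -
  have "exp s *\<^sub>R (x (exp s) * complex_of_real (exp s powr (-1/2)) * exp (\<i> * complex_of_real (\<sigma> * \<mu> * ln (exp s))))
      = log_pullback x s * expi (\<sigma> * \<mu> * s)" for s
  proof -
    have "exp s * exp s powr (-1/2) = exp (s / 2)"
      by (simp add: powr_def flip: exp_add)
    then have "complex_of_real (exp s) * complex_of_real (exp s powr (-1/2)) = complex_of_real (exp (s / 2))"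
      by (simp only: of_real_mult[symmetric])
    then show ?thesis
      by (simp add: log_pullback_def scaleR_conv_of_real expi_def mult_ac)
  qed
  then show ?thesis
    using integral_exp_substitution(2)[of "\<lambda>\<xi>. x \<xi> * complex_of_real (\<xi> powr (-1/2)) * exp (\<i> * complex_of_real (\<sigma> * \<mu> * ln \<xi>))"]
    by (simp add: U_comp_def fourier_int_eq)
qed

section \<open>The model space as a space of functions on the line\<close>

text \<open>The minus component is the transform at negative frequencies, hence the reflection. The
  choice of branch at t = 0 concerns a null set.\<close>

definition glue :: "mvec \<Rightarrow> real \<Rightarrow> complex" where
  "glue y t = (if t > 0 then fst y t else snd y (- t))"

lemma integral_split_reflect:
  fixes k :: "real \<Rightarrow> 'a::{banach, second_countable_topology}"
  assumes k: "integrable lborel k"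
  shows "(LINT t:{0<..}|lborel. k t) + (LINT t:{0<..}|lborel. k (- t)) = (LINT t|lborel. k t)"
proof -
  have "(LINT t:{0<..}|lborel. k (- t)) = (LINT t|lborel. indicator {0<..} (- t) *\<^sub>R k t)"
    unfolding set_lebesgue_integral_def
    using integral_reflect[of "\<lambda>t. indicator {0<..} (- t) *\<^sub>R k t"] by simp
  also have "\<dots> = (LINT t:{..<0}|lborel. k t)"
    unfolding set_lebesgue_integral_def by (intro Bochner_Integration.integral_cong) (auto simp: indicator_def)
  finally have "(LINT t:{0<..}|lborel. k t) + (LINT t:{0<..}|lborel. k (- t))
      = (LINT t|lborel. indicator {0<..} t *\<^sub>R k t + indicator {..<0} t *\<^sub>R k t)"
    unfolding set_lebesgue_integral_def
    using k by (subst Bochner_Integration.integral_add) (auto intro!: integrable_mult_indicator)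
  also have "\<dots> = (LINT t|lborel. k t)"
  proof (rule integral_cong_AE)
    show "AE t in lborel. indicator {0<..} t *\<^sub>R k t + indicator {..<0} t *\<^sub>R k t = k t"
      using AE_lborel_singleton[of "0::real"] by eventually_elim (auto simp: indicator_def)
  qed (use k in auto)
  finally show ?thesis .
qed

lemma integrable_split_reflect:
  fixes k :: "real \<Rightarrow> 'a::{banach, second_countable_topology}"
  assumes [measurable]: "k \<in> borel_measurable borel"
    and "set_integrable lborel {0<..} k" "set_integrable lborel {0<..} (\<lambda>t. k (- t))"
  shows "integrable lborel k"
proof -
  have "integrable lborel (\<lambda>t. indicator {0<..} (- t) *\<^sub>R k t)"
    using lborel_integrable_real_affine[of "\<lambda>t. indicator {0<..} t *\<^sub>R k (- t)" "-1" 0] assms(3)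
    by (simp add: set_integrable_def)
  moreover have "integrable lborel (\<lambda>t. indicator {0<..} t *\<^sub>R k t)"
    using assms(2) by (simp add: set_integrable_def)
  ultimately have "integrable lborel (\<lambda>t. indicator {0<..} t *\<^sub>R k t + indicator {0<..} (- t) *\<^sub>R k t)"
    by auto
  then show ?thesis
  proof (rule integrable_cong_AE_imp)
    show "AE t in lborel. indicator {0<..} t *\<^sub>R k t + indicator {0<..} (- t) *\<^sub>R k t = k t"
      using AE_lborel_singleton[of "0::real"] by eventually_elim (auto simp: indicator_def)
  qed simp
qed

lemma Mspace_iff: "y \<in> Mspace \<longleftrightarrow> fst y \<in> L2pos \<and> snd y \<in> L2pos"
  by (cases y) (simp add: Mspace_def)

lemma glue_L2R:
  assumes "y \<in> Mspace" shows "glue y \<in> L2R"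
proof -
  have L: "fst y \<in> L2pos" "snd y \<in> L2pos" using assms by (auto simp: Mspace_iff)
  note [measurable] = L2pos_measurable[OF L(1)] L2pos_measurable[OF L(2)]
  have [measurable]: "glue y \<in> borel_measurable borel"
    unfolding glue_def[abs_def] by measurable
  have "integrable lborel (\<lambda>t. (cmod (glue y t))\<^sup>2)"
  proof (rule integrable_split_reflect)
    show "set_integrable lborel {0<..} (\<lambda>t. (cmod (glue y t))\<^sup>2)"
      using L(1) unfolding L2pos_def set_integrable_def
      by (auto elim!: integrable_cong_AE_imp intro!: AE_I2 simp: glue_def indicator_def)
    show "set_integrable lborel {0<..} (\<lambda>t. (cmod (glue y (- t)))\<^sup>2)"
      using L(2) unfolding L2pos_def set_integrable_def
      by (auto elim!: integrable_cong_AE_imp intro!: AE_I2 simp: glue_def indicator_def)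
  qed simp
  then show ?thesis by (simp add: L2R_def)
qed

lemma L2pos_of_L2R: "f \<in> L2R \<Longrightarrow> f \<in> L2pos"
  using integrable_mult_indicator[of "{0<..}" lborel "\<lambda>t. (cmod (f t))\<^sup>2"]
  by (simp add: L2pos_def L2R_def set_integrable_def)

lemma Mspace_split: "f \<in> L2R \<Longrightarrow> (f, \<lambda>t. f (- t)) \<in> Mspace"
  by (auto simp: Mspace_iff intro: L2pos_of_L2R)

lemma glue_split [simp]: "glue (f, \<lambda>t. f (- t)) = f"
  by (simp add: glue_def fun_eq_iff)

lemma M_dist_glue:
  assumes y: "y \<in> Mspace" and z: "z \<in> Mspace"
  shows "M_dist y z = L2R_dist (glue y) (glue z)"
proof -
  let ?k = "\<lambda>t. (cmod (glue y t - glue z t))\<^sup>2"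
  have "(L2pos_dist (fst y) (fst z))\<^sup>2 = (LINT t:{0<..}|lborel. (cmod (fst y t - fst z t))\<^sup>2)"
    by (simp add: L2pos_dist_def set_lebesgue_integral_def)
  also have "\<dots> = (LINT t:{0<..}|lborel. ?k t)"
    by (intro set_lebesgue_integral_cong) (auto simp: glue_def)
  finally have 1: "(L2pos_dist (fst y) (fst z))\<^sup>2 = \<dots>" .
  have "(L2pos_dist (snd y) (snd z))\<^sup>2 = (LINT t:{0<..}|lborel. (cmod (snd y t - snd z t))\<^sup>2)"
    by (simp add: L2pos_dist_def set_lebesgue_integral_def)
  also have "\<dots> = (LINT t:{0<..}|lborel. ?k (- t))"
    by (intro set_lebesgue_integral_cong) (auto simp: glue_def)
  finally have 2: "(L2pos_dist (snd y) (snd z))\<^sup>2 = \<dots>" .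
  show ?thesis
    unfolding M_dist_def 1 2
    using integral_split_reflect[OF L2R_integrable[OF L2R_diff[OF glue_L2R[OF y] glue_L2R[OF z]]]]
    by (simp add: L2R_dist_def)
qed

lemma M_inner_glue:
  assumes y: "y \<in> Mspace" and z: "z \<in> Mspace"
  shows "M_inner y z = (LINT t|lborel. glue y t * cnj (glue z t))"
proof -
  let ?k = "\<lambda>t. glue y t * cnj (glue z t)"
  have 1: "L2pos_inner (fst y) (fst z) = (LINT t:{0<..}|lborel. ?k t)"
    unfolding L2pos_inner_def by (intro set_lebesgue_integral_cong) (auto simp: glue_def)
  have 2: "L2pos_inner (snd y) (snd z) = (LINT t:{0<..}|lborel. ?k (- t))"
    unfolding L2pos_inner_def by (intro set_lebesgue_integral_cong) (auto simp: glue_def)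
  show ?thesis
    unfolding M_inner_def 1 2
    by (intro integral_split_reflect L2R_mult_integrable glue_L2R y L2R_cnj z)
qed

lemma M_eq_glue: "M_eq y z \<longleftrightarrow> (AE t in lborel. glue y t = glue z t)"
proof
  assume "M_eq y z"
  then have f: "AE t in lborel. t > 0 \<longrightarrow> fst y t = fst z t"
    and s: "AE t in lborel. t > 0 \<longrightarrow> snd y t = snd z t"
    by (simp_all add: M_eq_def L2pos_eq_def)
  show "AE t in lborel. glue y t = glue z t"
    using f AE_reflect[OF s] AE_lborel_singleton[of "0::real"]
    by eventually_elim (auto simp: glue_def)
next
  assume g: "AE t in lborel. glue y t = glue z t"
  have "L2pos_eq (fst y) (fst z)"
    unfolding L2pos_eq_def using g by eventually_elim (auto simp: glue_def split: if_splits)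
  moreover have "L2pos_eq (snd y) (snd z)"
    unfolding L2pos_eq_def using AE_reflect[OF g] by eventually_elim (auto simp: glue_def split: if_splits)
  ultimately show "M_eq y z" by (simp add: M_eq_def)
qed

lemma L2R_conv_log_pullback:
  assumes "L2pos_conv s x"
  shows "L2R_conv (\<lambda>n. log_pullback (s n)) (log_pullback x)"
  using assms by (auto simp: L2pos_conv_def L2R_conv_def L2R_log_pullback L2R_dist_log_pullback L2pos_measurable)

lemma L2R_conv_glue:
  assumes "M_conv s y" shows "L2R_conv (\<lambda>n. glue (s n)) (glue y)"
  using assms by (auto simp: M_conv_def L2R_conv_def glue_L2R simp flip: M_dist_glue)

section \<open>The operator U read on the line\<close>

lemma U0_eq:
  assumes "x \<in> borel_measurable borel"
  shows "U0 x = (fourier_int (log_pullback x), \<lambda>t. fourier_int (log_pullback x) (- t))"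
  using assms by (simp add: U0_def U_comp_eq_fourier_int fun_eq_iff)

text \<open>Truncations of \<open>log_pullback x\<close>, pushed forward to the half-line, lie in
  \<open>Udom\<close> and their images converge, so the choice in \<open>U\<close> has a candidate.
  Whatever is chosen, its glued form is an \<open>FP_lim\<close> of \<open>log_pullback x\<close>
  and hence agrees with \<open>FP\<close> almost everywhere.\<close>

lemma U_char:
  assumes x: "x \<in> L2pos"
  shows "U x \<in> Mspace" "AE t in lborel. glue (U x) t = FP (log_pullback x) t"
proof -
  let ?P = "\<lambda>y. y \<in> Mspace \<and> (\<exists>s. (\<forall>n. s n \<in> Udom) \<and> L2pos_conv s x \<and> M_conv (\<lambda>n. U0 (s n)) y)"
  let ?V = "log_pullback x"
  have V: "?V \<in> L2R" using x by (rule L2R_log_pullback)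
  define v where "v n t = indicator {- real n..real n} t * ?V t" for n t
  have v: "integrable lborel (v n)" "v n \<in> L2R" for n
    unfolding v_def using L2R_truncate[OF V, of "{- real n..real n}"] by auto
  have vconv: "L2R_conv v ?V"
    unfolding v_def[abs_def] by (rule L2R_truncate_conv[OF V])
  define s where "s n = log_pushforward (v n)" for n
  have sL: "s n \<in> L2pos" for n unfolding s_def using v by (intro L2pos_log_pushforward)
  have sV: "log_pullback (s n) = v n" for n by (simp add: s_def)
  have U0s: "U0 (s n) = (fourier_int (v n), \<lambda>t. fourier_int (v n) (- t))" for n
    using U0_eq[OF L2pos_measurable[OF sL[of n]]] by (simp add: sV)
  let ?y = "(FP ?V, \<lambda>t. FP ?V (- t))"
  have y: "?y \<in> Mspace" using V by (intro Mspace_split FP_L2R)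
  have U0M: "U0 (s n) \<in> Mspace" for n
    unfolding U0s using v by (intro Mspace_split fourier_int_L2R)
  have "?P ?y"
  proof (intro conjI exI allI)
    show "s n \<in> Udom" for n using v sL by (simp add: Udom_iff sV)
    show "L2pos_conv s x"
      using vconv L2R_dist_log_pullback[of "s _" x] x sL
      by (auto simp: L2pos_conv_def L2R_conv_def L2pos_measurable sV)
    have "M_dist (U0 (s n)) ?y = L2R_dist (v n) ?V" for n
    proof -
      have "M_dist (U0 (s n)) ?y = L2R_dist (fourier_int (v n)) (FP ?V)"
        unfolding M_dist_glue[OF U0M y] by (simp add: U0s)
      also have "\<dots> = L2R_dist (FP (v n)) (FP ?V)"
      proof (rule L2R_dist_cong_AE)
        show "AE t in lborel. fourier_int (v n) t = FP (v n) t"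
          using FP_AE_fourier_int[OF v(1)[of n] v(2)[of n]] by eventually_elim simp
      qed (use v V in \<open>auto intro: FP_L2R fourier_int_L2R\<close>)
      finally show ?thesis using FP_dist[OF v(2) V] by simp
    qed
    then show "M_conv (\<lambda>n. U0 (s n)) ?y"
      using vconv y U0M by (simp add: M_conv_def L2R_conv_def)
  qed (rule y)
  then have "?P (U x)" unfolding U_def by (rule someI)
  then obtain r where M: "U x \<in> Mspace" and r: "\<And>n. r n \<in> Udom" "L2pos_conv r x" "M_conv (\<lambda>n. U0 (r n)) (U x)"
    by auto
  show "U x \<in> Mspace" by (rule M)
  have "glue (U0 (r n)) = fourier_int (log_pullback (r n))" for n
    using r(1)[of n] by (simp add: Udom_iff U0_eq L2pos_measurable)
  then have "FP_lim ?V (glue (U x))"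
    unfolding FP_lim_def using r L2R_conv_log_pullback[OF r(2)] L2R_conv_glue[OF r(3)]
    by (intro exI[of _ "\<lambda>n. log_pullback (r n)"]) (auto simp: Udom_iff)
  then show "AE t in lborel. glue (U x) t = FP ?V t"
    using FP_lim_unique[OF _ FP_lim_FP[OF V]] by auto
qed

lemma U_inner:
  assumes x: "x \<in> L2pos" and y: "y \<in> L2pos"
  shows "M_inner (U x) (U y) = L2pos_inner x y"
proof -
  note V = L2R_log_pullback[OF x] L2R_log_pullback[OF y]
  have m: "glue (U x) \<in> borel_measurable borel" "glue (U y) \<in> borel_measurable borel"
    "FP (log_pullback x) \<in> borel_measurable borel" "FP (log_pullback y) \<in> borel_measurable borel"
    using x y V by (auto intro!: L2R_measurable glue_L2R U_char FP_L2R)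
  note [measurable] = m
  have "M_inner (U x) (U y) = (LINT t|lborel. FP (log_pullback x) t * cnj (FP (log_pullback y) t))"
    unfolding M_inner_glue[OF U_char(1)[OF x] U_char(1)[OF y]]
    using U_char(2)[OF x] U_char(2)[OF y] by (intro integral_cong_AE) (auto elim: eventually_elim2)
  also have "\<dots> = L2pos_inner x y"
    using x y by (simp add: FP_inner[OF V] L2pos_inner_log_pullback L2pos_measurable)
  finally show ?thesis .
qed

lemma U_surj:
  assumes z: "z \<in> Mspace" shows "\<exists>x\<in>L2pos. M_eq (U x) z"
proof -
  obtain f where f: "f \<in> L2R" "AE t in lborel. FP f t = glue z t"
    using FP_surj[OF glue_L2R[OF z]] by auto
  have x: "log_pushforward f \<in> L2pos" using f(1) by (rule L2pos_log_pushforward)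
  have "AE t in lborel. glue (U (log_pushforward f)) t = FP f t"
    using U_char(2)[OF x] by simp
  then have "AE t in lborel. glue (U (log_pushforward f)) t = glue z t"
    using f(2) by eventually_elim simp
  with x show ?thesis by (auto simp: M_eq_glue)
qed

text \<open>Membership in \<open>L2pos\<close> says nothing about sizes at t <= 0; the cut is what
  produces an element of L2 on the line.\<close>

lemma L2R_half_line:
  assumes x: "x \<in> L2pos"
  shows "(\<lambda>t. indicator {0<..} t * x t) \<in> L2R"
proof -
  have "(cmod (indicator {0<..} t * x t))\<^sup>2 = indicator {0<..} t *\<^sub>R (cmod (x t))\<^sup>2" for t
    by (auto simp: indicator_def)
  with x show ?thesis by (auto simp: L2R_def L2pos_def set_integrable_def)
qed

lemma L2R_dist_half_line:
  "L2R_dist (\<lambda>t. indicator {0<..} t * x t) (\<lambda>t. indicator {0<..} t * y t) = L2pos_dist x y"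
  unfolding L2R_dist_def L2pos_dist_def set_lebesgue_integral_def
  by (intro arg_cong[where f=sqrt] Bochner_Integration.integral_cong) (auto simp: indicator_def)

lemma L2pos_eq_of_dist:
  assumes x: "x \<in> L2pos" and y: "y \<in> L2pos" and 0: "L2pos_dist x y = 0"
  shows "L2pos_eq x y"
proof -
  have "L2R_dist (\<lambda>t. indicator {0<..} t * x t) (\<lambda>t. indicator {0<..} t * y t) = 0"
    using 0 by (simp add: L2R_dist_half_line)
  then have "AE t in lborel. indicator {0<..} t * x t = indicator {0<..} t * y t"
    using L2R_dist_0_iff[OF L2R_half_line[OF x] L2R_half_line[OF y]] by simp
  then show ?thesis
    unfolding L2pos_eq_def by eventually_elim (auto simp: indicator_def split: if_splits)
qed

lemma U_inject:
  assumes x: "x \<in> L2pos" and y: "y \<in> L2pos" and eq: "M_eq (U x) (U y)"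
  shows "L2pos_eq x y"
proof -
  note V = L2R_log_pullback[OF x] L2R_log_pullback[OF y]
  have "AE t in lborel. FP (log_pullback x) t = FP (log_pullback y) t"
    using eq[unfolded M_eq_glue] U_char(2)[OF x] U_char(2)[OF y] by eventually_elim simp
  then have "L2R_dist (log_pullback x) (log_pullback y) = 0"
    using FP_AE_inject[OF V] V by (simp add: L2R_dist_0_iff)
  with x y show ?thesis by (simp add: L2R_dist_log_pullback L2pos_measurable L2pos_eq_of_dist)
qed

text \<open>Injectivity of \<open>U\<close> up to null sets makes the preimage chosen by
  \<open>U_inv\<close> agree with any other.\<close>

lemma U_inv_eqI:
  assumes x: "x \<in> L2pos" and y: "M_eq (U x) y"
  shows "L2pos_eq x (U_inv y)"
proof -
  have inv: "U_inv y \<in> L2pos \<and> M_eq (U (U_inv y)) y"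
    unfolding U_inv_def by (rule someI[where x=x]) (use x y in simp)
  then have "AE t in lborel. glue (U (U_inv y)) t = glue y t"
    by (simp add: M_eq_glue)
  then have "M_eq (U x) (U (U_inv y))"
    using y unfolding M_eq_glue by eventually_elim simp
  with inv show ?thesis using U_inject x by blast
qed

section \<open>The Gamma integral along complex rays\<close>

lemma Re_pos_notin_nonpos_Ints: "Re s > 0 \<Longrightarrow> s \<notin> \<int>\<^sub>\<le>\<^sub>0"
  by (auto elim!: nonpos_Ints_cases)

text \<open>The power t^(s-1) is written as an exponential in \<open>ln t\<close>, so that powers,
  dilations and decay all combine by the exponential law.\<close>

lemma Gamma_set_integral:
  assumes s: "Re s > 0"
  shows "set_integrable lborel {0<..} (\<lambda>t. exp ((s - 1) * complex_of_real (ln t)) * complex_of_real (exp (- t)))"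
    and "(LINT t:{0<..}|lborel. exp ((s - 1) * complex_of_real (ln t)) * complex_of_real (exp (- t))) = Gamma s"
proof -
  let ?f = "\<lambda>t. exp ((s - 1) * complex_of_real (ln t)) * complex_of_real (exp (- t))"
  have eq: "complex_of_real t powr (s - 1) / complex_of_real (exp t) = ?f t" if "t > 0" for t
    using that by (simp add: powr_def Ln_of_real exp_minus field_simps)
  have "set_integrable lebesgue {0<..} ?f"
    using absolutely_integrable_Gamma_integral'[OF s] eq
    by (subst set_integrable_cong[OF refl refl, of _ _ "\<lambda>t. complex_of_real t powr (s - 1) / complex_of_real (exp t)"]) auto
  \<comment> \<open>Lebesgue measure is the completion of \<open>lborel\<close>, and integrability
    of a Borel function is the same for both.\<close>
  then show *: "set_integrable lborel {0<..} ?f"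
    unfolding set_integrable_def by (subst (asm) integrable_completion) auto
  have "(?f has_integral Gamma s) {0<..}"
    using Gamma_integral_complex'[OF s] by (rule has_integral_cong[THEN iffD1, rotated]) (use eq in auto)
  then show "(LINT t:{0<..}|lborel. ?f t) = Gamma s"
    using set_borel_integral_eq_integral(2)[OF *] by (simp add: integral_unique)
qed

lemma Gamma_set_integral_real:
  assumes s: "\<sigma> > (0::real)"
  shows "set_integrable lborel {0<..} (\<lambda>t. exp ((\<sigma> - 1) * ln t) * exp (- t))"
    and "(LINT t:{0<..}|lborel. exp ((\<sigma> - 1) * ln t) * exp (- t)) = Gamma \<sigma>"
proof -
  have eq: "exp ((complex_of_real \<sigma> - 1) * complex_of_real (ln t)) * complex_of_real (exp (- t))
      = complex_of_real (exp ((\<sigma> - 1) * ln t) * exp (- t))" for t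
    by (simp flip: exp_of_real)
  note G = Gamma_set_integral[of "complex_of_real \<sigma>", unfolded eq]
  show "set_integrable lborel {0<..} (\<lambda>t. exp ((\<sigma> - 1) * ln t) * exp (- t))"
    using G(1) s unfolding set_integrable_def scaleR_conv_of_real
    by (simp add: complex_of_real_integrable_eq flip: of_real_mult)
  show "(LINT t:{0<..}|lborel. exp ((\<sigma> - 1) * ln t) * exp (- t)) = Gamma \<sigma>"
    using G(2) s unfolding set_lebesgue_integral_def scaleR_conv_of_real
    by (simp add: Gamma_complex_of_real flip: of_real_mult)
qed

lemma exp_decay_integrable:
  assumes "\<sigma> > (0::real)" "c > 0"
  shows "set_integrable lborel {0<..} (\<lambda>t. exp ((\<sigma> - 1) * ln t) * exp (- c * t))"
proof -
  let ?f = "\<lambda>t. indicator {0<..} t * (exp ((\<sigma> - 1) * ln t) * exp (- t))"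
  have "integrable lborel ?f"
    using Gamma_set_integral_real(1)[OF assms(1)] by (simp add: set_integrable_def)
  then have "integrable lborel (\<lambda>t. ?f (0 + c * t))"
    using assms by (intro lborel_integrable_real_affine) auto
  \<comment> \<open>The prefactor c^(1 - sigma) cancels the power of c that the dilation
    produces.\<close>
  then have "integrable lborel (\<lambda>t. exp (- (\<sigma> - 1) * ln c) * ?f (0 + c * t))" by simp
  moreover have "exp (- (\<sigma> - 1) * ln c) * ?f (0 + c * t) = indicator {0<..} t *\<^sub>R (exp ((\<sigma> - 1) * ln t) * exp (- c * t))" for t
  proof (cases "t > 0")
    case True
    have "exp (- (\<sigma> - 1) * ln c) * exp ((\<sigma> - 1) * ln (c * t)) = exp ((\<sigma> - 1) * ln t)"
      using True assms by (simp add: ln_mult algebra_simps flip: exp_add)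
    with True assms show ?thesis by (simp add: mult.assoc[symmetric])
  next
    case False
    then show ?thesis using assms by (simp add: zero_less_mult_iff)
  qed
  ultimately show ?thesis by (simp only: set_integrable_def)
qed

lemma pochhammer_series:
  fixes z s :: complex
  assumes "norm z < 1"
  shows "(\<lambda>n. pochhammer s n / fact n * z ^ n) sums (1 - z) powr (- s)"
proof -
  have "(- s gchoose n) * (- z) ^ n = pochhammer s n / fact n * z ^ n" for n
    by (simp add: gbinomial_pochhammer power_minus[of z])
  then show ?thesis using gen_binomial_complex[of "- z" "- s"] assms by simp
qed

text \<open>Near \<open>w = 1\<close>, expanding \<open>e\<^bsup>(1-w)t\<^esup>\<close> turns the integral into the binomial series of \<open>w\<^bsup>-s\<^esup>\<close>.\<close>
lemma Gamma_integral_near_one: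
  assumes s: "Re s > 0" and w: "norm (1 - w) < 1"
  shows "(LINT t:{0<..}|lborel. exp ((s - 1) * complex_of_real (ln t)) * exp (- w * complex_of_real t))
       = Gamma s * w powr (- s)"
proof -
  define z where "z = 1 - w"
  have z: "norm z < 1" using w by (simp add: z_def)
  define \<sigma> where "\<sigma> = Re s"
  have \<sigma>: "\<sigma> > 0" using s by (simp add: \<sigma>_def)
  \<comment> \<open>The terms of e^(zt) times t^(s-1) e^(-t), with z = 1 - w; the n-th integrates to
    z^n Gamma(s + n) / n!.\<close>
  define f where "f n t = indicator {0<..} t *\<^sub>R ((z * complex_of_real t) ^ n / fact n *
      (exp ((s - 1) * complex_of_real (ln t)) * complex_of_real (exp (- t))))" for n t
  have pw: "complex_of_real t ^ n = exp (of_nat n * complex_of_real (ln t))" if "t > 0" for t n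
    using that by (simp add: exp_of_nat_mult exp_of_real)
  have f_eq: "f n t = (z ^ n / fact n) * (indicator {0<..} t *\<^sub>R
      (exp ((s + of_nat n - 1) * complex_of_real (ln t)) * complex_of_real (exp (- t))))" for n t
    by (cases "t > 0") (simp_all add: f_def power_mult_distrib pw algebra_simps flip: exp_add)
  have cm: "cmod (exp ((s + of_nat n - 1) * complex_of_real (ln t)) * complex_of_real (exp (- t)))
      = exp ((\<sigma> + real n - 1) * ln t) * exp (- t)" for t n
    by (simp add: norm_mult \<sigma>_def)
  have f_norm: "norm (f n t) = (norm z ^ n / fact n) * (indicator {0<..} t *\<^sub>R
      (exp ((\<sigma> + real n - 1) * ln t) * exp (- t)))" for n t
    unfolding f_eq norm_mult norm_scaleR cm by (simp add: norm_mult norm_divide norm_power \<sigma>_def)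
  have G: "set_integrable lborel {0<..} (\<lambda>t. exp ((s + of_nat n - 1) * complex_of_real (ln t)) * complex_of_real (exp (- t)))"
    "(LINT t:{0<..}|lborel. exp ((s + of_nat n - 1) * complex_of_real (ln t)) * complex_of_real (exp (- t))) = Gamma (s + of_nat n)" for n
    using Gamma_set_integral[of "s + of_nat n"] s by auto
  have Gr: "(LINT t:{0<..}|lborel. exp ((\<sigma> + real n - 1) * ln t) * exp (- t)) = Gamma (\<sigma> + real n)" for n
    using Gamma_set_integral_real(2)[of "\<sigma> + real n"] \<sigma> by simp
  have int: "integrable lborel (f n)" for n
    unfolding f_eq[abs_def] using G(1)[of n]
    by (intro Bochner_Integration.integrable_mult_right) (simp only: set_integrable_def)
  have exps: "(\<lambda>n. x ^ n / fact n) sums exp x" for x :: complex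
    using exp_converges[of x] by (simp add: scaleR_conv_of_real field_simps)
  have sums: "(\<lambda>n. f n t) sums (indicator {0<..} t *\<^sub>R
      (exp ((s - 1) * complex_of_real (ln t)) * exp (- w * complex_of_real t)))" for t
  proof -
    have "(\<lambda>n. f n t) sums (indicator {0<..} t *\<^sub>R (exp (z * complex_of_real t) *
      (exp ((s - 1) * complex_of_real (ln t)) * complex_of_real (exp (- t)))))"
      unfolding f_def by (intro sums_scaleR_right sums_mult2 exps)
    also have "exp (z * complex_of_real t) * (exp ((s - 1) * complex_of_real (ln t)) * complex_of_real (exp (- t)))
       = exp ((s - 1) * complex_of_real (ln t)) * exp (- w * complex_of_real t)"
      by (simp add: z_def algebra_simps flip: exp_add exp_of_real)
    finally show ?thesis .
  qed
  have "(\<lambda>n. integral\<^sup>L lborel (f n)) sums (LINT t|lborel. (\<Sum>n. f n t))"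
  proof (rule sums_integral[OF int])
    show "AE t in lborel. summable (\<lambda>n. norm (f n t))"
    proof (rule AE_I2)
      fix t
      have "summable (\<lambda>n. norm ((z * complex_of_real t) ^ n / fact n))"
        using summable_norm_exp[of "z * complex_of_real t"] by (simp add: scaleR_conv_of_real norm_mult norm_divide field_simps)
      then have "summable (\<lambda>n. norm ((z * complex_of_real t) ^ n / fact n) *
         norm (indicator {0<..} t *\<^sub>R (exp ((s - 1) * complex_of_real (ln t)) * complex_of_real (exp (- t)))))"
        by (rule summable_mult2)
      then show "summable (\<lambda>n. norm (f n t))"
        by (simp add: f_def norm_mult norm_divide norm_power mult_ac)
    qed
    \<comment> \<open>Taking norms replaces z by |z| and s by its real part, so the exchange of sum
      and integral again rests on a binomial series, at |z| < 1.\<close>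
    have "(LINT t|lborel. norm (f n t)) = norm z ^ n / fact n * Gamma (\<sigma> + real n)" for n
      unfolding f_norm integral_mult_right_zero using Gr[of n] by (simp add: set_lebesgue_integral_def)
    also have "\<dots> n = Gamma \<sigma> * Re (pochhammer (complex_of_real \<sigma>) n / fact n * complex_of_real (norm z) ^ n)" for n
    proof -
      have "Gamma (\<sigma> + real n) = Gamma \<sigma> * pochhammer \<sigma> n"
      proof -
        have "\<sigma> \<notin> \<int>\<^sub>\<le>\<^sub>0" using \<sigma> nonpos_Ints_nonpos[of \<sigma>] by auto
        then show ?thesis using pochhammer_Gamma[of \<sigma> n] by (simp add: Gamma_eq_zero_iff)
      qed
      moreover have "pochhammer (complex_of_real \<sigma>) n / fact n * complex_of_real (norm z) ^ n
          = complex_of_real (pochhammer \<sigma> n / fact n * norm z ^ n)"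
        by (simp add: pochhammer_of_real)
      ultimately show ?thesis by (simp only: Re_complex_of_real) simp
    qed
    finally show "summable (\<lambda>n. LINT t|lborel. norm (f n t))"
      using pochhammer_series[of "complex_of_real (norm z)" "complex_of_real \<sigma>"] z
      by (auto simp: sums_iff intro!: summable_mult summable_Re)
  qed
  also have "(\<lambda>n. integral\<^sup>L lborel (f n)) = (\<lambda>n. Gamma s * (pochhammer s n / fact n * z ^ n))"
  proof
    fix n
    have "integral\<^sup>L lborel (f n) = z ^ n / fact n * Gamma (s + of_nat n)"
      unfolding f_eq[abs_def] integral_mult_right_zero using G(2)[of n] by (simp add: set_lebesgue_integral_def)
    moreover have "Gamma (s + of_nat n) = Gamma s * pochhammer s n"
      using Re_pos_notin_nonpos_Ints[OF s] pochhammer_Gamma[of s n] by (simp add: Gamma_eq_zero_iff)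
    ultimately show "integral\<^sup>L lborel (f n) = Gamma s * (pochhammer s n / fact n * z ^ n)" by simp
  qed
  also have "(LINT t|lborel. (\<Sum>n. f n t)) = (LINT t:{0<..}|lborel. exp ((s - 1) * complex_of_real (ln t)) * exp (- w * complex_of_real t))"
    unfolding set_lebesgue_integral_def using sums by (simp add: sums_iff)
  finally show ?thesis
    using sums_mult[OF pochhammer_series[OF z], of "Gamma s" s] by (simp add: z_def sums_iff)
qed

text \<open>A real dilation keeps the path of integration on the half-line. It serves twice: to
  bring w into the unit disc around 1, and to extract xi^(-s) from a kernel in t xi.\<close>

lemma Gamma_integral_scale:
  assumes c: "c > 0"
  shows "(LINT t:{0<..}|lborel. exp ((s - 1) * complex_of_real (ln t)) * exp (- (complex_of_real c * w) * complex_of_real t))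
       = exp (- s * complex_of_real (ln c)) * (LINT t:{0<..}|lborel. exp ((s - 1) * complex_of_real (ln t)) * exp (- w * complex_of_real t))"
proof -
  let ?f = "\<lambda>t. indicator {0<..} t *\<^sub>R (exp ((s - 1) * complex_of_real (ln t)) * exp (- w * complex_of_real t))"
  have e: "complex_of_real c = exp (complex_of_real (ln c))" using c by (simp add: exp_of_real)
  have "exp (- s * complex_of_real (ln c)) * integral\<^sup>L lborel ?f
      = exp (- s * complex_of_real (ln c)) * (c *\<^sub>R (LINT t|lborel. ?f (0 + c * t)))"
    using lborel_integral_real_affine[of c ?f 0] c by simp
  also have "\<dots> = (LINT t|lborel. (exp (- s * complex_of_real (ln c)) * complex_of_real c) * ?f (0 + c * t))"
    by (simp add: scaleR_conv_of_real)
  also have "\<dots> = (LINT t|lborel. indicator {0<..} t *\<^sub>R (exp ((s - 1) * complex_of_real (ln t)) * exp (- (complex_of_real c * w) * complex_of_real t)))"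
  proof (rule Bochner_Integration.integral_cong[OF refl])
    fix t :: real
    show "(exp (- s * complex_of_real (ln c)) * complex_of_real c) * ?f (0 + c * t)
      = indicator {0<..} t *\<^sub>R (exp ((s - 1) * complex_of_real (ln t)) * exp (- (complex_of_real c * w) * complex_of_real t))"
    proof (cases "t > 0")
      case True
      have "exp (- s * complex_of_real (ln c)) * complex_of_real c * (exp ((s - 1) * complex_of_real (ln (c * t))))
         = exp ((s - 1) * complex_of_real (ln t))"
        unfolding e using True c by (simp add: ln_mult algebra_simps flip: exp_add)
      with True c show ?thesis by (simp add: mult.assoc[symmetric]) (simp add: mult_ac)
    next
      case False
      then show ?thesis using c by (simp add: zero_less_mult_iff)
    qed
  qed
  finally show ?thesis by (simp add: set_lebesgue_integral_def)
qed

text \<open>Instead of rotating a contour, w is divided by a positive number that brings it into the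
  disc where the binomial series converges; both sides scale alike.\<close>

lemma Gamma_integral_ray:
  assumes s: "Re s > 0" and w: "Re w > 0"
  shows "(LINT t:{0<..}|lborel. exp ((s - 1) * complex_of_real (ln t)) * exp (- w * complex_of_real t))
       = Gamma s * w powr (- s)"
proof -
  \<comment> \<open>The inequality |c - w| < c holds once c > |w|^2 / (2 Re w). This c is twice that
    threshold, and |c - w|^2 = c^2 - |w|^2.\<close>
  define c where "c = ((Re w)\<^sup>2 + (Im w)\<^sup>2) / Re w"
  have m: "(Re w)\<^sup>2 + (Im w)\<^sup>2 > 0" using w by (simp add: add_pos_nonneg)
  then have c: "c > 0" using w by (simp add: c_def)
  have "(norm (complex_of_real c - w))\<^sup>2 = c\<^sup>2 - 2 * c * Re w + ((Re w)\<^sup>2 + (Im w)\<^sup>2)"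
    unfolding cmod_power2 by (simp add: power2_eq_square algebra_simps)
  also have "c * Re w = (Re w)\<^sup>2 + (Im w)\<^sup>2" using w by (simp add: c_def)
  then have "c\<^sup>2 - 2 * c * Re w + ((Re w)\<^sup>2 + (Im w)\<^sup>2) < c\<^sup>2"
  proof -
    have "x - 2 * y + y < x" if "y > 0" for x y :: real using that by linarith
    from this[OF m] \<open>c * Re w = _\<close> show ?thesis by (simp only: mult.assoc)
  qed
  finally have "norm (complex_of_real c - w) < c" using c by (simp add: power2_less_imp_less)
  then have "norm (1 - w / complex_of_real c) < 1"
  proof -
    have "1 - w / complex_of_real c = (complex_of_real c - w) / complex_of_real c" using c by (simp add: field_simps)
    then show ?thesis using \<open>norm (complex_of_real c - w) < c\<close> c by (simp add: norm_divide)
  qed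
  note near = Gamma_integral_near_one[OF s this]
  have cw: "complex_of_real c * (w / complex_of_real c) = w" using c by simp
  have "w powr (- s) = complex_of_real c powr (- s) * (w / complex_of_real c) powr (- s)"
    using powr_times_real_left[of "complex_of_real c" "w / complex_of_real c" "- s"] c by (simp add: cw)
  moreover have "complex_of_real c powr (- s) = exp (- s * complex_of_real (ln c))"
    using c by (simp add: powr_def Ln_of_real)
  ultimately show ?thesis
    using Gamma_integral_scale[OF c, of s "w / complex_of_real c"] unfolding cw near by simp
qed

section \<open>The multiplier\<close>

text \<open>On the line Re z = 1/2 the conjugate of z is 1 - z, so the reflection formula computes
  |Gamma z|^2 as pi / cosh(pi mu).\<close>

lemma cmod_Gamma_half:
  "cmod (Gamma (1/2 + \<i> * complex_of_real \<mu>)) \<le> sqrt (2 * pi) * exp (- pi * \<bar>\<mu>\<bar> / 2)"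
proof -
  let ?z = "1/2 + \<i> * complex_of_real \<mu>"
  have "complex_of_real ((cmod (Gamma ?z))\<^sup>2) = Gamma ?z * Gamma (1 - ?z)"
    unfolding complex_norm_square cnj_Gamma by simp
  also have "\<dots> = of_real pi / sin (of_real pi * ?z)" by (rule Gamma_reflection_complex)
  also have "sin (of_real pi * ?z) = cos (\<i> * complex_of_real (pi * \<mu>))"
    using sin_cos_eq[of "of_real pi * ?z"] cos_minus[of "\<i> * complex_of_real (pi * \<mu>)"] by (simp add: algebra_simps)
  also have "\<dots> = complex_of_real (cosh (pi * \<mu>))"
    by (simp add: cos_exp_eq cosh_def scaleR_conv_of_real field_simps flip: exp_of_real)
  finally have "complex_of_real ((cmod (Gamma ?z))\<^sup>2) = complex_of_real (pi / cosh (pi * \<mu>))" by simp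
  then have "(cmod (Gamma ?z))\<^sup>2 = pi / cosh (pi * \<mu>)" by (simp only: of_real_eq_iff)
  also have "\<dots> \<le> pi / (exp (pi * \<bar>\<mu>\<bar>) / 2)"
  proof (rule divide_left_mono)
    show "exp (pi * \<bar>\<mu>\<bar>) / 2 \<le> cosh (pi * \<mu>)"
      by (cases "\<mu> \<ge> 0") (simp_all add: cosh_def)
  qed auto
  also have "\<dots> = (sqrt (2 * pi) * exp (- pi * \<bar>\<mu>\<bar> / 2))\<^sup>2"
    by (simp add: power_mult_distrib exp_minus field_simps flip: exp_double)
  finally show ?thesis by (rule power2_le_imp_le) simp
qed

definition F_approx :: "real \<Rightarrow> real \<Rightarrow> complex" where
  "F_approx \<delta> \<mu> = complex_of_real (1 / sqrt (2 * pi)) * Gamma (1/2 + \<i> * complex_of_real \<mu>) *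
     (complex_of_real \<delta> - \<i>) powr (- (1/2 + \<i> * complex_of_real \<mu>))"

text \<open>The principal logarithm of -i is -i pi / 2; multiplied by -(1/2 + i mu) it gives i pi /
  4 - pi mu / 2.\<close>

lemma F_pm_eq_F_approx_0: "F_pm \<mu> = F_approx 0 \<mu>"
proof -
  have "(- \<i>) powr (- (1/2 + \<i> * complex_of_real \<mu>)) = exp (\<i> * complex_of_real (pi / 4)) * complex_of_real (exp (- pi * \<mu> / 2))"
    by (simp add: powr_def algebra_simps flip: exp_add exp_of_real)
  then show ?thesis by (simp add: F_pm_def F_approx_def)
qed

text \<open>For w = delta - i one has |w| >= 1 and |Arg w| <= pi / 2, so the power grows at most
  like e^(pi |mu| / 2), which the decay of Gamma cancels. The bound is uniform in delta, as
  dominated convergence requires.\<close>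

lemma cmod_F_approx:
  assumes "\<delta> \<ge> 0" shows "cmod (F_approx \<delta> \<mu>) \<le> 1"
proof -
  let ?w = "complex_of_real \<delta> - \<i>"
  have w0: "?w \<noteq> 0" by (auto simp: complex_eq_iff)
  have "1 \<le> norm ?w" using abs_Im_le_cmod[of ?w] by simp
  then have ReLn: "0 \<le> Re (Ln ?w)" using w0 by simp
  have ImLn: "\<bar>Im (Ln ?w)\<bar> \<le> pi / 2"
    using Re_Ln_pos_le[OF w0] assms by simp
  have "cmod (?w powr (- (1/2 + \<i> * complex_of_real \<mu>))) = exp (- Re (Ln ?w) / 2 + \<mu> * Im (Ln ?w))"
    using w0 by (simp add: powr_def)
  also have "\<dots> \<le> exp (\<bar>\<mu>\<bar> * (pi / 2))"
  proof -
    have "\<mu> * Im (Ln ?w) \<le> \<bar>\<mu>\<bar> * \<bar>Im (Ln ?w)\<bar>" by (simp flip: abs_mult)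
    also have "\<dots> \<le> \<bar>\<mu>\<bar> * (pi / 2)" using ImLn by (intro mult_left_mono) auto
    finally show ?thesis using ReLn by simp
  qed
  finally have "cmod (F_approx \<delta> \<mu>) \<le> (1 / sqrt (2 * pi)) * (sqrt (2 * pi) * exp (- pi * \<bar>\<mu>\<bar> / 2)) * exp (\<bar>\<mu>\<bar> * (pi / 2))"
    unfolding F_approx_def norm_mult by (intro mult_mono cmod_Gamma_half) (auto simp: norm_divide)
  also have "\<dots> = 1" by (simp add: mult.commute flip: exp_add)
  finally show ?thesis .
qed

lemma F_approx_measurable [measurable]: "F_approx \<delta> \<in> borel_measurable borel"
proof -
  have "continuous_on UNIV (\<lambda>\<mu>. Gamma (1/2 + \<i> * complex_of_real \<mu>))"
    by (rule continuous_on_compose2[of "{z. Re z > 0}" Gamma])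
       (auto intro!: continuous_intros continuous_on_Gamma dest: Re_pos_notin_nonpos_Ints)
  then have [measurable]: "(\<lambda>\<mu>. Gamma (1/2 + \<i> * complex_of_real \<mu>)) \<in> borel_measurable borel"
    by (rule borel_measurable_continuous_onI)
  have "complex_of_real \<delta> - \<i> \<noteq> 0" by (auto simp: complex_eq_iff)
  then show ?thesis unfolding F_approx_def[abs_def] powr_def by simp
qed

lemma F_approx_tendsto: "(\<lambda>n. F_approx (1 / real (Suc n)) \<mu>) \<longlonglongrightarrow> F_pm \<mu>"
proof -
  have "(\<lambda>n. complex_of_real (1 / real (Suc n)) - \<i>) \<longlonglongrightarrow> complex_of_real 0 - \<i>"
    by (intro tendsto_intros tendsto_of_real LIMSEQ_Suc[OF lim_1_over_n])
  then have "(\<lambda>n. (complex_of_real (1 / real (Suc n)) - \<i>) powr (- (1/2 + \<i> * complex_of_real \<mu>)))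
       \<longlonglongrightarrow> (complex_of_real 0 - \<i>) powr (- (1/2 + \<i> * complex_of_real \<mu>))"
    by (intro tendsto_powr_complex tendsto_const) (auto simp: complex_nonpos_Reals_iff)
  then show ?thesis
    unfolding F_pm_eq_F_approx_0 F_approx_def by (intro tendsto_mult tendsto_const)
qed

lemma F_mp_eq: "F_mp \<mu> = F_pm (- \<mu>)"
  by (simp add: F_mp_def F_pm_def)

lemma F_pm_measurable [measurable]: "F_pm \<in> borel_measurable borel"
  unfolding F_pm_eq_F_approx_0[abs_def] by measurable

lemma cmod_F_pm: "cmod (F_pm \<mu>) \<le> 1"
  unfolding F_pm_eq_F_approx_0 by (rule cmod_F_approx) simp

lemma L2R_F_pm_mult:
  assumes "f \<in> L2R" shows "(\<lambda>\<mu>. F_pm \<mu> * f \<mu>) \<in> L2R"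
  by (rule L2R_cmod_le[OF assms])
     (use assms cmod_F_pm mult_right_mono[OF cmod_F_pm norm_ge_zero] in \<open>auto simp: norm_mult\<close>)

text \<open>On the line the off-diagonal matrix becomes a reflection followed by one multiplier. At
  t = 0 \<open>glue\<close> takes the second component on both sides, which the matrix has
  exchanged.\<close>

lemma glue_MF:
  "t \<noteq> 0 \<Longrightarrow> glue (MF y) t = F_pm t * glue y (- t)"
  by (auto simp: glue_def MF_def F_mp_eq)

section \<open>The Fourier operator on the half-line\<close>

lemma L2pos_dist_le_L2R_dist:
  assumes "f \<in> L2R" "g \<in> L2R" shows "L2pos_dist f g \<le> L2R_dist f g"
  unfolding L2pos_dist_def L2R_dist_def set_lebesgue_integral_def
proof (intro real_sqrt_le_mono integral_mono)
  show "integrable lborel (\<lambda>t. indicator {0<..} t *\<^sub>R (cmod (f t - g t))\<^sup>2)"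
    by (intro integrable_mult_indicator L2R_integrable L2R_diff assms) simp
qed (use L2R_integrable[OF L2R_diff[OF assms]] in \<open>auto simp: indicator_def\<close>)

lemma L2pos_dist_indicator:
  "L2pos_dist (\<lambda>t. indicator {0<..} t * f t) (\<lambda>t. indicator {0<..} t * g t) = L2pos_dist f g"
  unfolding L2pos_dist_def by (intro arg_cong[where f=sqrt] set_lebesgue_integral_cong) auto

lemma FRp_L2pos:
  assumes x: "x \<in> L2pos" shows "FRp x \<in> L2pos"
proof -
  note F = FP_L2R[OF L2R_half_line[OF x]]
  have "FRp x \<in> L2R"
    unfolding FRp_def by (rule L2R_cmod_le[OF F]) (use L2R_measurable[OF F] in \<open>auto simp: indicator_def\<close>)
  then show ?thesis by (rule L2pos_of_L2R)
qed

lemma FRp_dist_le: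
  assumes x: "x \<in> L2pos" and y: "y \<in> L2pos"
  shows "L2pos_dist (FRp x) (FRp y) \<le> L2pos_dist x y"
proof -
  note h = L2R_half_line[OF x] L2R_half_line[OF y]
  have "L2pos_dist (FRp x) (FRp y)
      \<le> L2R_dist (FP (\<lambda>t. indicator {0<..} t * x t)) (FP (\<lambda>t. indicator {0<..} t * y t))"
    unfolding FRp_def L2pos_dist_indicator by (intro L2pos_dist_le_L2R_dist FP_L2R h)
  also have "\<dots> = L2pos_dist x y" by (simp add: FP_dist[OF h] L2R_dist_half_line)
  finally show ?thesis .
qed

text \<open>The integral runs over the whole line, but it is evaluated for t > 0 and for
  \<open>x\<close> vanishing left of some a > 0, where the factor e^(-delta t xi) is
  damping.\<close>

definition regularized_FRp :: "real \<Rightarrow> (real \<Rightarrow> complex) \<Rightarrow> real \<Rightarrow> complex" where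
  "regularized_FRp \<delta> x t = complex_of_real (1 / sqrt (2 * pi)) *
     (LINT \<xi>|lborel. x \<xi> * exp (- (complex_of_real \<delta> - \<i>) * complex_of_real (t * \<xi>)))"

text \<open>The gap between 0 and the support turns the damping into decay e^(-delta a t), uniform
  in xi, and bounds xi^(-1/2) on the support. \<open>FP_FRp\<close> removes the restriction by
  density.\<close>

context
  fixes x :: "real \<Rightarrow> complex" and a b :: real
  assumes x: "x \<in> L2R" and xI: "integrable lborel x" and a: "0 < a"
    and supp: "\<And>\<xi>. \<xi> < a \<Longrightarrow> x \<xi> = 0"
begin

lemma supported_measurable [measurable]: "x \<in> borel_measurable borel"
  using x by (rule L2R_measurable)

lemma regularized_FRp_measurable [measurable]: "regularized_FRp \<delta> x \<in> borel_measurable borel"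
  unfolding regularized_FRp_def[abs_def] by measurable

lemma regularized_kernel:
  assumes "\<delta> \<ge> 0" "t \<ge> 0"
  shows "cmod (x \<xi> * exp (- (complex_of_real \<delta> - \<i>) * complex_of_real (t * \<xi>))) \<le> exp (- (\<delta> * a) * t) * cmod (x \<xi>)"
    and "integrable lborel (\<lambda>\<xi>. x \<xi> * exp (- (complex_of_real \<delta> - \<i>) * complex_of_real (t * \<xi>)))"
proof -
  show *: "cmod (x \<xi> * exp (- (complex_of_real \<delta> - \<i>) * complex_of_real (t * \<xi>))) \<le> exp (- (\<delta> * a) * t) * cmod (x \<xi>)" for \<xi>
  proof (cases "\<xi> < a")
    case False
    then have "\<delta> * t * a \<le> \<delta> * t * \<xi>" using assms by (intro mult_left_mono) auto
    then have "exp (- (\<delta> * (t * \<xi>))) \<le> exp (- (\<delta> * a) * t)" by (simp add: mult_ac)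
    then show ?thesis by (simp add: norm_mult mult.commute[of "cmod _"] mult_right_mono)
  qed (simp add: supp)
  show "integrable lborel (\<lambda>\<xi>. x \<xi> * exp (- (complex_of_real \<delta> - \<i>) * complex_of_real (t * \<xi>)))"
    by (rule Bochner_Integration.integrable_bound[where f="\<lambda>\<xi>. exp (- (\<delta> * a) * t) * cmod (x \<xi>)"])
       (use xI * in \<open>auto intro!: AE_I2 order_trans[OF *]\<close>)
qed

lemma cmod_regularized_FRp_le:
  assumes "\<delta> \<ge> 0" "t \<ge> 0"
  shows "cmod (regularized_FRp \<delta> x t) \<le> exp (- (\<delta> * a) * t) * (LINT \<xi>|lborel. cmod (x \<xi>))"
proof -
  have "cmod (LINT \<xi>|lborel. x \<xi> * exp (- (complex_of_real \<delta> - \<i>) * complex_of_real (t * \<xi>)))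
      \<le> (LINT \<xi>|lborel. exp (- (\<delta> * a) * t) * cmod (x \<xi>))"
    by (rule Bochner_Integration.integral_norm_bound_integral) (use regularized_kernel[OF assms] xI in auto)
  then have 1: "cmod (LINT \<xi>|lborel. x \<xi> * exp (- (complex_of_real \<delta> - \<i>) * complex_of_real (t * \<xi>)))
      \<le> exp (- (\<delta> * a) * t) * (LINT \<xi>|lborel. cmod (x \<xi>))" by simp
  have 2: "1 / sqrt (2 * pi) \<le> 1" using pi_gt3 by (simp add: real_le_rsqrt)
  have "cmod (regularized_FRp \<delta> x t) \<le> 1 * (exp (- (\<delta> * a) * t) * (LINT \<xi>|lborel. cmod (x \<xi>)))"
    unfolding regularized_FRp_def norm_mult using 2 by (intro mult_mono 1) (auto simp: norm_divide)
  then show ?thesis by simp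
qed

lemma regularized_FRp_Udom:
  assumes d: "\<delta> > 0" shows "regularized_FRp \<delta> x \<in> Udom"
proof -
  let ?C = "LINT \<xi>|lborel. cmod (x \<xi>)"
  note le = cmod_regularized_FRp_le[OF less_imp_le[OF d]]
  have da: "\<delta> * a > 0" using d a by simp
  have "set_integrable lborel {0<..} (\<lambda>t. (cmod (regularized_FRp \<delta> x t))\<^sup>2)"
  proof (rule set_integrable_bound)
    \<comment> \<open>The exponent \<open>1 - 1\<close> presents pure exponential decay as the case
      sigma = 1 of \<open>exp_decay_integrable\<close>; the weight t^(-1/2) below is the case sigma
      = 1/2.\<close>
    show "set_integrable lborel {0<..} (\<lambda>t. ?C\<^sup>2 * (exp ((1 - 1) * ln t) * exp (- (2 * (\<delta> * a)) * t)))"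
      using da by (intro set_integrable_mult_right exp_decay_integrable) auto
    show "AE t in lborel. t \<in> {0<..} \<longrightarrow> norm ((cmod (regularized_FRp \<delta> x t))\<^sup>2)
        \<le> norm (?C\<^sup>2 * (exp ((1 - 1) * ln t) * exp (- (2 * (\<delta> * a)) * t)))"
    proof (rule AE_I2, rule impI)
      fix t :: real assume "t \<in> {0<..}"
      then have "(cmod (regularized_FRp \<delta> x t))\<^sup>2 \<le> (exp (- (\<delta> * a) * t) * ?C)\<^sup>2"
        by (intro power_mono le) auto
      also have "\<dots> = ?C\<^sup>2 * exp (- (2 * (\<delta> * a)) * t)"
        by (simp add: power_mult_distrib mult_ac flip: exp_double)
      finally show "norm ((cmod (regularized_FRp \<delta> x t))\<^sup>2)
        \<le> norm (?C\<^sup>2 * (exp ((1 - 1) * ln t) * exp (- (2 * (\<delta> * a)) * t)))" by simp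
    qed
  qed (simp add: set_borel_measurable_def)
  then have "regularized_FRp \<delta> x \<in> L2pos" by (simp add: L2pos_def)
  moreover have "set_integrable lborel {0<..} (\<lambda>t. cmod (regularized_FRp \<delta> x t) * t powr (-1/2))"
  proof (rule set_integrable_bound)
    show "set_integrable lborel {0<..} (\<lambda>t. ?C * (exp ((1/2 - 1) * ln t) * exp (- (\<delta> * a) * t)))"
      using da by (intro set_integrable_mult_right exp_decay_integrable) auto
    show "AE t in lborel. t \<in> {0<..} \<longrightarrow> norm (cmod (regularized_FRp \<delta> x t) * t powr (-1/2))
        \<le> norm (?C * (exp ((1/2 - 1) * ln t) * exp (- (\<delta> * a) * t)))"
    proof (rule AE_I2, rule impI)
      fix t :: real assume "t \<in> {0<..}"
      then have t: "t > 0" by simp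
      then have "cmod (regularized_FRp \<delta> x t) * t powr (-1/2) \<le> exp (- (\<delta> * a) * t) * ?C * exp ((1/2 - 1) * ln t)"
        by (intro mult_mono le) (auto simp: powr_def)
      moreover have "0 \<le> ?C" by simp
      ultimately show "norm (cmod (regularized_FRp \<delta> x t) * t powr (-1/2))
        \<le> norm (?C * (exp ((1/2 - 1) * ln t) * exp (- (\<delta> * a) * t)))"
        by (simp add: abs_mult mult_ac)
    qed
  qed (simp add: set_borel_measurable_def)
  ultimately show ?thesis by (simp add: Udom_def)
qed

text \<open>Fubini and \<open>\<integral> t\<^bsup>s-1\<^esup> e\<^bsup>-wt\<^esup> dt = \<Gamma>(s) w\<^bsup>-s\<^esup>\<close> with \<open>w = (\<delta> - \<i>)\<xi>\<close>, \<open>s = 1/2 + \<i>\<mu>\<close>.\<close>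
lemma fourier_int_regularized_FRp:
  assumes d: "\<delta> > 0"
  shows "fourier_int (log_pullback (regularized_FRp \<delta> x)) \<mu> = F_approx \<delta> \<mu> * fourier_int (log_pullback x) (- \<mu>)"
proof -
  define s where "s = 1/2 + \<i> * complex_of_real \<mu>"
  have s: "Re s > 0" by (simp add: s_def)
  define w where "w = complex_of_real \<delta> - \<i>"
  have w: "Re w > 0" using d by (simp add: w_def)
  define C where "C = complex_of_real (1 / sqrt (2 * pi))"
  \<comment> \<open>The factor e^(-delta a t) is taken out of the kernel to make \<open>g\<close>
    integrable at infinity. The remaining kernel \<open>k\<close> is bounded by 1 for t > 0 and xi
    >= a.\<close>
  define g where "g t = indicator {0<..} t *\<^sub>R (exp ((s - 1) * complex_of_real (ln t)) * complex_of_real (exp (- (\<delta> * a) * t)))" for t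
  define k where "k t \<xi> = exp (- w * complex_of_real (t * \<xi>)) * complex_of_real (exp (\<delta> * a * t))" for t \<xi>
  have [measurable]: "g \<in> borel_measurable borel" unfolding g_def by measurable
  have pw: "complex_of_real (t powr (-1/2)) * exp (\<i> * complex_of_real (1 * \<mu> * ln t)) = exp ((s - 1) * complex_of_real (ln t))"
    if "t > 0" for t
    using that by (simp add: powr_def s_def algebra_simps flip: exp_add exp_of_real)
  have pw': "exp (- s * complex_of_real (ln t)) = complex_of_real (t powr (-1/2)) * exp (\<i> * complex_of_real (- 1 * \<mu> * ln t))"
    if "t > 0" for t
    using that
    by (simp add: powr_def s_def algebra_simps flip: exp_add exp_of_real, intro arg_cong[where f=exp]) simp
  have gk: "g t * k t \<xi> = indicator {0<..} t *\<^sub>R (exp ((s - 1) * complex_of_real (ln t)) * exp (- (complex_of_real \<xi> * w) * complex_of_real t))" for t \<xi>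
  proof -
    have "complex_of_real (exp (- (\<delta> * a) * t)) * complex_of_real (exp (\<delta> * a * t)) = 1"
      by (simp flip: of_real_mult exp_add)
    then show ?thesis
      by (simp add: g_def k_def scaleR_conv_of_real mult_ac)
  qed
  have gI: "integrable lborel g"
  proof (rule Bochner_Integration.integrable_bound)
    show "integrable lborel (\<lambda>t. indicator {0<..} t *\<^sub>R (exp ((1/2 - 1) * ln t) * exp (- (\<delta> * a) * t)))"
      using exp_decay_integrable[of "1/2" "\<delta> * a"] d a by (simp add: set_integrable_def)
  qed (auto simp: g_def s_def norm_mult)
  have "U_comp 1 (regularized_FRp \<delta> x) \<mu> = C * (LINT t:{0<..}|lborel. regularized_FRp \<delta> x t *
      complex_of_real (t powr (-1/2)) * exp (\<i> * complex_of_real (1 * \<mu> * ln t)))"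
    by (simp add: U_comp_def C_def)
  also have "(LINT t:{0<..}|lborel. regularized_FRp \<delta> x t *
      complex_of_real (t powr (-1/2)) * exp (\<i> * complex_of_real (1 * \<mu> * ln t)))
     = (LINT t|lborel. C * (g t * (LINT \<xi>|lborel. x \<xi> * k t \<xi>)))"
    unfolding set_lebesgue_integral_def
  proof (rule Bochner_Integration.integral_cong[OF refl])
    fix t :: real
    have "complex_of_real (exp (- (\<delta> * a) * t)) * (LINT \<xi>|lborel. x \<xi> * k t \<xi>)
       = (LINT \<xi>|lborel. x \<xi> * exp (- w * complex_of_real (t * \<xi>)))"
    proof -
      have "complex_of_real (exp (- (\<delta> * a) * t)) * (x \<xi> * k t \<xi>) = x \<xi> * exp (- w * complex_of_real (t * \<xi>))" for \<xi>
      proof -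
        have "complex_of_real (exp (- (\<delta> * a) * t)) * complex_of_real (exp (\<delta> * a * t)) = 1"
          by (simp flip: of_real_mult exp_add)
        then show ?thesis by (simp add: k_def mult_ac)
      qed
      then show ?thesis by (simp only: integral_mult_right_zero[symmetric])
    qed
    then have "C * (g t * (LINT \<xi>|lborel. x \<xi> * k t \<xi>))
       = indicator {0<..} t *\<^sub>R (exp ((s - 1) * complex_of_real (ln t)) * regularized_FRp \<delta> x t)"
      by (simp add: g_def regularized_FRp_def C_def w_def mult.assoc)
    then show "indicator {0<..} t *\<^sub>R (regularized_FRp \<delta> x t *
      complex_of_real (t powr (-1/2)) * exp (\<i> * complex_of_real (1 * \<mu> * ln t)))
        = C * (g t * (LINT \<xi>|lborel. x \<xi> * k t \<xi>))"
      using pw[of t] by (cases "t > 0") (simp_all add: mult_ac)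
  qed
  also have "\<dots> = C * (LINT t|lborel. g t * (LINT \<xi>|lborel. x \<xi> * k t \<xi>))"
    by simp
  also have "(LINT t|lborel. g t * (LINT \<xi>|lborel. x \<xi> * k t \<xi>)) = (LINT \<xi>|lborel. x \<xi> * (LINT t|lborel. g t * k t \<xi>))"
  proof (rule integral_swap_bounded_kernel[OF gI xI, where B=1])
    fix t \<xi> assume "g t \<noteq> 0" "x \<xi> \<noteq> 0"
    then have "t > 0" "\<xi> \<ge> a" using supp[of \<xi>]
      by (auto simp: g_def indicator_def not_less[symmetric] split: if_splits)
    then have "\<delta> * t * a \<le> \<delta> * t * \<xi>" using d by (intro mult_left_mono) auto
    then show "cmod (k t \<xi>) \<le> 1"
      by (simp add: k_def w_def norm_mult mult_ac flip: exp_add)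
  qed (simp add: k_def)
  also have "\<dots> = (LINT \<xi>|lborel. (Gamma s * w powr (- s)) * (indicator {0<..} \<xi> *\<^sub>R (x \<xi> * complex_of_real (\<xi> powr (-1/2)) * exp (\<i> * complex_of_real (- 1 * \<mu> * ln \<xi>)))))"
  proof (rule Bochner_Integration.integral_cong[OF refl])
    fix \<xi> :: real
    show "x \<xi> * (LINT t|lborel. g t * k t \<xi>) = (Gamma s * w powr (- s)) * (indicator {0<..} \<xi> *\<^sub>R (x \<xi> * complex_of_real (\<xi> powr (-1/2)) * exp (\<i> * complex_of_real (- 1 * \<mu> * ln \<xi>))))"
    proof (cases "\<xi> < a")
      case False
      with a have \<xi>: "\<xi> > 0" by simp
      \<comment> \<open>The dilation by xi extracts xi^(-s) = xi^(-1/2) xi^(-i mu), the kernel of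
        the minus component of U.\<close>
      have "(LINT t|lborel. g t * k t \<xi>) = exp (- s * complex_of_real (ln \<xi>)) * (Gamma s * w powr (- s))"
        unfolding gk using Gamma_integral_scale[OF \<xi>, of s w] Gamma_integral_ray[OF s w]
        by (simp add: set_lebesgue_integral_def)
      with \<xi> show ?thesis unfolding pw'[OF \<xi>] by (simp add: mult_ac)
    qed (simp add: supp)
  qed
  also have "\<dots> = (Gamma s * w powr (- s)) * (LINT \<xi>:{0<..}|lborel. x \<xi> * complex_of_real (\<xi> powr (-1/2)) * exp (\<i> * complex_of_real (- 1 * \<mu> * ln \<xi>)))"
    unfolding set_lebesgue_integral_def by (rule integral_mult_right_zero)
  finally have "U_comp 1 (regularized_FRp \<delta> x) \<mu> = (C * Gamma s * w powr (- s)) * U_comp (- 1) x \<mu>"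
    by (simp add: U_comp_def C_def mult_ac)
  moreover have "C * Gamma s * w powr (- s) = F_approx \<delta> \<mu>"
    by (simp add: F_approx_def C_def s_def w_def)
  ultimately show ?thesis by (simp add: U_comp_eq_fourier_int)
qed

lemma regularized_FRp_tendsto:
  assumes t: "t > 0"
  shows "(\<lambda>n. regularized_FRp (1 / real (Suc n)) x t) \<longlonglongrightarrow> fourier_int x t"
proof -
  have "(\<lambda>n. LINT \<xi>|lborel. x \<xi> * exp (- (complex_of_real (1 / real (Suc n)) - \<i>) * complex_of_real (t * \<xi>)))
      \<longlonglongrightarrow> (LINT \<xi>|lborel. x \<xi> * expi (t * \<xi>))"
  proof (rule integral_dominated_convergence[where w="\<lambda>\<xi>. cmod (x \<xi>)"])
    show "AE \<xi> in lborel. norm (x \<xi> * exp (- (complex_of_real (1 / real (Suc n)) - \<i>) * complex_of_real (t * \<xi>))) \<le> cmod (x \<xi>)" for n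
    proof (rule AE_I2)
      fix \<xi>
      have "exp (- (1 / real (Suc n) * a) * t) \<le> 1" using a t by simp
      then have "exp (- (1 / real (Suc n) * a) * t) * cmod (x \<xi>) \<le> cmod (x \<xi>)"
        by (intro mult_left_le_one_le) auto
      then show "norm (x \<xi> * exp (- (complex_of_real (1 / real (Suc n)) - \<i>) * complex_of_real (t * \<xi>))) \<le> cmod (x \<xi>)"
        by (rule order_trans[rotated], intro regularized_kernel(1)) (use t in auto)
    qed
    show "AE \<xi> in lborel. (\<lambda>n. x \<xi> * exp (- (complex_of_real (1 / real (Suc n)) - \<i>) * complex_of_real (t * \<xi>))) \<longlonglongrightarrow> x \<xi> * expi (t * \<xi>)"
    proof (rule AE_I2)
      fix \<xi>
      have "(\<lambda>n. x \<xi> * exp (- (complex_of_real (1 / real (Suc n)) - \<i>) * complex_of_real (t * \<xi>)))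
         \<longlonglongrightarrow> x \<xi> * exp (- (complex_of_real 0 - \<i>) * complex_of_real (t * \<xi>))"
        by (intro tendsto_intros tendsto_of_real LIMSEQ_Suc[OF lim_1_over_n])
      then show "(\<lambda>n. x \<xi> * exp (- (complex_of_real (1 / real (Suc n)) - \<i>) * complex_of_real (t * \<xi>))) \<longlonglongrightarrow> x \<xi> * expi (t * \<xi>)"
        by (simp add: expi_def)
    qed
  qed (use xI in auto)
  then show ?thesis
    unfolding regularized_FRp_def fourier_int_eq by (intro tendsto_mult tendsto_const)
qed

lemma log_pullback_supported_integrable: "integrable lborel (log_pullback x)"
proof -
  have "set_integrable lborel {0<..} (\<lambda>\<xi>. cmod (x \<xi>) * \<xi> powr (-1/2))"
  proof (rule set_integrable_bound)
    show "set_integrable lborel {0<..} (\<lambda>\<xi>. a powr (-1/2) * cmod (x \<xi>))"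
      using xI unfolding set_integrable_def by (intro integrable_mult_indicator) auto
    show "AE \<xi> in lborel. \<xi> \<in> {0<..} \<longrightarrow> norm (cmod (x \<xi>) * \<xi> powr (-1/2)) \<le> norm (a powr (-1/2) * cmod (x \<xi>))"
    proof (rule AE_I2, rule impI)
      fix \<xi> :: real
      show "norm (cmod (x \<xi>) * \<xi> powr (-1/2)) \<le> norm (a powr (-1/2) * cmod (x \<xi>))"
      proof (cases "\<xi> < a")
        case False
        then have "\<xi> powr (-1/2) \<le> a powr (-1/2)" using a by (intro powr_mono2') auto
        then show ?thesis by (simp add: mult.commute[of "cmod _"] mult_right_mono)
      qed (simp add: supp)
    qed
  qed (simp add: set_borel_measurable_def)
  then have "x \<in> Udom" using L2pos_of_L2R[OF x] by (simp add: Udom_def)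
  then show ?thesis by (simp add: Udom_iff)
qed

text \<open>The transforms of the damped functions \<open>q n\<close> are explicit and converge in
  L2 to \<open>G\<close>. Surjectivity writes \<open>G\<close> as \<open>FP f\<close>, the isometry
  makes \<open>q n\<close> converge to \<open>f\<close>, and the pointwise limit of
  \<open>q n\<close> identifies \<open>f\<close> with the undamped transform.\<close>

lemma FP_FRp_supported:
  "AE \<mu> in lborel. FP (log_pullback (FRp x)) \<mu> = F_pm \<mu> * FP (log_pullback x) (- \<mu>)"
proof -
  let ?V = "log_pullback x"
  have xp: "x \<in> L2pos" using x by (rule L2pos_of_L2R)
  have V: "?V \<in> L2R" using xp by (rule L2R_log_pullback)
  define q where "q n = log_pullback (regularized_FRp (1 / real (Suc n)) x)" for n
  have q: "q n \<in> L2R" "integrable lborel (q n)" for n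
    using regularized_FRp_Udom[of "1 / real (Suc n)"] by (auto simp: q_def Udom_iff L2R_log_pullback)
  have fq: "fourier_int (q n) = (\<lambda>\<mu>. F_approx (1 / real (Suc n)) \<mu> * fourier_int ?V (- \<mu>))" for n
    unfolding q_def by (rule ext, rule fourier_int_regularized_FRp) simp
  have FV: "(\<lambda>\<mu>. fourier_int ?V (- \<mu>)) \<in> L2R"
    using fourier_int_L2R(1)[OF log_pullback_supported_integrable V] by (rule L2R_reflect)
  define G where "G \<mu> = F_pm \<mu> * fourier_int ?V (- \<mu>)" for \<mu>
  have G: "G \<in> L2R" unfolding G_def by (rule L2R_F_pm_mult[OF FV])
  have conv: "L2R_conv (\<lambda>n. fourier_int (q n)) G"
    unfolding fq G_def
  proof (rule L2R_dominated_convergence[OF FV])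
    show "cmod (F_approx (1 / real (Suc n)) \<mu> * fourier_int ?V (- \<mu>)) \<le> cmod (fourier_int ?V (- \<mu>))" for n \<mu>
      using mult_right_mono[OF cmod_F_approx[of "1 / real (Suc n)" \<mu>] norm_ge_zero[of "fourier_int ?V (- \<mu>)"]]
      by (simp add: norm_mult)
    show "(\<lambda>n. F_approx (1 / real (Suc n)) \<mu> * fourier_int ?V (- \<mu>)) \<longlonglongrightarrow> F_pm \<mu> * fourier_int ?V (- \<mu>)" for \<mu>
      by (intro tendsto_mult F_approx_tendsto tendsto_const)
  qed (use FV in \<open>auto dest: L2R_measurable\<close>)
  obtain f where f: "f \<in> L2R" "AE \<mu> in lborel. FP f \<mu> = G \<mu>"
    using FP_surj[OF G] by auto
  have "L2R_dist (q n) f = L2R_dist (fourier_int (q n)) G" for n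
  proof -
    have "L2R_dist (q n) f = L2R_dist (FP (q n)) (FP f)" using FP_dist[OF q(1) f(1)] by simp
    also have "\<dots> = L2R_dist (fourier_int (q n)) G"
      using FP_AE_fourier_int[OF q(2,1)] f q G by (intro L2R_dist_cong_AE fourier_int_L2R FP_L2R)
    finally show ?thesis .
  qed
  with conv q(1) f(1) have "L2R_conv q f" by (simp add: L2R_conv_def)
  then have "AE s in lborel. f s = log_pullback (fourier_int x) s"
  proof (rule L2R_limit_AE_eq)
    show "AE s in lborel. (\<lambda>n. q n s) \<longlonglongrightarrow> log_pullback (fourier_int x) s"
      unfolding q_def log_pullback_def by (intro AE_I2 tendsto_mult tendsto_const regularized_FRp_tendsto) simp
  qed measurable
  moreover have "AE s in lborel. log_pullback (FRp x) s = log_pullback (fourier_int x) s"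
  proof -
    \<comment> \<open>\<open>x\<close> already vanishes on the nonpositive axis, so the inner cut of
      \<open>FRp\<close> changes nothing; the outer one is invisible to
      \<open>L2pos_dist\<close>.\<close>
    have ix: "(\<lambda>\<xi>. indicator {0<..} \<xi> * x \<xi>) = x"
      using supp a by (auto simp: fun_eq_iff indicator_def)
    have fL: "fourier_int x \<in> L2R" by (rule fourier_int_L2R(1)[OF xI x])
    have "L2pos_dist (FRp x) (fourier_int x) = L2pos_dist (FP x) (fourier_int x)"
      unfolding FRp_def ix L2pos_dist_def by (intro arg_cong[where f=sqrt] set_lebesgue_integral_cong) auto
    also have "\<dots> \<le> L2R_dist (FP x) (fourier_int x)"
      by (rule L2pos_dist_le_L2R_dist[OF FP_L2R[OF x] fL])
    also have "\<dots> = 0"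
      using L2R_dist_0_iff[OF FP_L2R[OF x] fL] FP_AE_fourier_int[OF xI x] by simp
    finally have "L2R_dist (log_pullback (FRp x)) (log_pullback (fourier_int x)) = 0"
      using FRp_L2pos[OF xp] L2R_dist_nonneg[of "log_pullback (FRp x)" "log_pullback (fourier_int x)"]
      by (simp add: L2R_dist_log_pullback L2pos_measurable)
    then show ?thesis
      using L2R_dist_0_iff[OF L2R_log_pullback[OF FRp_L2pos[OF xp]] L2R_log_pullback[OF L2pos_of_L2R[OF fL]]] by simp
  qed
  ultimately have "AE s in lborel. log_pullback (FRp x) s = f s"
    by eventually_elim simp
  from FP_cong_AE[OF L2R_log_pullback[OF FRp_L2pos[OF xp]] f(1) this]
  show ?thesis
    using f(2) AE_reflect[OF FP_AE_fourier_int[OF log_pullback_supported_integrable V]]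
    by eventually_elim (simp add: G_def)
qed

end

lemma L2R_dist_F_pm_reflect_le:
  assumes f: "f \<in> L2R" and g: "g \<in> L2R"
  shows "L2R_dist (\<lambda>\<mu>. F_pm \<mu> * f (- \<mu>)) (\<lambda>\<mu>. F_pm \<mu> * g (- \<mu>)) \<le> L2R_dist f g"
proof -
  have d: "(\<lambda>t. f (- t) - g (- t)) \<in> L2R" using f g by (intro L2R_diff L2R_reflect)
  have "L2R_dist (\<lambda>\<mu>. F_pm \<mu> * f (- \<mu>)) (\<lambda>\<mu>. F_pm \<mu> * g (- \<mu>)) \<le> L2R_dist (\<lambda>\<mu>. f (- \<mu>)) (\<lambda>\<mu>. g (- \<mu>))"
    unfolding L2R_dist_def
  proof (intro real_sqrt_le_mono integral_mono)
    show "integrable lborel (\<lambda>t. (cmod (F_pm t * f (- t) - F_pm t * g (- t)))\<^sup>2)"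
      using L2R_integrable[OF L2R_F_pm_mult[OF d]] by (simp add: right_diff_distrib)
    show "integrable lborel (\<lambda>t. (cmod (f (- t) - g (- t)))\<^sup>2)" by (rule L2R_integrable[OF d])
    show "(cmod (F_pm t * f (- t) - F_pm t * g (- t)))\<^sup>2 \<le> (cmod (f (- t) - g (- t)))\<^sup>2" for t
      using mult_right_mono[OF cmod_F_pm[of t] norm_ge_zero[of "f (- t) - g (- t)"]]
      by (intro power_mono) (simp_all add: norm_mult flip: right_diff_distrib)
  qed
  then show ?thesis by (simp add: L2R_dist_reflect)
qed

text \<open>Neither side increases distances, and they agree for \<open>x\<close> supported in a
  compact interval of positive numbers; such functions are dense.\<close>

lemma FP_FRp:
  assumes x: "x \<in> L2pos"
  shows "AE \<mu> in lborel. FP (log_pullback (FRp x)) \<mu> = F_pm \<mu> * FP (log_pullback x) (- \<mu>)"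
proof -
  let ?T = "\<lambda>x. FP (log_pullback (FRp x))" and ?S = "\<lambda>x \<mu>. F_pm \<mu> * FP (log_pullback x) (- \<mu>)"
  have T: "?T z \<in> L2R" and S: "?S z \<in> L2R" if "z \<in> L2pos" for z
    using that by (auto intro!: FP_L2R L2R_log_pullback FRp_L2pos L2R_F_pm_mult L2R_reflect)
  have Td: "L2R_dist (?T z) (?T z') \<le> L2pos_dist z z'" and Sd: "L2R_dist (?S z) (?S z') \<le> L2pos_dist z z'"
    if z: "z \<in> L2pos" "z' \<in> L2pos" for z z'
  proof -
    note V = L2R_log_pullback[OF z(1)] L2R_log_pullback[OF z(2)]
    note W = L2R_log_pullback[OF FRp_L2pos[OF z(1)]] L2R_log_pullback[OF FRp_L2pos[OF z(2)]]
    show "L2R_dist (?T z) (?T z') \<le> L2pos_dist z z'"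
      using FRp_dist_le[OF z] z by (simp add: FP_dist[OF W] L2R_dist_log_pullback L2pos_measurable FRp_L2pos)
    show "L2R_dist (?S z) (?S z') \<le> L2pos_dist z z'"
      using L2R_dist_F_pm_reflect_le[OF FP_L2R[OF V(1)] FP_L2R[OF V(2)]] z
      by (simp add: FP_dist[OF V] L2R_dist_log_pullback L2pos_measurable)
  qed
  define h where "h t = indicator {0<..} t * x t" for t
  have h: "h \<in> L2R" unfolding h_def by (rule L2R_half_line[OF x])
  \<comment> \<open>The lower cut provides the gap a = 1/(n+1) for \<open>FP_FRp_supported\<close>;
    the upper cut makes the function integrable.\<close>
  define r where "r n t = indicator {1 / real (Suc n)..real (Suc n)} t * h t" for n t
  have r: "integrable lborel (r n)" "r n \<in> L2R" for n
    unfolding r_def using L2R_truncate[OF h, of "{1 / real (Suc n)..real (Suc n)}"]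
    by (auto simp: emeasure_lborel_Icc_eq)
  have rp: "r n \<in> L2pos" for n using r by (intro L2pos_of_L2R)
  have eq: "AE \<mu> in lborel. ?T (r n) \<mu> = ?S (r n) \<mu>" for n
    by (rule FP_FRp_supported[OF r(2,1), of "1 / real (Suc n)"]) (auto simp: r_def)
  have "L2R_conv r h"
  proof (rule L2R_dominated_convergence[OF h])
    fix t :: real
    show "(\<lambda>n. r n t) \<longlonglongrightarrow> h t"
    proof (cases "t > 0")
      case True
      have small: "eventually (\<lambda>n. 1 / real (Suc n) < t) sequentially"
        using order_tendstoD(2)[OF LIMSEQ_Suc[OF lim_1_over_n[where 'a=real]] True] by simp
      obtain N :: nat where N: "t \<le> real N" using real_arch_simple by blast
      have "eventually (\<lambda>n. r n t = h t) sequentially"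
        using small eventually_ge_at_top[of N]
        by eventually_elim (use N in \<open>auto simp: r_def indicator_def\<close>)
      then show ?thesis by (rule tendsto_eventually)
    qed (simp add: r_def h_def)
  qed (use h r in \<open>auto simp: r_def indicator_def dest: L2R_measurable\<close>)
  moreover have "L2R_dist (r n) h = L2pos_dist (r n) x" for n
  proof -
    have "r n = (\<lambda>t. indicator {0<..} t * r n t)" by (auto simp: r_def h_def indicator_def)
    then show ?thesis using L2R_dist_half_line[of "r n" x] by (simp add: h_def[abs_def])
  qed
  ultimately have lim: "(\<lambda>n. 2 * L2pos_dist (r n) x) \<longlonglongrightarrow> 2 * 0"
    by (intro tendsto_mult tendsto_const) (simp add: L2R_conv_def)
  have "L2R_dist (?T x) (?S x) \<le> 2 * L2pos_dist (r n) x" for n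
  proof -
    have "L2R_dist (?T x) (?S x) \<le> L2R_dist (?T x) (?T (r n)) + L2R_dist (?T (r n)) (?S x)"
      by (rule L2R_dist_triangle[OF T[OF x] T[OF rp] S[OF x]])
    also have "L2R_dist (?T (r n)) (?S x) = L2R_dist (?S (r n)) (?S x)"
      by (rule L2R_dist_cong_AE[OF T[OF rp] S[OF rp] S[OF x] S[OF x] eq]) simp
    also have "L2R_dist (?T x) (?T (r n)) + \<dots> \<le> L2pos_dist (r n) x + L2pos_dist (r n) x"
      by (subst L2R_dist_commute) (intro add_mono Td Sd rp x)
    finally show ?thesis by simp
  qed
  then have "L2R_dist (?T x) (?S x) \<le> 0"
    using LIMSEQ_le_const[OF lim] by simp
  then have "L2R_dist (?T x) (?S x) = 0" using L2R_dist_nonneg[of "?T x" "?S x"] by linarith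
  then show ?thesis using L2R_dist_0_iff[OF T[OF x] S[OF x]] by simp
qed

theorem theorem3p5:
  shows "(\<forall>x\<in>L2pos. U x \<in> Mspace)
       \<and> (\<forall>x\<in>L2pos. \<forall>y\<in>L2pos. M_inner (U x) (U y) = L2pos_inner x y)
       \<and> (\<forall>z\<in>Mspace. \<exists>x\<in>L2pos. M_eq (U x) z)
       \<and> (\<forall>x\<in>L2pos. L2pos_eq (FRp x) (U_inv (MF (U x))))"
proof (intro conjI ballI)
  fix x assume x: "x \<in> L2pos"
  note R = FRp_L2pos[OF x]
  \<comment> \<open>\<open>glue_MF\<close> reads \<open>U x\<close> at -t and excludes t = 0, hence
    the reflected form of \<open>U_char\<close> and the null set {0}.\<close>
  have "AE t in lborel. glue (U (FRp x)) t = glue (MF (U x)) t"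
    using U_char(2)[OF R] FP_FRp[OF x] AE_reflect[OF U_char(2)[OF x]] AE_lborel_singleton[of "0::real"]
    by eventually_elim (simp add: glue_MF)
  then show "L2pos_eq (FRp x) (U_inv (MF (U x)))"
    by (intro U_inv_eqI R) (simp add: M_eq_glue)
qed (simp_all add: U_char(1) U_inner U_surj)

end
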